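(* Let $n\ge 2$, let $\Omega\subset\mathbb{R}^n$ be a bounded smooth domain, and let $A\in N(\Omega)$ satisfy conditions $(\mathscr{A})$, $(A_1)$ and $(C_1)$. Let $M,\gamma,\gamma_1,\delta$ be positive constants with $\delta\le 2$. Then $$\mathscr{B}(\Omega,M,\gamma,\gamma_1,\delta)\subset C^{0,\alpha}(\Omega),$$ where the constant $\alpha\in(0,1)$ depends only on $n$, $A$, $\gamma$ and $\delta$, and is independent of $\gamma_1$ and $M$.
   Context: **$N$-functions.** An $N$-function is an even, convex, continuous function $A:\mathbb{R}\to[0,+\infty)$ with $A(0)=0$, $A(t)>0$ for $t\ne0$, $\lim_{t\to0+}A(t)/t=0$ and $\lim_{t\to+\infty}A(t)/t=+\infty$. A function $A:\Omega\times\mathbb{R}\to[0,+\infty)$ belongs to $N(\Omega)$ if $A(\cdot,t)$ is measurable for each $t\ge0$ and $A(x,\cdot)$ is an $N$-function for a.e. $x\in\Omega$. **Spaces.** $L^A(\Omega)$ is the set of measurable $u:\Omega\to\mathbb{R}$ with $\int_\Omega A(x,|u(x)|/\lambda)\,dx<\infty$ for some $\lambda>0$, with the Luxemburg norm $\|u\|_A=\inf\{\lambda>0:\int_\Omega A(x,|u|/\lambda)\,dx\le1\}$. $W^{1,A}(\Omega)=\{u\in L^A(\Omega):|\nabla u|\in L^A(\Omega)\}$ with norm $\|u\|_A+\|\,|\nabla u|\,\|_A$. **Condition $(C_1)$:** $\inf_{x\in\Omega}A(x,1)>0$. **Condition $(\mathscr{A})$:** all of the following hold. - $\Omega$ is bounded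 with the cone property; $A:\overline\Omega\times\mathbb{R}\to[0,+\infty)$ is continuous with $A(x,t)\in(0,+\infty)$ for $x\in\overline\Omega$, $t\in(0,+\infty)$. - With $A^{-1}(x,\cdot)$ the inverse of $A(x,\cdot)$ on $[0,\infty)$, $\int_0^1 A^{-1}(x,t)\,t^{-(n+1)/n}\,dt<+\infty$ for all $x\in\overline\Omega$. - Put $A_*^{-1}(x,s)=\int_0^sA^{-1}(x,\tau)\,\tau^{-(n+1)/n}\,d\tau$ for $s\ge0$. Then $T(x):=\lim_{s\to+\infty}A_*^{-1}(x,s)=+\infty$ for all $x\in\overline\Omega$. The Sobolev conjugate $A_*:\overline\Omega\times\mathbb{R}\to[0,\infty)$ is the function, even in $t$, such that $A_*(x,\cdot)|_{[0,\infty)}$ is the inverse of $A_*^{-1}(x,\cdot)$. - $A_*$ is locally Lipschitz on $\overline\Omega\times\mathbb{R}$ and there are positive constants $\delta_0<\frac1n$, $C_0$, $t_0$ with $|\nabla_xA_*(x,t)|\le C_0(A_*(x,t))^{1+\delta_0}$ for all $x\in\Omega$ and $|t|\ge t_0$ at which $\nabla_xA_*(x,t)$ exists. **Condition $(A_1)$:** there is a strictly increasing differentiable $\mathfrak{A}:[0,+\infty)\to[0,+\infty)$ with $n\mathfrak{A}(\alpha)>\alpha\mathfrak{A}'(\alpha)>\mathfrak{A}(\alpha)$ for $\alpha>0$ such that $A(x,\alpha t)\ge\mathfrak{A}(\alpha)A(x,t)$ for all $\alpha\ge0$, $t\in\mathbb{R}$, $x\in\Omega$, and such that each of $\mathfrak{A},\mathfrak{A}^{-1},\mathfrak{A}_*,\widehat{\widetilde{\mathfrak{A}}}$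 belongs to $\Delta_{\mathbb{R}^+}$. Here $\mathfrak{A}_*$ and $\widehat{\widetilde{\mathfrak{A}}}$ are the functions on $[0,\infty)$ whose inverses are $\mathfrak{A}_*^{-1}(\sigma)=\frac{1}{\sigma^{1/n}\mathfrak{A}^{-1}(\sigma^{-1})}$ and $\widehat{\widetilde{\mathfrak{A}}}^{-1}(\sigma)=\sigma\,\mathfrak{A}^{-1}(\sigma^{-1})$ for $\sigma>0$, both equal to $0$ at $\sigma=0$. A function $\mathfrak{C}:\mathbb{R}^+\to\mathbb{R}^+$ is in $\Delta_{\mathbb{R}^+}$ if there is $M_0>0$ with $\mathfrak{C}(\alpha\beta)\le M_0\mathfrak{C}(\alpha)\mathfrak{C}(\beta)$ for all $\alpha,\beta>0$. **The class $\mathscr{B}(\Omega,M,\gamma,\gamma_1,\delta)$.** Throughout $\max$ and $\min$ of measurable functions mean essential supremum and infimum. A function $u$ belongs to this class if $u\in W^{1,A}(\Omega)$, $\max_\Omega|u|\le M$, and both functions $w=u$ and $w=-u$ satisfy $$\int_{\Omega_{k,\sigma\rho}}A(x,|\nabla w|)\,dx\le\gamma\int_{\Omega_{k,\rho}}A\Big(x,\frac{w(x)-k}{(1-\sigma)\rho}\Big)dx+\gamma_1|\Omega_{k,\rho}|$$ for every ball $B_\rho\subset\Omega$, every $\sigma\in(0,1)$ and every $k\ge\max_{B_\rho}w-\delta M$, where $\Omega_{k,r}=\{x\in B_r:w(x)>k\}$, $B_{\sigma\rho}$ is concentric with $B_\rho$, and $|\cdot|$ is Lebesgue measure. **Hölder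 space.** $u\in C^{0,\alpha}(\Omega)$ means that every $x_0\in\Omega$ has a ball $B_{R_0}(x_0)\subset\Omega$ on which (a representative of) $u$ is Hölder continuous with exponent $\alpha$. *)

theory Defs
  imports "HOL-Analysis.Analysis" "HOL-Probability.Essential_Supremum"
begin

section \<open>Smooth functions, smooth domains, cone property\<close>

primrec C_k :: "nat \<Rightarrow> ('a::real_normed_vector \<Rightarrow> real) \<Rightarrow> bool" where
  "C_k 0 f \<longleftrightarrow> continuous_on UNIV f"
| "C_k (Suc k) f \<longleftrightarrow>
     (\<forall>x. f differentiable (at x)) \<and> (\<forall>v. C_k k (\<lambda>x. frechet_derivative f (at x) v))"

definition smooth :: "('a::real_normed_vector \<Rightarrow> real) \<Rightarrow> bool" where
  "smooth f \<longleftrightarrow> (\<forall>k. C_k k f)"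

text \<open>
  Near each boundary point, \<open>\<Omega>\<close> is the region above the graph of a smooth function, in
  orthonormal coordinates whose last axis is the unit vector \<open>e\<close>: the height of \<open>y\<close> is
  \<open>y \<bullet> e\<close>, and \<open>y - (y \<bullet> e) *\<^sub>R e\<close> stands for its first \<open>n - 1\<close> coordinates. Only the values of
  \<open>g\<close> on the hyperplane orthogonal to \<open>e\<close> matter.
\<close>

definition smooth_boundary :: "'a::euclidean_space set \<Rightarrow> bool" where
  "smooth_boundary \<Omega> \<longleftrightarrow>
     (\<forall>z\<in>frontier \<Omega>. \<exists>r>0. \<exists>e g. norm e = 1 \<and> smooth g \<and>
        \<Omega> \<inter> ball z r = {y \<in> ball z r. g (y - (y \<bullet> e) *\<^sub>R e) < y \<bullet> e})"

definition smooth_domain :: "'a::euclidean_space set \<Rightarrow> bool" where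
  "smooth_domain \<Omega> \<longleftrightarrow> open \<Omega> \<and> connected \<Omega> \<and> \<Omega> \<noteq> {} \<and> smooth_boundary \<Omega>"

text \<open>
  The finite cone with vertex \<open>x\<close>, axis direction \<open>e\<close> (a unit vector), height \<open>r\<close> and
  aperture angle \<open>2 * \<theta>\<close>; the inequality says that \<open>y = 0\<close> or the angle between \<open>y\<close> and \<open>e\<close>
  is at most \<open>\<theta>\<close>.
\<close>

definition finite_cone :: "'a::euclidean_space \<Rightarrow> 'a \<Rightarrow> real \<Rightarrow> real \<Rightarrow> 'a set" where
  "finite_cone x e r \<theta> = {x + y | y. norm y \<le> r \<and> norm y * cos \<theta> \<le> y \<bullet> e}"

definition cone_property :: "'a::euclidean_space set \<Rightarrow> bool" where
  "cone_property \<Omega> \<longleftrightarrow>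
     (\<exists>r \<theta>. 0 < r \<and> 0 < \<theta> \<and> \<theta> \<le> pi / 2 \<and>
        (\<forall>x\<in>\<Omega>. \<exists>e. norm e = 1 \<and> finite_cone x e r \<theta> \<subseteq> \<Omega>))"


section \<open>Weak gradients\<close>

definition test_function :: "'a::euclidean_space set \<Rightarrow> ('a \<Rightarrow> real) \<Rightarrow> bool" where
  "test_function \<Omega> \<phi> \<longleftrightarrow>
     smooth \<phi> \<and> compact (closure (support_on UNIV \<phi>)) \<and> closure (support_on UNIV \<phi>) \<subseteq> \<Omega>"

definition locally_integrable ::
    "'a::euclidean_space set \<Rightarrow> ('a \<Rightarrow> 'b::euclidean_space) \<Rightarrow> bool" where
  "locally_integrable \<Omega> f \<longleftrightarrow>
     f \<in> borel_measurable (lebesgue_on \<Omega>) \<and>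
     (\<forall>K. compact K \<and> K \<subseteq> \<Omega> \<longrightarrow> set_integrable lebesgue K f)"

definition has_weak_gradient ::
    "'a::euclidean_space set \<Rightarrow> ('a \<Rightarrow> real) \<Rightarrow> ('a \<Rightarrow> 'a) \<Rightarrow> bool" where
  "has_weak_gradient \<Omega> u g \<longleftrightarrow>
     locally_integrable \<Omega> u \<and> locally_integrable \<Omega> g \<and>
     (\<forall>\<phi>. test_function \<Omega> \<phi> \<longrightarrow>
        (\<forall>i\<in>Basis. (LINT x:\<Omega>|lebesgue. u x * frechet_derivative \<phi> (at x) i) =
                 - (LINT x:\<Omega>|lebesgue. (g x \<bullet> i) * \<phi> x)))"

text \<open>The weak gradient is determined up to a null set; any version may be chosen.\<close>

definition weak_gradient ::
    "'a::euclidean_space set \<Rightarrow> ('a \<Rightarrow> real) \<Rightarrow> 'a \<Rightarrow> 'a" where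
  "weak_gradient \<Omega> u = (SOME g. has_weak_gradient \<Omega> u g)"


section \<open>Generalized N-functions and Musielak-Orlicz-Sobolev spaces\<close>

definition N_function :: "(real \<Rightarrow> real) \<Rightarrow> bool" where
  "N_function A \<longleftrightarrow>
     (\<forall>t. A (- t) = A t) \<and> convex_on UNIV A \<and> continuous_on UNIV A \<and>
     A 0 = 0 \<and> (\<forall>t. t \<noteq> 0 \<longrightarrow> 0 < A t) \<and>
     ((\<lambda>t. A t / t) \<longlongrightarrow> 0) (at_right 0) \<and>
     filterlim (\<lambda>t. A t / t) at_top at_top"

definition N_class :: "'a::euclidean_space set \<Rightarrow> ('a \<Rightarrow> real \<Rightarrow> real) set" where
  "N_class \<Omega> =
     {A. (\<forall>x\<in>\<Omega>. \<forall>t. 0 \<le> A x t) \<and>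
         (\<forall>t\<ge>0. (\<lambda>x. A x t) \<in> borel_measurable (lebesgue_on \<Omega>)) \<and>
         (AE x in lebesgue_on \<Omega>. N_function (A x))}"

definition L_space ::
    "'a::euclidean_space set \<Rightarrow> ('a \<Rightarrow> real \<Rightarrow> real) \<Rightarrow> ('a \<Rightarrow> real) set" where
  "L_space \<Omega> A =
     {u. u \<in> borel_measurable (lebesgue_on \<Omega>) \<and>
         (\<exists>c>0. (\<integral>\<^sup>+x\<in>\<Omega>. ennreal (A x (\<bar>u x\<bar> / c)) \<partial>lebesgue) < \<infinity>)}"

definition W1_space ::
    "'a::euclidean_space set \<Rightarrow> ('a \<Rightarrow> real \<Rightarrow> real) \<Rightarrow> ('a \<Rightarrow> real) set" where
  "W1_space \<Omega> A =
     {u. u \<in> L_space \<Omega> A \<and> (\<exists>g. has_weak_gradient \<Omega> u g) \<and>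
         (\<lambda>x. norm (weak_gradient \<Omega> u x)) \<in> L_space \<Omega> A}"


section \<open>The structural conditions on A\<close>

definition cond_C1 :: "'a::euclidean_space set \<Rightarrow> ('a \<Rightarrow> real \<Rightarrow> real) \<Rightarrow> bool" where
  "cond_C1 \<Omega> A \<longleftrightarrow> (INF x\<in>\<Omega>. A x 1) > 0"

text \<open>
  Inverse on \<open>[0, \<infinity>)\<close>; meaningful when the function is a bijection of \<open>[0, \<infinity>)\<close> onto itself,
  which the conditions below guarantee wherever it is used.
\<close>

abbreviation nonneg_inverse :: "(real \<Rightarrow> real) \<Rightarrow> real \<Rightarrow> real" where
  "nonneg_inverse f \<equiv> inv_into {0..} f"

definition sobolev_integrand ::
    "(real^'n \<Rightarrow> real \<Rightarrow> real) \<Rightarrow> real^'n \<Rightarrow> real \<Rightarrow> real" where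
  "sobolev_integrand A x t =
     nonneg_inverse (A x) t * t powr (- (real (CARD('n) + 1) / real CARD('n)))"

definition sobolev_conj_inv ::
    "(real^'n \<Rightarrow> real \<Rightarrow> real) \<Rightarrow> real^'n \<Rightarrow> real \<Rightarrow> real" where
  "sobolev_conj_inv A x s = (LINT t:{0..s}|lborel. sobolev_integrand A x t)"

definition sobolev_conj ::
    "(real^'n \<Rightarrow> real \<Rightarrow> real) \<Rightarrow> real^'n \<Rightarrow> real \<Rightarrow> real" where
  "sobolev_conj A x t = nonneg_inverse (sobolev_conj_inv A x) \<bar>t\<bar>"

definition locally_lipschitz_on ::
    "'a::metric_space set \<Rightarrow> ('a \<Rightarrow> 'b::metric_space) \<Rightarrow> bool" where
  "locally_lipschitz_on S f \<longleftrightarrow> (\<forall>p\<in>S. \<exists>r>0. \<exists>L. L-lipschitz_on (S \<inter> ball p r) f)"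

definition cond_A :: "(real^'n) set \<Rightarrow> (real^'n \<Rightarrow> real \<Rightarrow> real) \<Rightarrow> bool" where
  "cond_A \<Omega> A \<longleftrightarrow>
     bounded \<Omega> \<and> cone_property \<Omega> \<and>
     continuous_on (closure \<Omega> \<times> UNIV) (\<lambda>(x, t). A x t) \<and>
     (\<forall>x\<in>closure \<Omega>. \<forall>t. 0 \<le> A x t) \<and>
     (\<forall>x\<in>closure \<Omega>. \<forall>t>0. 0 < A x t) \<and>
     (\<forall>x\<in>closure \<Omega>. (\<integral>\<^sup>+t\<in>{0..1}. ennreal (sobolev_integrand A x t) \<partial>lborel) < \<infinity>) \<and>
     (\<forall>x\<in>closure \<Omega>. filterlim (sobolev_conj_inv A x) at_top at_top) \<and>
     locally_lipschitz_on (closure \<Omega> \<times> UNIV) (\<lambda>(x, t). sobolev_conj A x t) \<and>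
     (\<exists>\<delta>\<^sub>0 C\<^sub>0 t\<^sub>0. 0 < \<delta>\<^sub>0 \<and> \<delta>\<^sub>0 < 1 / real CARD('n) \<and> 0 < C\<^sub>0 \<and> 0 < t\<^sub>0 \<and>
        (\<forall>x\<in>\<Omega>. \<forall>t D. t\<^sub>0 \<le> \<bar>t\<bar> \<and> (GDERIV (\<lambda>y. sobolev_conj A y t) x :> D) \<longrightarrow>
           norm D \<le> C\<^sub>0 * sobolev_conj A x t powr (1 + \<delta>\<^sub>0)))"

text \<open>
  In \<open>cond_A\<close>, the gradient of \<open>A\<^sub>*\<close> in \<open>x\<close> is required to obey the bound only at points
  where \<open>A\<^sub>*(\<cdot>, t)\<close> is Frechet differentiable. In \<open>cond_A1\<close>, \<open>F\<close> is the gauge often written as a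
  fraktur A, while \<open>frak_star_inv\<close> and \<open>frak_hat_tilde_inv\<close> are the inverses of its two
  derived gauges.
\<close>

definition Delta_Rplus :: "(real \<Rightarrow> real) \<Rightarrow> bool" where
  "Delta_Rplus F \<longleftrightarrow> (\<exists>M\<^sub>0>0. \<forall>\<alpha>>0. \<forall>\<beta>>0. F (\<alpha> * \<beta>) \<le> M\<^sub>0 * F \<alpha> * F \<beta>)"

definition frak_star_inv :: "nat \<Rightarrow> (real \<Rightarrow> real) \<Rightarrow> real \<Rightarrow> real" where
  "frak_star_inv n F \<sigma> =
     (if \<sigma> = 0 then 0 else 1 / (\<sigma> powr (1 / real n) * nonneg_inverse F (1 / \<sigma>)))"

definition frak_hat_tilde_inv :: "(real \<Rightarrow> real) \<Rightarrow> real \<Rightarrow> real" where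
  "frak_hat_tilde_inv F \<sigma> = (if \<sigma> = 0 then 0 else \<sigma> * nonneg_inverse F (1 / \<sigma>))"

definition cond_A1 :: "(real^'n) set \<Rightarrow> (real^'n \<Rightarrow> real \<Rightarrow> real) \<Rightarrow> bool" where
  "cond_A1 \<Omega> A \<longleftrightarrow>
     (\<exists>F. F \<in> {0..} \<rightarrow> {0..} \<and> strict_mono_on {0..} F \<and> F differentiable_on {0..} \<and>
        (\<forall>\<alpha>>0. real CARD('n) * F \<alpha> > \<alpha> * deriv F \<alpha> \<and> \<alpha> * deriv F \<alpha> > F \<alpha>) \<and>
        (\<forall>\<alpha>\<ge>0. \<forall>t. \<forall>x\<in>\<Omega>. A x (\<alpha> * t) \<ge> F \<alpha> * A x t) \<and>
        Delta_Rplus F \<and>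
        Delta_Rplus (nonneg_inverse F) \<and>
        Delta_Rplus (nonneg_inverse (frak_star_inv CARD('n) F)) \<and>
        Delta_Rplus (nonneg_inverse (frak_hat_tilde_inv F)))"


section \<open>The De Giorgi type class and the Hoelder space\<close>

definition superlevel :: "('a::euclidean_space \<Rightarrow> real) \<Rightarrow> real \<Rightarrow> 'a \<Rightarrow> real \<Rightarrow> 'a set" where
  "superlevel w k y r = {x \<in> ball y r. w x > k}"

definition class_B ::
    "'a::euclidean_space set \<Rightarrow> ('a \<Rightarrow> real \<Rightarrow> real) \<Rightarrow> real \<Rightarrow> real \<Rightarrow> real \<Rightarrow> real \<Rightarrow> ('a \<Rightarrow> real) set"
  where
  "class_B \<Omega> A M \<gamma> \<gamma>\<^sub>1 \<delta> =
     {u. u \<in> W1_space \<Omega> A \<and>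
         esssup (lebesgue_on \<Omega>) (\<lambda>x. ereal \<bar>u x\<bar>) \<le> ereal M \<and>
         (\<forall>w\<in>{u, \<lambda>x. - u x}. \<forall>y. \<forall>\<rho>>0. ball y \<rho> \<subseteq> \<Omega> \<longrightarrow>
            (\<forall>\<sigma>\<in>{0<..<1}. \<forall>k.
               ereal k \<ge> esssup (lebesgue_on (ball y \<rho>)) (\<lambda>x. ereal (w x)) - ereal (\<delta> * M) \<longrightarrow>
               (\<integral>\<^sup>+x\<in>superlevel w k y (\<sigma> * \<rho>).
                    ennreal (A x (norm (weak_gradient \<Omega> w x))) \<partial>lebesgue)
               \<le> ennreal \<gamma> * (\<integral>\<^sup>+x\<in>superlevel w k y \<rho>.
                    ennreal (A x ((w x - k) / ((1 - \<sigma>) * \<rho>))) \<partial>lebesgue)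
                 + ennreal \<gamma>\<^sub>1 * emeasure lebesgue (superlevel w k y \<rho>)))}"

definition C_Hoelder :: "'a::euclidean_space set \<Rightarrow> real \<Rightarrow> ('a \<Rightarrow> real) set" where
  "C_Hoelder \<Omega> \<alpha> =
     {u. \<forall>x\<^sub>0\<in>\<Omega>. \<exists>R\<^sub>0>0. ball x\<^sub>0 R\<^sub>0 \<subseteq> \<Omega> \<and>
         (\<exists>v C. (AE x in lebesgue_on \<Omega>. v x = u x) \<and>
            (\<forall>x\<in>ball x\<^sub>0 R\<^sub>0. \<forall>y\<in>ball x\<^sub>0 R\<^sub>0. \<bar>v x - v y\<bar> \<le> C * dist x y powr \<alpha>))}"

end

theory Submission
  imports Defs
begin

text \<open>
  The conditions sandwich \<open>A(x, t)\<close> between multiples of the single gauge \<open>F\<close> of \<open>cond_A1\<close>,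
  which is both sub- and supermultiplicative up to a constant and superlinear at infinity, so the
  membership in the class becomes a Caccioppoli inequality for \<open>F(|\<nabla>w|)\<close>. A quasi-Young
  inequality \<open>a \<le> L s + \<epsilon> s F(a) / F(s)\<close> turns it into a bound on the \<open>L\<^sup>1\<close> norm of the gradient
  between two levels. Instead of the Sobolev inequality, an isoperimetric inequality is used: almost
  every segment from \<open>{w \<le> k}\<close> to \<open>{w > l}\<close> crosses the levels in between, and integrating this
  over all pairs of end points bounds \<open>|{w \<le> k}| |{w > l}|\<close> by the \<open>L\<^sup>1\<close> norm of the gradient on
  \<open>{k < w < l}\<close>, with a power gain when \<open>|{w > l}|\<close> is small. De Giorgi's iteration then gives a
  geometric decay of the oscillation; the term with \<open>\<gamma>\<^sub>1\<close> and the bound \<open>M\<close> only enter the size of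
  the oscillation, not its rate.
\<close>

section \<open>Smooth bump functions on boxes\<close>

text \<open>The weak gradient is known only through smooth test functions. Instead of a chain rule
  for truncations, the proof recovers the fundamental theorem of calculus on almost every segment by
  testing with shifted bumps; levels are then cut on a continuous function of one variable, never on
  a Sobolev function. The energy controls \<open>F\<close> of the gradient, not a power of it, so
  Hoelder's inequality cannot trade energy for measure. The quasi-Young inequality does so because
  its \<open>L\<close> does not depend on the scale \<open>s\<close>: with \<open>s\<close> the
  ratio of a level gap to a radius, \<open>F s\<close> cancels and only ratios of measures survive.
  The term with \<open>\<gamma>\<^sub>1\<close> is absorbed through a slope \<open>K\<close> with
  \<open>C\<^sub>2 \<le> F K\<close>: it is harmless while the level gap exceeds \<open>K\<close>
  times the radius, and otherwise the oscillation is already of the order of the radius, which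
  decays faster than required. As the exponent has to be chosen before \<open>M\<close> and
  \<open>\<gamma>\<^sub>1\<close>, the central lemmas fix their constants first and quantify over
  the function, \<open>C\<^sub>2\<close>, \<open>K\<close> and the radius inside.\<close>

lemma C_k_Suc_I:
  assumes "\<And>x. (f has_derivative D x) (at x)" and "\<And>v. C_k k (\<lambda>x. D x v)"
  shows "C_k (Suc k) f"
proof -
  have "frechet_derivative f (at x) = D x" for x
    using frechet_derivative_at[OF assms(1)[of x]] by simp
  then show ?thesis
    using assms by (auto simp: differentiable_def)
qed

lemma C_k_Suc_has_derivative:
  assumes "C_k (Suc k) f"
  shows "(f has_derivative frechet_derivative f (at x)) (at x)"
  using assms by (simp add: frechet_derivative_works)

lemma C_k_SucD: "C_k (Suc k) f \<Longrightarrow> C_k k f"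
proof (induction k arbitrary: f)
  case 0
  then have "f differentiable_on UNIV"
    by (simp add: differentiable_on_def)
  then show ?case
    by (simp add: differentiable_imp_continuous_on)
next
  case (Suc k)
  then show ?case
    by (metis C_k.simps(2))
qed

lemma C_k_const: "C_k k (\<lambda>x. c)"
proof (induction k arbitrary: c)
  case (Suc k)
  show ?case by (rule C_k_Suc_I[where D = "\<lambda>_ _. 0"]) (auto intro: Suc)
qed simp

lemma C_k_add: "C_k k f \<Longrightarrow> C_k k g \<Longrightarrow> C_k k (\<lambda>x. f x + g x)"
proof (induction k arbitrary: f g)
  case 0
  then show ?case by (simp add: continuous_on_add)
next
  case (Suc k)
  show ?case
    by (rule C_k_Suc_I[OF has_derivative_add[OF C_k_Suc_has_derivative[OF Suc.prems(1)]
            C_k_Suc_has_derivative[OF Suc.prems(2)]]]) (use Suc in auto)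
qed

text \<open>In each term of the product rule one factor has been differentiated and has only
  \<open>k\<close> derivatives left, while the other still has \<open>Suc k\<close>;
  \<open>C_k_SucD\<close> brings both to the same order.\<close>

lemma C_k_mult: "C_k k f \<Longrightarrow> C_k k g \<Longrightarrow> C_k k (\<lambda>x. f x * g x)"
proof (induction k arbitrary: f g)
  case 0
  then show ?case by (simp add: continuous_on_mult)
next
  case (Suc k)
  show ?case
  proof (rule C_k_Suc_I[OF has_derivative_mult[OF C_k_Suc_has_derivative[OF Suc.prems(1)]
            C_k_Suc_has_derivative[OF Suc.prems(2)]]], rule C_k_add)
    fix v
    show "C_k k (\<lambda>x. f x * frechet_derivative g (at x) v)"
      by (rule Suc.IH) (use Suc.prems C_k_SucD[OF Suc.prems(1)] in auto)
    show "C_k k (\<lambda>x. frechet_derivative f (at x) v * g x)"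
      by (rule Suc.IH) (use Suc.prems C_k_SucD[OF Suc.prems(2)] in auto)
  qed
qed

lemma C_k_cmult: "C_k k f \<Longrightarrow> C_k k (\<lambda>x. c * f x)"
  by (intro C_k_mult C_k_const)

lemma C_k_prod:
  "finite I \<Longrightarrow> (\<And>i. i \<in> I \<Longrightarrow> C_k k (f i)) \<Longrightarrow> C_k k (\<lambda>x. \<Prod>i\<in>I. f i x)"
  by (induction I rule: finite_induct) (auto intro!: C_k_const C_k_mult)

lemma has_derivative_shift:
  fixes f :: "'a::real_normed_vector \<Rightarrow> real"
  assumes "(f has_derivative D) (at (x - c))"
  shows "((\<lambda>x. f (x - c)) has_derivative D) (at x)"
proof -
  have "((\<lambda>x. x - c) has_derivative (\<lambda>x. x)) (at x)"
    by (auto intro!: derivative_eq_intros)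
  from has_derivative_compose[OF this assms] show ?thesis
    by simp
qed

lemma C_k_shift: "C_k k f \<Longrightarrow> C_k k (\<lambda>x. f (x - c))"
proof (induction k arbitrary: f)
  case 0
  then have "continuous_on UNIV f" by simp
  then have "continuous_on UNIV (\<lambda>x. f (x - c))"
    by (rule continuous_on_compose2) (auto intro!: continuous_intros)
  then show ?case by simp
next
  case (Suc k)
  show ?case
    by (rule C_k_Suc_I[OF has_derivative_shift[OF C_k_Suc_has_derivative[OF Suc.prems]]])
      (use Suc in auto)
qed

text \<open>This is t^(-j) exp (-1/t), continued by 0. The factor t^(-j) closes the family under
  differentiation: the derivative of \<open>flat j\<close> is a combination of
  \<open>flat (j + 2)\<close> and \<open>flat (j + 1)\<close>, so smoothness follows by induction
  for all \<open>j\<close> at once.\<close>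

definition flat :: "nat \<Rightarrow> real \<Rightarrow> real" where
  "flat j t = (if t \<le> 0 then 0 else (1 / t) ^ j / exp (1 / t))"

lemma flat_tendsto_0: "(flat j \<longlongrightarrow> 0) (at_right 0)"
proof -
  have "filterlim (\<lambda>t::real. 1 / t) at_top (at_right 0)"
    using filterlim_inverse_at_top_right by (simp add: inverse_eq_divide)
  from filterlim_compose[OF tendsto_power_div_exp_0[of j] this]
  have "((\<lambda>t::real. (1 / t) ^ j / exp (1 / t)) \<longlongrightarrow> 0) (at_right 0)" .
  then show ?thesis
    by (rule Lim_transform_eventually)
      (auto simp: flat_def eventually_at_filter)
qed

text \<open>Only t = 0 needs a limit: there the right difference quotient of \<open>flat j\<close>
  is \<open>flat (Suc j)\<close>, which tends to 0, and the left one is 0.\<close>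

lemma flat_has_derivative:
  "(flat j has_real_derivative (flat (j + 2) t - real j * flat (j + 1) t)) (at t)"
proof -
  consider "t < 0" | "t = 0" | "t > 0" by linarith
  then show ?thesis
  proof cases
    case 1
    have "(flat j has_real_derivative 0) (at t)"
      by (rule has_field_derivative_transform_within_open[where f = "\<lambda>_. 0" and S = "{..<0}"])
        (use 1 in \<open>auto simp: flat_def\<close>)
    then show ?thesis using 1 by (simp add: flat_def)
  next
    case 3
    have inv: "((\<lambda>t. 1 / t) has_real_derivative - ((1 / t)\<^sup>2)) (at t)"
      using 3 by (auto intro!: derivative_eq_intros simp: power2_eq_square divide_simps)
    have pw: "((\<lambda>x::real. x ^ j * exp (- x)) has_real_derivative
        (real j * x ^ (j - 1) * exp (- x) - x ^ j * exp (- x))) (at x)" for x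
      by (auto intro!: derivative_eq_intros)
    \<comment> \<open>For \<open>j = 0\<close> the truncated exponent \<open>j - 1\<close> is wrong,
      but the factor \<open>real j\<close> makes both sides 0.\<close>
    have eq: "real j * x ^ (j - 1) * x\<^sup>2 = real j * x ^ (j + 1)" for x :: real
      by (cases j) (simp_all add: power2_eq_square)
    have alg: "(real j * x ^ (j - 1) * e - x ^ j * e) * - (x\<^sup>2)
        = x ^ (j + 2) * e - (real j * x ^ (j - 1) * x\<^sup>2) * e" for x e :: real
      by (simp add: algebra_simps power_add power2_eq_square)
    have "((\<lambda>t. (1 / t) ^ j * exp (- (1 / t))) has_real_derivative
        (real j * (1 / t) ^ (j - 1) * exp (- (1 / t)) - (1 / t) ^ j * exp (- (1 / t))) * - ((1 / t)\<^sup>2)) (at t)"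
      by (rule DERIV_chain2[OF pw inv])
    also have "(real j * (1 / t) ^ (j - 1) * exp (- (1 / t)) - (1 / t) ^ j * exp (- (1 / t))) * - ((1 / t)\<^sup>2)
        = (1 / t) ^ (j + 2) * exp (- (1 / t)) - (real j * (1 / t) ^ (j - 1) * (1 / t)\<^sup>2) * exp (- (1 / t))"
      by (rule alg)
    also have "\<dots> = flat (j + 2) t - real j * flat (j + 1) t"
      unfolding eq using 3 by (simp add: flat_def exp_minus field_simps)
    finally show ?thesis
      by (rule has_field_derivative_transform_within_open[where S = "{0<..}"])
        (use 3 in \<open>auto simp: flat_def exp_minus field_simps\<close>)
  next
    case 2
    have "((\<lambda>h. (flat j h - flat j 0) / (h - 0)) \<longlongrightarrow> 0) (at 0)"
    proof (rule filterlim_split_at)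
      have l: "\<forall>\<^sub>F h in at_left 0. 0 = (flat j h - flat j 0) / (h - 0)"
        by (auto simp: flat_def eventually_at_filter)
      show "((\<lambda>h. (flat j h - flat j 0) / (h - 0)) \<longlongrightarrow> 0) (at_left 0)"
        by (rule Lim_transform_eventually[OF tendsto_const l])
      have "flat (Suc j) h = (flat j h - flat j 0) / (h - 0)" if "h > 0" for h
        using that by (simp add: flat_def)
      then have r: "\<forall>\<^sub>F h in at_right 0. flat (Suc j) h = (flat j h - flat j 0) / (h - 0)"
        by (auto simp: eventually_at_filter)
      show "((\<lambda>h. (flat j h - flat j 0) / (h - 0)) \<longlongrightarrow> 0) (at_right 0)"
        by (rule Lim_transform_eventually[OF flat_tendsto_0 r])
    qed
    then show ?thesis
      using 2 by (simp add: has_field_derivative_iff flat_def)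
  qed
qed

lemma flat_nonneg: "0 \<le> flat j t"
  by (simp add: flat_def)

lemma flat_0_le_1: "flat 0 t \<le> 1"
  by (simp add: flat_def)

lemma C_k_flat: "C_k k (\<lambda>x::'a::euclidean_space. flat j (x \<bullet> v + d))"
proof (induction k arbitrary: j)
  case 0
  have "continuous_on UNIV (flat j)"
    using flat_has_derivative by (meson DERIV_isCont continuous_at_imp_continuous_on)
  moreover have "continuous_on UNIV (\<lambda>x::'a. x \<bullet> v + d)"
    by (intro continuous_intros)
  ultimately have "continuous_on UNIV (\<lambda>x::'a. flat j (x \<bullet> v + d))"
    by (rule continuous_on_compose2) simp
  then show ?case by simp
next
  case (Suc k)
  show ?case
  proof (rule C_k_Suc_I)
    fix x :: 'a
    have "((\<lambda>x. x \<bullet> v + d) has_derivative (\<lambda>h. h \<bullet> v)) (at x)"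
      by (auto intro!: derivative_eq_intros)
    from has_derivative_compose[OF this flat_has_derivative[unfolded has_field_derivative_def]]
    show "((\<lambda>x. flat j (x \<bullet> v + d)) has_derivative
       (\<lambda>h. (flat (j + 2) (x \<bullet> v + d) - real j * flat (j + 1) (x \<bullet> v + d)) * (h \<bullet> v))) (at x)" .
  next
    fix h :: 'a
    have "C_k k (\<lambda>x. (h \<bullet> v) * flat (j + 2) (x \<bullet> v + d) + ((h \<bullet> v) * - real j) * flat (j + 1) (x \<bullet> v + d))"
      by (intro C_k_add C_k_cmult Suc)
    moreover have "(\<lambda>x. (h \<bullet> v) * flat (j + 2) (x \<bullet> v + d) + ((h \<bullet> v) * - real j) * flat (j + 1) (x \<bullet> v + d))
        = (\<lambda>x. (flat (j + 2) (x \<bullet> v + d) - real j * flat (j + 1) (x \<bullet> v + d)) * (h \<bullet> v))"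
      by (rule ext) (simp add: left_diff_distrib)
    ultimately show "C_k k (\<lambda>x. (flat (j + 2) (x \<bullet> v + d) - real j * flat (j + 1) (x \<bullet> v + d)) * (h \<bullet> v))"
      by simp
  qed
qed

text \<open>The support stays in the same closed box for every \<open>m\<close>; only the steepness
  at the faces grows. Inside the box each argument tends to infinity with \<open>m\<close> and
  \<open>flat 0\<close> tends to 1, so the bumps converge to the indicator of the box.
  \<open>Suc m\<close> keeps the scale positive.\<close>

definition box_bump :: "'a::euclidean_space \<Rightarrow> 'a \<Rightarrow> nat \<Rightarrow> 'a \<Rightarrow> real" where
  "box_bump a b m x =
     (\<Prod>i\<in>Basis. flat 0 (real (Suc m) * (x \<bullet> i - a \<bullet> i)) * flat 0 (real (Suc m) * (b \<bullet> i - x \<bullet> i)))"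

lemma smooth_box_bump: "smooth (box_bump a b m)"
  unfolding smooth_def
proof
  fix k
  have *: "C_k k (\<lambda>x::'a. flat 0 (real (Suc m) * (x \<bullet> i - a \<bullet> i))
      * flat 0 (real (Suc m) * (b \<bullet> i - x \<bullet> i)))" for i
  proof -
    define c where "c = real (Suc m)"
    have eq: "c * (x \<bullet> i - a \<bullet> i) = x \<bullet> (c *\<^sub>R i) + (- (c * (a \<bullet> i)))"
      "c * (b \<bullet> i - x \<bullet> i) = x \<bullet> ((- c) *\<^sub>R i) + c * (b \<bullet> i)" for x
      by (simp_all add: right_diff_distrib)
    show ?thesis
      unfolding c_def[symmetric] eq by (rule C_k_mult[OF C_k_flat C_k_flat])
  qed
  have "C_k k (\<lambda>x::'a. \<Prod>i\<in>Basis. flat 0 (real (Suc m) * (x \<bullet> i - a \<bullet> i))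
      * flat 0 (real (Suc m) * (b \<bullet> i - x \<bullet> i)))"
    by (rule C_k_prod[where f = "\<lambda>i x. flat 0 (real (Suc m) * (x \<bullet> i - a \<bullet> i))
      * flat 0 (real (Suc m) * (b \<bullet> i - x \<bullet> i))", OF finite_Basis *])
  then show "C_k k (box_bump a b m)"
    unfolding box_bump_def[abs_def] .
qed

lemma box_bump_nonneg: "0 \<le> box_bump a b m x"
  unfolding box_bump_def by (simp add: prod_nonneg flat_nonneg)

lemma box_bump_le_1: "box_bump a b m x \<le> 1"
  unfolding box_bump_def
  by (intro prod_le_1) (auto simp: flat_nonneg flat_0_le_1 intro!: mult_le_one)

lemma box_bump_eq_0:
  assumes "x \<notin> box a b"
  shows "box_bump a b m x = 0"
proof -
  obtain i where i: "i \<in> Basis" "x \<bullet> i - a \<bullet> i \<le> 0 \<or> b \<bullet> i - x \<bullet> i \<le> 0"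
    using assms by (force simp: mem_box)
  then have "flat 0 (real (Suc m) * (x \<bullet> i - a \<bullet> i)) * flat 0 (real (Suc m) * (b \<bullet> i - x \<bullet> i)) = 0"
    by (auto simp: flat_def mult_le_0_iff)
  then show ?thesis
    unfolding box_bump_def using i(1) by (intro prod_zero) auto
qed

lemma flat_scale_tendsto_1:
  assumes "t > 0"
  shows "(\<lambda>m. flat 0 (real (Suc m) * t)) \<longlonglongrightarrow> 1"
proof -
  have "(\<lambda>m. 1 / exp (inverse t * inverse (real (Suc m)))) \<longlonglongrightarrow> 1 / exp (inverse t * 0)"
    by (intro tendsto_intros LIMSEQ_inverse_real_of_nat) auto
  moreover have "flat 0 (real (Suc m) * t) = 1 / exp (inverse t * inverse (real (Suc m)))" for m
  proof -
    have "0 < real (Suc m) * t" using assms by simp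
    then show ?thesis by (simp add: flat_def inverse_eq_divide mult.commute not_le del: of_nat_Suc)
  qed
  ultimately show ?thesis by simp
qed

lemma box_bump_tendsto: "(\<lambda>m. box_bump a b m x) \<longlonglongrightarrow> indicator (box a b) x"
proof (cases "x \<in> box a b")
  case True
  have "(\<lambda>m. box_bump a b m x) \<longlonglongrightarrow> (\<Prod>i\<in>(Basis::'a set). 1 * 1)"
    unfolding box_bump_def
    by (intro tendsto_prod tendsto_mult flat_scale_tendsto_1) (use True in \<open>auto simp: mem_box\<close>)
  then show ?thesis using True by simp
next
  case False
  then show ?thesis by (simp add: box_bump_eq_0)
qed

lemma test_function_box_bump:
  assumes "cbox a b \<subseteq> U"
  shows "test_function U (box_bump a b m)"
proof -
  have "support_on UNIV (box_bump a b m) \<subseteq> cbox a b"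
    using box_bump_eq_0[of _ a b m] box_subset_cbox by (force simp: in_support_on)
  then have "closure (support_on UNIV (box_bump a b m)) \<subseteq> cbox a b"
    using closure_minimal closed_cbox by blast
  then show ?thesis
    unfolding test_function_def using assms smooth_box_bump
    by (metis bounded_cbox bounded_subset closed_closure compact_eq_bounded_closed dual_order.trans)
qed

section \<open>Translation, bounds and vanishing of test functions\<close>

lemma test_function_shift:
  assumes "test_function U \<phi>"
  shows "test_function ((+) c ` U) (\<lambda>x. \<phi> (x - c))"
proof -
  have eq: "support_on UNIV (\<lambda>x. \<phi> (x - c)) = (+) c ` support_on UNIV \<phi>"
  proof (intro set_eqI iffI)
    fix x assume "x \<in> support_on UNIV (\<lambda>x. \<phi> (x - c))"
    then show "x \<in> (+) c ` support_on UNIV \<phi>"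
      by (intro image_eqI[of _ _ "x - c"]) (auto simp: in_support_on)
  qed (auto simp: in_support_on)
  have "closure (support_on UNIV (\<lambda>x. \<phi> (x - c))) = (+) c ` closure (support_on UNIV \<phi>)"
    unfolding eq by (rule closure_translation)
  then show ?thesis
    using assms by (auto simp: test_function_def smooth_def C_k_shift compact_translation)
qed

lemma test_function_mono: "test_function U \<phi> \<Longrightarrow> U \<subseteq> V \<Longrightarrow> test_function V \<phi>"
  by (auto simp: test_function_def)

lemma test_function_has_derivative:
  assumes "test_function U \<phi>"
  shows "(\<phi> has_derivative frechet_derivative \<phi> (at x)) (at x)"
proof -
  have "C_k (Suc 0) \<phi>" using assms by (simp add: test_function_def smooth_def)
  then show ?thesis by (rule C_k_Suc_has_derivative)
qed

lemma test_function_eq_0: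
  assumes "test_function U \<phi>" "x \<notin> U"
  shows "\<phi> x = 0"
proof -
  have "x \<notin> support_on UNIV \<phi>"
    using assms closure_subset unfolding test_function_def by blast
  then show ?thesis by (simp add: in_support_on)
qed

lemma test_function_derivative_continuous:
  assumes "test_function U \<phi>"
  shows "continuous_on UNIV (\<lambda>x. frechet_derivative \<phi> (at x) v)"
proof -
  have "C_k (Suc 0) \<phi>" using assms by (simp add: test_function_def smooth_def)
  then show ?thesis by simp
qed

lemma test_function_continuous: "test_function U \<phi> \<Longrightarrow> continuous_on UNIV \<phi>"
  unfolding test_function_def smooth_def using C_k.simps(1) by blast

text \<open>Off its closed support \<open>\<phi>\<close> is 0 on a whole neighbourhood. Bounding the
  derivative thereby reduces to a compact set.\<close>

lemma test_function_derivative_eq_0: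
  assumes \<phi>: "test_function U \<phi>" and "x \<notin> closure (support_on UNIV \<phi>)"
  shows "frechet_derivative \<phi> (at x) v = 0"
proof -
  let ?V = "- closure (support_on UNIV \<phi>)"
  have "(\<phi> has_derivative (\<lambda>_. 0)) (at x)"
  proof (rule has_derivative_transform_within_open[where s = ?V and f = "\<lambda>_. 0"])
    fix y assume "y \<in> ?V"
    then show "0 = \<phi> y"
      using closure_subset[of "support_on UNIV \<phi>"] by (auto simp: in_support_on)
  qed (use assms in auto)
  then show ?thesis
    using frechet_derivative_at by metis
qed

lemma test_function_derivative_outside:
  assumes "test_function U \<phi>" "x \<notin> U"
  shows "frechet_derivative \<phi> (at x) v = 0"
  using assms test_function_derivative_eq_0[OF assms(1)] unfolding test_function_def by blast

lemma test_function_derivative_bounded: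
  assumes \<phi>: "test_function U \<phi>"
  obtains C where "\<And>x. \<bar>frechet_derivative \<phi> (at x) v\<bar> \<le> C"
proof -
  let ?K = "closure (support_on UNIV \<phi>)"
  have "compact ((\<lambda>x. frechet_derivative \<phi> (at x) v) ` ?K)"
    by (rule compact_continuous_image[OF continuous_on_subset[OF test_function_derivative_continuous[OF \<phi>]]])
      (use \<phi> in \<open>auto simp: test_function_def\<close>)
  then obtain C where C: "\<And>x. x \<in> ?K \<Longrightarrow> \<bar>frechet_derivative \<phi> (at x) v\<bar> \<le> C"
    using compact_imp_bounded bounded_real by (metis (mono_tags, lifting) image_eqI)
  have "\<bar>frechet_derivative \<phi> (at x) v\<bar> \<le> max C 0" for x
    using C[of x] test_function_derivative_eq_0[OF \<phi>, of x v] by (cases "x \<in> ?K") auto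
  then show ?thesis using that by blast
qed

lemma test_function_bounded:
  assumes \<phi>: "test_function U \<phi>"
  obtains C where "\<And>x. \<bar>\<phi> x\<bar> \<le> C"
proof -
  let ?K = "closure (support_on UNIV \<phi>)"
  have "compact (\<phi> ` ?K)"
    by (rule compact_continuous_image[OF continuous_on_subset[OF test_function_continuous[OF \<phi>]]])
      (use \<phi> in \<open>auto simp: test_function_def\<close>)
  then obtain C where C: "\<And>x. x \<in> ?K \<Longrightarrow> \<bar>\<phi> x\<bar> \<le> C"
    using compact_imp_bounded bounded_real by (metis (mono_tags, lifting) image_eqI)
  have "\<bar>\<phi> x\<bar> \<le> max C 0" for x
  proof (cases "x \<in> ?K")
    case False
    then have "x \<notin> support_on UNIV \<phi>" using closure_subset by blast
    then show ?thesis by (simp add: in_support_on)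
  qed (use C[of x] in auto)
  then show ?thesis using that by blast
qed


section \<open>Weak gradients along line segments\<close>

text \<open>Open boxes are an intersection-stable generator of the Borel sets, so an integrable
  density with zero integral over all boxes has zero integral over all Borel sets and vanishes
  almost everywhere. Cutting \<open>f\<close> off to \<open>box a b\<close> makes the hypothesis
  reach every box: two open boxes meet in an open box, whose closed box stays in
  \<open>cbox a b\<close>.\<close>

lemma AE_eq_0_from_box_integrals_aux:
  fixes f :: "'a::euclidean_space \<Rightarrow> real"
  assumes f: "integrable lborel f" and U: "cbox a b \<subseteq> U"
    and null: "\<And>c d. cbox c d \<subseteq> U \<Longrightarrow> (LINT x:box c d|lborel. f x) = 0"
  shows "AE x in lborel. x \<in> box a b \<longrightarrow> f x = 0"
proof -
  define f' where "f' x = indicator (box a b) x * f x" for x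
  have [measurable]: "f \<in> borel_measurable borel" using f by auto
  have int: "integrable lborel f'"
    unfolding f'_def using integrable_real_indicator integrable_mult_indicator[OF _ f, of "box a b"] by simp
  have sint: "set_integrable lborel S f'" if "S \<in> sets borel" for S
    unfolding set_integrable_def using integrable_mult_indicator[OF _ int, of S] that by simp
  \<comment> \<open>The complement case of the induction needs the total integral, and
    \<open>box a b\<close> is itself an admissible box.\<close>
  have tot: "(LINT x:UNIV|lborel. f' x) = 0"
    using null[OF U] by (simp add: f'_def set_lebesgue_integral_def)
  have "(LINT x:S|lborel. f' x) = 0" if S: "S \<in> sets (borel :: 'a measure)" for S
  proof -
    let ?G = "range (\<lambda>(a, b). box a b :: 'a set)"
    have "S \<in> sigma_sets UNIV ?G" using S by (simp add: borel_eq_box)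
    moreover have "Int_stable ?G"
      unfolding Int_stable_def by (auto simp: Int_interval[of _ _, symmetric] box_Int_box)
    moreover have "?G \<subseteq> Pow UNIV" by simp
    ultimately have *: "Int_stable ?G" "?G \<subseteq> Pow UNIV" "S \<in> sigma_sets UNIV ?G" by auto
    from * show ?thesis
    proof (induction rule: sigma_sets_induct_disjoint)
      case (basic A)
      then obtain c d where A: "A = box c d" by auto
      define l u where "l = (\<Sum>i\<in>Basis. max (a \<bullet> i) (c \<bullet> i) *\<^sub>R i)"
        and "u = (\<Sum>i\<in>Basis. min (b \<bullet> i) (d \<bullet> i) *\<^sub>R i)"
      have eq: "box a b \<inter> box c d = box l u"
        unfolding l_def u_def by (rule box_Int_box)
      have "cbox l u \<subseteq> cbox a b"
        by (auto simp: l_def u_def mem_box)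
      then have "(LINT x:box l u|lborel. f x) = 0"
        using U null by blast
      moreover have "(LINT x:A|lborel. f' x) = (LINT x:box l u|lborel. f x)"
        unfolding set_lebesgue_integral_def eq[symmetric] A f'_def
        by (rule Bochner_Integration.integral_cong) (auto simp: indicator_def)
      ultimately show ?case by simp
    next
      case empty then show ?case by (simp add: set_lebesgue_integral_def)
    next
      case (compl A)
      have A: "A \<in> sets borel" using compl(1) by (simp add: borel_eq_box)
      have "(LINT x:(UNIV - A) \<union> A|lborel. f' x) = (LINT x:UNIV - A|lborel. f' x) + (LINT x:A|lborel. f' x)"
        by (rule set_integral_Un) (use A in \<open>auto intro!: sint\<close>)
      then show ?case using compl tot by (simp add: Un_commute)
    next
      case (union A)
      have A: "A i \<in> sets borel" for i using union(2) by (auto simp: borel_eq_box)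
      have "(LINT x:(\<Union>i. A i)|lborel. f' x) = (\<Sum>i. (LINT x:A i|lborel. f' x))"
        by (rule lebesgue_integral_countable_add)
          (use A union(1) in \<open>auto intro!: sint sets.countable_UN simp: disjoint_family_on_def\<close>)
      then show ?case using union by simp
    qed
  qed
  then have "AE x in lborel. f' x = 0"
    by (intro density_unique_real int) (auto simp: set_lebesgue_integral_def)
  then show ?thesis by eventually_elim (auto simp: f'_def)
qed

text \<open>An open set is a countable union of closed boxes, and the faces of a box are null
  sets.\<close>

lemma AE_eq_0_from_box_integrals:
  fixes f :: "'a::euclidean_space \<Rightarrow> real"
  assumes f: "integrable lborel f" and "open U"
    and null: "\<And>a b. cbox a b \<subseteq> U \<Longrightarrow> (LINT x:box a b|lborel. f x) = 0"
  shows "AE x in lborel. x \<in> U \<longrightarrow> f x = 0"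
proof -
  obtain D where D: "countable D" "\<And>X. X \<in> D \<Longrightarrow> X \<subseteq> U" "\<And>X. X \<in> D \<Longrightarrow> \<exists>a b. X = cbox a b" "\<Union>D = U"
    using open_countable_Union_open_cbox[OF \<open>open U\<close>] by (metis PowD subsetD)
  have "AE x in lborel. x \<in> X \<longrightarrow> f x = 0" if X: "X \<in> D" for X
  proof -
    obtain a b where ab: "X = cbox a b" using D X by blast
    have "cbox a b - box a b \<in> null_sets lebesgue"
      using negligible_frontier_interval by (simp add: negligible_iff_null_sets)
    then have "cbox a b - box a b \<in> null_sets lborel"
      by (subst (asm) null_sets_completion_iff) auto
    then have "AE x in lborel. x \<notin> cbox a b - box a b" by (rule AE_not_in)
    moreover have "AE x in lborel. x \<in> box a b \<longrightarrow> f x = 0"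
      by (rule AE_eq_0_from_box_integrals_aux[OF f _ null]) (use D(2)[OF X] ab in auto)
    ultimately show ?thesis by eventually_elim (auto simp: ab)
  qed
  then have "AE x in lborel. \<forall>X\<in>D. x \<in> X \<longrightarrow> f x = 0"
    using D(1) by (subst AE_ball_countable) auto
  then show ?thesis by eventually_elim (use D(4) in auto)
qed

section \<open>Translation of integrals and integrability along segments\<close>

lemma integrable_lborel_translate:
  fixes f :: "'a::euclidean_space \<Rightarrow> real"
  assumes "integrable lborel f"
  shows "integrable lborel (\<lambda>x. f (x + c))"
proof -
  have "integrable (distr lborel borel ((+) c)) f"
    using assms by (simp add: lborel_distr_plus)
  from integrable_distr[OF _ this] show ?thesis
    by (simp add: add.commute)
qed

lemma integral_lborel_translate:
  fixes f :: "'a::euclidean_space \<Rightarrow> real"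
  assumes [measurable]: "f \<in> borel_measurable borel"
  shows "(LINT x|lborel. f (x + c)) = (LINT x|lborel. f x)"
proof -
  have "(LINT x|lborel. f x) = (LINT x|distr lborel borel ((+) c). f x)"
    by (simp add: lborel_distr_plus)
  also have "\<dots> = (LINT x|lborel. f (c + x))"
    by (rule integral_distr) auto
  finally show ?thesis by (simp add: add.commute)
qed

lemma nn_integral_lborel_translate:
  fixes f :: "'a::euclidean_space \<Rightarrow> ennreal"
  assumes [measurable]: "f \<in> borel_measurable borel"
  shows "(\<integral>\<^sup>+ x. f (x + c) \<partial>lborel) = (\<integral>\<^sup>+ x. f x \<partial>lborel)"
proof -
  have "(\<integral>\<^sup>+ x. f x \<partial>lborel) = (\<integral>\<^sup>+ x. f x \<partial>distr lborel borel ((+) c))"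
    by (simp add: lborel_distr_plus)
  also have "\<dots> = (\<integral>\<^sup>+ x. f (c + x) \<partial>lborel)"
    by (rule nn_integral_distr) auto
  finally show ?thesis by (simp add: add.commute)
qed

text \<open>By translation invariance the norm of \<open>f\<close> is the same for each
  \<open>s\<close>, so the double integral is finite. In particular the line integral of
  \<open>f\<close> exists for almost every starting point.\<close>

lemma integrable_along_segment:
  fixes f :: "'a::euclidean_space \<Rightarrow> real"
  assumes f: "integrable lborel f"
  shows "integrable (lborel \<Otimes>\<^sub>M lborel) (\<lambda>(s::real, x). indicator {0..1} s * f (x + s *\<^sub>R h))"
proof (rule lborel_pair.Fubini_integrable)
  have [measurable]: "f \<in> borel_measurable borel" using f by auto
  show "(\<lambda>(s::real, x). indicator {0..1} s * f (x + s *\<^sub>R h)) \<in> borel_measurable (lborel \<Otimes>\<^sub>M lborel)"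
    by measurable
  have "(LINT x|lborel. norm (indicator {0..1} s * f (x + s *\<^sub>R h)))
      = indicator {0..1} s * (LINT x|lborel. \<bar>f x\<bar>)" for s :: real
    using integral_lborel_translate[of "\<lambda>x. \<bar>f x\<bar>" "s *\<^sub>R h"]
    by (auto simp: indicator_def abs_mult)
  then show "integrable lborel (\<lambda>s::real. LINT y|lborel.
      norm (case (s, y) of (s, x) \<Rightarrow> indicator {0..1} s * f (x + s *\<^sub>R h)))"
    by simp
  show "AE s in lborel. integrable lborel
      (\<lambda>y. case (s::real, y) of (s, x) \<Rightarrow> indicator {0..1} s * f (x + s *\<^sub>R h))"
    using integrable_lborel_translate[OF f] by auto
qed

text \<open>The working form of a weak gradient: functions integrable over the whole space with
  respect to \<open>lborel\<close>, so that Fubini applies on products, and all directions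
  \<open>h\<close> in place of basis vectors. The weak identity is asked only of test functions on
  \<open>U\<close>.\<close>

definition has_integrable_weak_gradient ::
    "'a::euclidean_space set \<Rightarrow> ('a \<Rightarrow> real) \<Rightarrow> ('a \<Rightarrow> 'a) \<Rightarrow> bool" where
  "has_integrable_weak_gradient U W G \<longleftrightarrow> integrable lborel W \<and> integrable lborel G \<and>
     (\<forall>\<phi> h. test_function U \<phi> \<longrightarrow>
        (LINT x|lborel. W x * frechet_derivative \<phi> (at x) h) = - (LINT x|lborel. (G x \<bullet> h) * \<phi> x))"

text \<open>Move the shift onto the test function: testing the difference of \<open>W\<close>
  against \<open>\<phi>\<close> amounts to testing \<open>W\<close> against the difference of a
  shifted \<open>\<phi>\<close> and \<open>\<phi>\<close>, which is an integral over
  \<open>s\<close> of directional derivatives of shifted copies. Each copy is a test function on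
  \<open>U\<close>, so the weak identity replaces \<open>W\<close> by \<open>G\<close>; shifting
  back and exchanging the integrals leaves the line integral of \<open>G\<close>.\<close>

lemma test_function_shift_identity:
  fixes W :: "'a::euclidean_space \<Rightarrow> real"
  assumes WG: "has_integrable_weak_gradient U W G"
    and \<phi>: "test_function V \<phi>" and V: "\<And>s. s \<in> {0..1} \<Longrightarrow> (+) (s *\<^sub>R h) ` V \<subseteq> U"
  shows "(LINT x|lborel. (W (x + h) - W x - (LINT s|lborel. indicator {0..1} s * (G (x + s *\<^sub>R h) \<bullet> h))) * \<phi> x) = 0"
proof -
  have W: "integrable lborel W" and G: "integrable lborel G"
    using WG by (auto simp: has_integrable_weak_gradient_def)
  have [measurable]: "W \<in> borel_measurable borel" "G \<in> borel_measurable borel" using W G by auto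
  have Gh: "integrable lborel (\<lambda>x. G x \<bullet> h)" using G by simp
  let ?D = "\<lambda>x. frechet_derivative \<phi> (at x) h"
  obtain C1 where C1: "\<And>x. \<bar>?D x\<bar> \<le> C1" using test_function_derivative_bounded[OF \<phi>] by blast
  obtain C0 where C0: "\<And>x. \<bar>\<phi> x\<bar> \<le> C0" using test_function_bounded[OF \<phi>] by blast
  have Dc: "continuous_on UNIV ?D" by (rule test_function_derivative_continuous[OF \<phi>])
  have [measurable]: "?D \<in> borel_measurable borel"
    using Dc by (rule borel_measurable_continuous_onI)
  have [measurable]: "\<phi> \<in> borel_measurable borel"
    using test_function_continuous[OF \<phi>] by (rule borel_measurable_continuous_onI)
  have bd: "integrable lborel (\<lambda>x. f x * g x)"
    if "integrable lborel f" "g \<in> borel_measurable borel" "\<And>x. \<bar>g x\<bar> \<le> C"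
    for f g :: "'a \<Rightarrow> real" and C
  proof (rule Bochner_Integration.integrable_bound[where f = "\<lambda>x. C * f x"])
    show "AE x in lborel. norm (f x * g x) \<le> norm (C * f x)"
      using that(3) order_trans[OF abs_ge_zero that(3)]
      by (intro AE_I2) (simp add: abs_mult mult.commute[of C] mult_left_mono)
  qed (use that in auto)
  have swap: "\<bar>w\<bar> * \<bar>v\<bar> \<le> C * \<bar>w\<bar>" "\<bar>v\<bar> * \<bar>w\<bar> \<le> C * \<bar>w\<bar>" if "\<bar>v\<bar> \<le> C" for w v C :: real
    using mult_left_mono[OF that abs_ge_zero[of w]] by (simp_all add: mult.commute)
  have W\<phi>: "integrable lborel (\<lambda>x. W x * \<phi> x)" "integrable lborel (\<lambda>x. W x * \<phi> (x - h))"
    by (rule bd[OF W, where C = C0], use C0 in auto)+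
  \<comment> \<open>The zero shift in \<open>W (x + s *\<^sub>R 0)\<close> makes this an instance of
    \<open>integrable_along_segment\<close> with direction 0.\<close>
  have int1: "integrable (lborel \<Otimes>\<^sub>M lborel) (\<lambda>(s::real, x). indicator {0..1} s * W (x + s *\<^sub>R 0) * - ?D (x - s *\<^sub>R h))"
  proof (rule Bochner_Integration.integrable_bound)
    show "integrable (lborel \<Otimes>\<^sub>M lborel) (\<lambda>p. C1 * (case p of (s::real, x) \<Rightarrow> indicator {0..1} s * W (x + s *\<^sub>R 0)))"
      by (intro integrable_mult_right integrable_along_segment W)
    show "AE p in lborel \<Otimes>\<^sub>M lborel. norm (case p of (s::real, x) \<Rightarrow> indicator {0..1} s * W (x + s *\<^sub>R 0) * - ?D (x - s *\<^sub>R h))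
       \<le> norm (C1 * (case p of (s::real, x) \<Rightarrow> indicator {0..1} s * W (x + s *\<^sub>R 0)))"
      using C1 order_trans[OF abs_ge_zero C1]
      by (intro AE_I2) (auto simp: split_beta abs_mult mult.assoc mult.left_commute mult.commute indicator_def
          intro!: swap)
    show "(\<lambda>(s::real, x). indicator {0..1} s * W (x + s *\<^sub>R 0) * - ?D (x - s *\<^sub>R h)) \<in> borel_measurable (lborel \<Otimes>\<^sub>M lborel)"
      by measurable
  qed
  have int2: "integrable (lborel \<Otimes>\<^sub>M lborel) (\<lambda>(s::real, x). indicator {0..1} s * (G (x + s *\<^sub>R h) \<bullet> h) * \<phi> x)"
  proof (rule Bochner_Integration.integrable_bound)
    show "integrable (lborel \<Otimes>\<^sub>M lborel) (\<lambda>p. C0 * (case p of (s::real, x) \<Rightarrow> indicator {0..1} s * (G (x + s *\<^sub>R h) \<bullet> h)))"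
      by (intro integrable_mult_right integrable_along_segment[OF Gh])
    show "AE p in lborel \<Otimes>\<^sub>M lborel. norm (case p of (s::real, x) \<Rightarrow> indicator {0..1} s * (G (x + s *\<^sub>R h) \<bullet> h) * \<phi> x)
       \<le> norm (C0 * (case p of (s::real, x) \<Rightarrow> indicator {0..1} s * (G (x + s *\<^sub>R h) \<bullet> h)))"
      using C0 order_trans[OF abs_ge_zero C0]
      by (intro AE_I2) (auto simp: split_beta abs_mult mult.assoc mult.left_commute mult.commute indicator_def
          intro!: swap)
    show "(\<lambda>(s::real, x). indicator {0..1} s * (G (x + s *\<^sub>R h) \<bullet> h) * \<phi> x) \<in> borel_measurable (lborel \<Otimes>\<^sub>M lborel)"
      by measurable
  qed
  have ftc: "(LINT s|lborel. indicator {0..1} s * - ?D (x - s *\<^sub>R h)) = \<phi> (x - h) - \<phi> x" for x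
  proof -
    have "((\<lambda>s. \<phi> (x - s *\<^sub>R h)) has_real_derivative - ?D (x - s *\<^sub>R h)) (at s)" for s :: real
    proof -
      have 1: "((\<lambda>s::real. x - s *\<^sub>R h) has_derivative (\<lambda>t. - (t *\<^sub>R h))) (at s)"
        by (auto intro!: derivative_eq_intros)
      note D = test_function_has_derivative[OF \<phi>, of "x - s *\<^sub>R h"]
      interpret linear "frechet_derivative \<phi> (at (x - s *\<^sub>R h))"
        using has_derivative_linear[OF D] .
      show ?thesis
        using has_derivative_compose[OF 1 D] unfolding has_field_derivative_def neg scaleR
        by (rule has_derivative_eq_rhs) (auto simp: mult.commute)
    qed
    moreover have "isCont (\<lambda>s. - ?D (x - s *\<^sub>R h)) s" for s :: real
    proof -
      have "continuous_on UNIV (\<lambda>s::real. ?D (x - s *\<^sub>R h))"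
        by (rule continuous_on_compose2[OF Dc]) (auto intro!: continuous_intros)
      then show ?thesis by (simp add: continuous_on_eq_continuous_at)
    qed
    ultimately have "(LINT s|lborel. - ?D (x - s *\<^sub>R h) * indicator {0..1} s) = \<phi> (x - 1 *\<^sub>R h) - \<phi> (x - 0 *\<^sub>R h)"
      by (intro integral_FTC_Icc_real) auto
    then show ?thesis by (simp add: mult.commute)
  qed
  have wk: "(LINT x|lborel. W x * - ?D (x - s *\<^sub>R h)) = (LINT x|lborel. (G (x + s *\<^sub>R h) \<bullet> h) * \<phi> x)"
    if s: "s \<in> {0..1}" for s :: real
  proof -
    let ?\<psi> = "\<lambda>x. \<phi> (x - s *\<^sub>R h)"
    have "test_function U ?\<psi>"
      by (rule test_function_mono[OF test_function_shift[OF \<phi>] V[OF s]])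
    then have "(LINT x|lborel. W x * frechet_derivative ?\<psi> (at x) h) = - (LINT x|lborel. (G x \<bullet> h) * ?\<psi> x)"
      using WG by (simp add: has_integrable_weak_gradient_def)
    moreover have "frechet_derivative ?\<psi> (at x) = frechet_derivative \<phi> (at (x - s *\<^sub>R h))" for x
      using frechet_derivative_at[OF has_derivative_shift[OF test_function_has_derivative[OF \<phi>]]] by metis
    ultimately have "(LINT x|lborel. W x * ?D (x - s *\<^sub>R h)) = - (LINT x|lborel. (G x \<bullet> h) * ?\<psi> x)"
      by simp
    also have "(LINT x|lborel. (G x \<bullet> h) * ?\<psi> x) = (LINT x|lborel. (G (x + s *\<^sub>R h) \<bullet> h) * \<phi> x)"
      using integral_lborel_translate[of "\<lambda>x. (G x \<bullet> h) * ?\<psi> x" "s *\<^sub>R h"] by simp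
    finally show ?thesis by simp
  qed
  have "(LINT x|lborel. W (x + h) * \<phi> x) - (LINT x|lborel. W x * \<phi> x)
      = (LINT x|lborel. W x * \<phi> (x - h)) - (LINT x|lborel. W x * \<phi> x)"
    using integral_lborel_translate[of "\<lambda>x. W x * \<phi> (x - h)" h] by simp
  also have "\<dots> = (LINT x|lborel. W x * (\<phi> (x - h) - \<phi> x))"
    using W\<phi> by (simp add: right_diff_distrib)
  also have "\<dots> = (LINT x|lborel. LINT s|lborel. indicator {0..1} s * W (x + s *\<^sub>R 0) * - ?D (x - s *\<^sub>R h))"
  proof (rule Bochner_Integration.integral_cong[OF refl])
    fix x
    have "W x * (\<phi> (x - h) - \<phi> x) = (LINT s|lborel. W x * (indicator {0..1} s * - ?D (x - s *\<^sub>R h)))"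
      unfolding ftc[symmetric] by (rule integral_mult_right_zero[symmetric])
    also have "(\<lambda>s. W x * (indicator {0..1} s * - ?D (x - s *\<^sub>R h)))
        = (\<lambda>s. indicator {0..1} s * W (x + s *\<^sub>R 0) * - ?D (x - s *\<^sub>R h))"
      by (rule ext) simp
    finally show "W x * (\<phi> (x - h) - \<phi> x) = (LINT s|lborel. indicator {0..1} s * W (x + s *\<^sub>R 0) * - ?D (x - s *\<^sub>R h))" .
  qed
  also have "\<dots> = (LINT s|lborel. LINT x|lborel. indicator {0..1} s * W (x + s *\<^sub>R 0) * - ?D (x - s *\<^sub>R h))"
    by (rule lborel_pair.Fubini_integral[OF int1])
  also have "\<dots> = (LINT s|lborel. LINT x|lborel. indicator {0..1} s * (G (x + s *\<^sub>R h) \<bullet> h) * \<phi> x)"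
  proof (rule Bochner_Integration.integral_cong[OF refl])
    fix s :: real
    show "(LINT x|lborel. indicator {0..1} s * W (x + s *\<^sub>R 0) * - ?D (x - s *\<^sub>R h))
        = (LINT x|lborel. indicator {0..1} s * (G (x + s *\<^sub>R h) \<bullet> h) * \<phi> x)"
      using wk[of s] by (cases "s \<in> {0..1}") auto
  qed
  also have "\<dots> = (LINT x|lborel. LINT s|lborel. indicator {0..1} s * (G (x + s *\<^sub>R h) \<bullet> h) * \<phi> x)"
    by (rule lborel_pair.Fubini_integral[OF int2, symmetric])
  also have "\<dots> = (LINT x|lborel. (LINT s|lborel. indicator {0..1} s * (G (x + s *\<^sub>R h) \<bullet> h)) * \<phi> x)"
    by (simp only: integral_mult_left_zero)
  finally have eq: "(LINT x|lborel. W (x + h) * \<phi> x) - (LINT x|lborel. W x * \<phi> x)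
      = (LINT x|lborel. (LINT s|lborel. indicator {0..1} s * (G (x + s *\<^sub>R h) \<bullet> h)) * \<phi> x)" .
  have i3: "integrable lborel (\<lambda>x. (LINT s|lborel. indicator {0..1} s * (G (x + s *\<^sub>R h) \<bullet> h)) * \<phi> x)"
    using lborel_pair.integrable_snd[OF int2] by (simp only: integral_mult_left_zero)
  have i4: "integrable lborel (\<lambda>x. W (x + h) * \<phi> x)"
    by (rule bd[OF integrable_lborel_translate[OF W], where C = C0]) (use C0 in auto)
  show ?thesis
    using eq i3 i4 W\<phi>(1) by (simp add: left_diff_distrib)
qed

text \<open>The defect \<open>Z\<close> has zero integral against every bump on a closed box in
  \<open>V\<close>. The bumps tend to the indicator of the open box, dominated through |Z|, so all
  box integrals of \<open>Z\<close> vanish. Convexity keeps the intermediate shifts of the box in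
  \<open>U\<close>.\<close>

lemma weak_gradient_segment:
  fixes W :: "'a::euclidean_space \<Rightarrow> real"
  assumes WG: "has_integrable_weak_gradient U W G" and "open U" "convex U"
  shows "AE x in lborel. x \<in> U \<and> x + h \<in> U \<longrightarrow>
    W (x + h) - W x = (LINT s|lborel. indicator {0..1} s * (G (x + s *\<^sub>R h) \<bullet> h))"
proof -
  define V where "V = U \<inter> (\<lambda>x. x + h) -` U"
  define Z where "Z x = W (x + h) - W x - (LINT s|lborel. indicator {0..1} s * (G (x + s *\<^sub>R h) \<bullet> h))" for x
  have W: "integrable lborel W" and G: "integrable lborel G"
    using WG by (auto simp: has_integrable_weak_gradient_def)
  have Gh: "integrable lborel (\<lambda>x. G x \<bullet> h)" using G by simp
  have Z: "integrable lborel Z"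
    unfolding Z_def
    by (intro Bochner_Integration.integrable_diff W integrable_lborel_translate
        lborel_pair.integrable_snd[OF integrable_along_segment[OF Gh]])
  have "open V"
    unfolding V_def using \<open>open U\<close> by (intro open_Int open_vimage continuous_intros)
  have "AE x in lborel. x \<in> V \<longrightarrow> Z x = 0"
  proof (rule AE_eq_0_from_box_integrals[OF Z \<open>open V\<close>])
    fix a b assume ab: "cbox a b \<subseteq> V"
    have "(+) (s *\<^sub>R h) ` cbox a b \<subseteq> U" if "s \<in> {0..1}" for s :: real
    proof clarify
      fix x assume "x \<in> cbox a b"
      then have "x \<in> U" "x + h \<in> U" using ab by (auto simp: V_def)
      then have "(1 - s) *\<^sub>R x + s *\<^sub>R (x + h) \<in> U"
        using \<open>convex U\<close> that by (intro convexD) auto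
      then show "s *\<^sub>R h + x \<in> U" by (simp add: algebra_simps)
    qed
    from test_function_shift_identity[OF WG test_function_box_bump[OF subset_refl] this]
    have 0: "(LINT x|lborel. Z x * box_bump a b m x) = 0" for m
      by (simp add: Z_def)
    have "(\<lambda>m. LINT x|lborel. Z x * box_bump a b m x) \<longlonglongrightarrow> (LINT x|lborel. Z x * indicator (box a b) x)"
    proof (rule integral_dominated_convergence[where w = "\<lambda>x. \<bar>Z x\<bar>"])
      have [measurable]: "Z \<in> borel_measurable borel" using Z by auto
      have [measurable]: "box_bump a b m \<in> borel_measurable borel" for m
        by (rule borel_measurable_continuous_onI[OF test_function_continuous[OF test_function_box_bump[OF subset_refl]]])
      show "(\<lambda>x. Z x * box_bump a b m x) \<in> borel_measurable lborel" for m by measurable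
      show "AE x in lborel. norm (Z x * box_bump a b m x) \<le> \<bar>Z x\<bar>" for m
        by (rule AE_I2) (simp add: abs_mult box_bump_nonneg box_bump_le_1 mult_left_le)
      show "AE x in lborel. (\<lambda>m. Z x * box_bump a b m x) \<longlonglongrightarrow> Z x * indicator (box a b) x"
        by (auto intro!: tendsto_intros box_bump_tendsto)
    qed (use Z in auto)
    then have "(LINT x|lborel. Z x * indicator (box a b) x) = 0"
      unfolding 0 using LIMSEQ_unique tendsto_const by metis
    then show "(LINT x:box a b|lborel. Z x) = 0"
      by (simp add: set_lebesgue_integral_def mult.commute)
  qed
  then show ?thesis
    by eventually_elim (auto simp: V_def Z_def)
qed


section \<open>An isoperimetric inequality of De Giorgi type\<close>

text \<open>Take \<open>a\<close> as the last time at or below level \<open>k\<close>, then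
  \<open>b\<close> as the first later time at or above \<open>l\<close>; the intermediate value
  theorem turns both inequalities into equalities.\<close>

lemma continuous_crossing:
  fixes U :: "real \<Rightarrow> real"
  assumes U: "continuous_on {0..1} U" and "U 0 \<le> k" "l \<le> U 1" "k < l"
  obtains a b where "0 \<le> a" "a < b" "b \<le> 1" "U a = k" "U b = l" "\<And>s. a < s \<Longrightarrow> s < b \<Longrightarrow> k < U s \<and> U s < l"
proof -
  define S where "S = {0..1} \<inter> U -` {..k}"
  have "compact S"
    unfolding S_def using continuous_closed_preimage[OF U, of "{..k}"]
    by (metis closed_atLeastAtMost closed_atMost compact_Icc compact_Int_closed Int_absorb Int_assoc)
  moreover have "0 \<in> S" using assms by (simp add: S_def)
  ultimately obtain a where a: "a \<in> S" "\<And>s. s \<in> S \<Longrightarrow> s \<le> a"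
    using compact_attains_sup[of S] by auto
  have a01: "0 \<le> a" "a \<le> 1" "U a \<le> k" using a(1) by (auto simp: S_def)
  have ca: "continuous_on {a..1} U" by (rule continuous_on_subset[OF U]) (use a01 in auto)
  have ak: "U a = k"
  proof (rule ccontr)
    assume "U a \<noteq> k"
    obtain s where s: "a \<le> s" "s \<le> 1" "U s = k"
      using IVT'[OF _ _ _ ca, of k] a01 assms by auto
    then have "s \<in> S" using a01 by (simp add: S_def)
    then show False using a(2)[of s] s \<open>U a \<noteq> k\<close> by auto
  qed
  define T where "T = {a..1} \<inter> U -` {l..}"
  have "compact T"
    unfolding T_def using continuous_closed_preimage[OF ca, of "{l..}"]
    by (metis closed_atLeastAtMost closed_atLeast compact_Icc compact_Int_closed Int_absorb Int_assoc)
  moreover have "1 \<in> T" using assms a01 by (simp add: T_def)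
  ultimately obtain b where b: "b \<in> T" "\<And>s. s \<in> T \<Longrightarrow> b \<le> s"
    using compact_attains_inf[of T] by auto
  have b01: "a \<le> b" "b \<le> 1" "l \<le> U b" using b(1) by (auto simp: T_def)
  have "a \<noteq> b" using ak b01 \<open>k < l\<close> by auto
  have bl: "U b = l"
  proof (rule ccontr)
    assume "U b \<noteq> l"
    have "continuous_on {a..b} U" by (rule continuous_on_subset[OF ca]) (use b01 in auto)
    then obtain s where s: "a \<le> s" "s \<le> b" "U s = l"
      using IVT'[of U a l b] ak b01 assms by auto
    then have "s \<in> T" using b01 by (simp add: T_def)
    then show False using b(2)[of s] s \<open>U b \<noteq> l\<close> by auto
  qed
  have "k < U s \<and> U s < l" if "a < s" "s < b" for s
  proof -
    have "s \<notin> S" "s \<notin> T" using a(2) b(2) that by force+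
    then show ?thesis using that a01 b01 by (auto simp: S_def T_def)
  qed
  then show ?thesis using that[of a b] a01 b01 ak bl \<open>a \<noteq> b\<close> by auto
qed

text \<open>For each fixed shift \<open>t *\<^sub>R h\<close> the segment formula fails only on a
  null set, which depends on \<open>t\<close>. Fubini for null sets exchanges the quantifiers: from
  almost every starting point the formula holds for almost every \<open>t\<close>.\<close>

lemma AE_weak_gradient_segment:
  fixes W :: "'a::euclidean_space \<Rightarrow> real"
  assumes WG: "has_integrable_weak_gradient U W G" and U: "open U" "convex U"
  shows "AE x in lborel. AE t in lborel. x \<in> U \<and> x + h \<in> U \<and> 0 < t \<and> t \<le> 1 \<longrightarrow>
    W (x + t *\<^sub>R h) - W x = (LINT s|lborel. (if 0 \<le> s \<and> s \<le> t then G (x + s *\<^sub>R h) \<bullet> h else 0))"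
    (is "AE x in lborel. AE t in lborel. ?P x t")
proof -
  have [measurable]: "W \<in> borel_measurable borel" "G \<in> borel_measurable borel"
    using WG by (auto simp: has_integrable_weak_gradient_def)
  have [measurable]: "U \<in> sets borel" using U by auto
  have "(AE x in lborel. AE t in lborel. ?P x t) \<longleftrightarrow> (AE t in lborel. AE x in lborel. ?P x t)"
    by (rule lborel_pair.AE_commute) measurable
  moreover have "AE x in lborel. ?P x t" for t :: real
  proof (cases "0 < t \<and> t \<le> 1")
    case True
    \<comment> \<open>Substituting t * s for s turns the part of the segment up to time
      \<open>t\<close> into the unit interval for the shift \<open>t *\<^sub>R h\<close>.\<close>
    have sub: "(LINT s|lborel. indicator {0..1} s * (G (x + s *\<^sub>R t *\<^sub>R h) \<bullet> (t *\<^sub>R h)))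
        = (LINT s|lborel. (if 0 \<le> s \<and> s \<le> t then G (x + s *\<^sub>R h) \<bullet> h else 0))" for x
    proof -
      have "(LINT s|lborel. (if 0 \<le> s \<and> s \<le> t then G (x + s *\<^sub>R h) \<bullet> h else 0))
          = \<bar>t\<bar> *\<^sub>R (LINT s|lborel. (if 0 \<le> 0 + t * s \<and> 0 + t * s \<le> t then G (x + (0 + t * s) *\<^sub>R h) \<bullet> h else 0))"
        by (rule lborel_integral_real_affine) (use True in auto)
      also have "\<dots> = (LINT s|lborel. t * (if 0 \<le> 0 + t * s \<and> 0 + t * s \<le> t then G (x + (0 + t * s) *\<^sub>R h) \<bullet> h else 0))"
        using True by simp
      also have "\<dots> = (LINT s|lborel. indicator {0..1} s * (G (x + s *\<^sub>R t *\<^sub>R h) \<bullet> (t *\<^sub>R h)))"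
        by (rule Bochner_Integration.integral_cong)
          (use True in \<open>auto simp: indicator_def zero_le_mult_iff mult.commute\<close>)
      finally show ?thesis by simp
    qed
    have "AE x in lborel. x \<in> U \<and> x + t *\<^sub>R h \<in> U \<longrightarrow> W (x + t *\<^sub>R h) - W x
        = (LINT s|lborel. (if 0 \<le> s \<and> s \<le> t then G (x + s *\<^sub>R h) \<bullet> h else 0))"
      using weak_gradient_segment[OF WG U, of "t *\<^sub>R h"] unfolding sub .
    then show ?thesis
    proof eventually_elim
      case (elim x)
      have "x + t *\<^sub>R h \<in> U" if "x \<in> U" "x + h \<in> U"
      proof -
        have "(1 - t) *\<^sub>R x + t *\<^sub>R (x + h) \<in> U"
          using \<open>convex U\<close> that True by (intro convexD) auto
        then show ?thesis by (simp add: algebra_simps)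
      qed
      then show ?case using elim by blast
    qed
  qed auto
  ultimately show ?thesis by simp
qed

text \<open>On almost every segment \<open>W\<close> agrees at almost every time with a continuous
  primitive \<open>V\<close>. Between its crossing times \<open>V\<close> climbs from
  \<open>k\<close> to \<open>l\<close> inside the band, so the directional derivative integrated
  over these times alone gives l - k.\<close>

lemma crossing_estimate:
  fixes W :: "'a::euclidean_space \<Rightarrow> real"
  assumes WG: "has_integrable_weak_gradient U W G" and U: "open U" "convex U" and "k < l"
  shows "AE x in lborel. x \<in> U \<and> x + h \<in> U \<and> W x \<le> k \<and> l < W (x + h) \<longrightarrow>
    ennreal (l - k) \<le> ennreal (norm h) *
      (\<integral>\<^sup>+ s. indicator {0..1} s * (indicator {z \<in> U. k < W z \<and> W z < l} (x + s *\<^sub>R h)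
        * ennreal (norm (G (x + s *\<^sub>R h)))) \<partial>lborel)"
proof -
  have W: "integrable lborel W" and G: "integrable lborel G"
    using WG by (auto simp: has_integrable_weak_gradient_def)
  have [measurable]: "W \<in> borel_measurable borel" "G \<in> borel_measurable borel" "U \<in> sets borel"
    using W G U by auto
  have Gh: "integrable lborel (\<lambda>x. G x \<bullet> h)" using G by simp
  show ?thesis
    \<comment> \<open>A statement for almost every \<open>t\<close> says nothing about the single
      time 1. The second fact supplies the value at the end point \<open>x + h\<close>.\<close>
    using AE_weak_gradient_segment[OF WG U, of h] weak_gradient_segment[OF WG U, of h]
      lborel_pair.AE_integrable_snd[OF integrable_along_segment[OF Gh]]
  proof (eventually_elim, intro impI, elim conjE)
    fix x
    assume int: "integrable lborel (\<lambda>s. indicator {0..1} s * (G (x + s *\<^sub>R h) \<bullet> h))"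
    assume x: "x \<in> U" "x + h \<in> U" and Wk: "W x \<le> k" and Wl: "l < W (x + h)"
    define K where "K s = G (x + s *\<^sub>R h) \<bullet> h" for s
    have [measurable]: "K \<in> borel_measurable borel" unfolding K_def by measurable
    have sint: "set_integrable lborel {0..1} K"
      using int by (simp add: set_integrable_def K_def)
    define V where "V t = W x + integral {0..t} K" for t
    have V: "(LINT s|lborel. (if 0 \<le> s \<and> s \<le> t then K s else 0)) = integral {0..t} K" if "t \<le> 1" for t
    proof -
      have "set_integrable lborel {0..t} K"
        by (rule set_integrable_subset[OF sint]) (use that in auto)
      then have "(LINT s:{0..t}|lborel. K s) = integral {0..t} K"
        by (rule set_borel_integral_eq_integral)
      moreover have "(LINT s:{0..t}|lborel. K s) = (LINT s|lborel. (if 0 \<le> s \<and> s \<le> t then K s else 0))"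
        unfolding set_lebesgue_integral_def
        by (rule Bochner_Integration.integral_cong) (auto simp: indicator_def)
      ultimately show ?thesis by simp
    qed
    assume "AE t in lborel. x \<in> U \<and> x + h \<in> U \<and> 0 < t \<and> t \<le> 1 \<longrightarrow>
      W (x + t *\<^sub>R h) - W x = (LINT s|lborel. (if 0 \<le> s \<and> s \<le> t then G (x + s *\<^sub>R h) \<bullet> h else 0))"
    then have AEV: "AE t in lborel. 0 < t \<and> t \<le> 1 \<longrightarrow> W (x + t *\<^sub>R h) = V t"
    proof eventually_elim
      case (elim t)
      then show ?case using x V[of t] unfolding V_def K_def by auto
    qed
    assume "x \<in> U \<and> x + h \<in> U \<longrightarrow> W (x + h) - W x = (LINT s|lborel. indicator {0..1} s * (G (x + s *\<^sub>R h) \<bullet> h))"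
    moreover have "(LINT s|lborel. indicator {0..1} s * (G (x + s *\<^sub>R h) \<bullet> h))
        = (LINT s|lborel. (if 0 \<le> s \<and> s \<le> 1 then K s else 0))"
      by (rule Bochner_Integration.integral_cong) (auto simp: indicator_def K_def)
    ultimately have V1: "W (x + h) = V 1" using x V[of 1] by (simp add: V_def)
    have "continuous_on {0..1} V"
      unfolding V_def
      by (intro continuous_intros indefinite_integral_continuous_1)
        (rule set_borel_integral_eq_integral[OF sint])
    then obtain a b where ab: "0 \<le> a" "a < b" "b \<le> 1" "V a = k" "V b = l"
      "\<And>s. a < s \<Longrightarrow> s < b \<Longrightarrow> k < V s \<and> V s < l"
      by (rule continuous_crossing[where k = k and l = l]) (use Wk Wl V1 \<open>k < l\<close> in \<open>auto simp: V_def\<close>)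
    have sab: "set_integrable lborel {a<..b} K"
      by (rule set_integrable_subset[OF sint]) (use ab in auto)
    have sa: "set_integrable lborel {0..a} K"
      by (rule set_integrable_subset[OF sint]) (use ab in auto)
    \<comment> \<open>Half-open, so that the two pieces are disjoint. The extra point
      \<open>b\<close>, where \<open>V\<close> has already reached \<open>l\<close>, is discarded
      below as a null set.\<close>
    have "{0..b} = {0..a} \<union> {a<..b}" using ab by auto
    then have "(LINT s:{0..b}|lborel. K s) = (LINT s:{0..a}|lborel. K s) + (LINT s:{a<..b}|lborel. K s)"
      using sa sab by (simp only:) (rule set_integral_Un, auto)
    moreover have "(LINT s:{0..a}|lborel. K s) = integral {0..a} K"
      by (rule set_borel_integral_eq_integral[OF sa])
    moreover have "(LINT s:{0..b}|lborel. K s) = integral {0..b} K"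
      by (rule set_borel_integral_eq_integral, rule set_integrable_subset[OF sint]) (use ab in auto)
    ultimately have lk: "l - k = (LINT s:{a<..b}|lborel. K s)"
      using ab(4,5) by (simp add: V_def)
    have "ennreal (l - k) \<le> (\<integral>\<^sup>+ s. ennreal (norm (indicator {a<..b} s *\<^sub>R K s)) \<partial>lborel)"
      unfolding lk set_lebesgue_integral_def
      using integral_norm_bound_ennreal[OF sab[unfolded set_integrable_def]] 
      by (rule order_trans[rotated]) (auto intro!: ennreal_leI)
    also have "\<dots> \<le> (\<integral>\<^sup>+ s. ennreal (norm h) * (indicator {0..1} s * (indicator {z \<in> U. k < W z \<and> W z < l} (x + s *\<^sub>R h)
        * ennreal (norm (G (x + s *\<^sub>R h))))) \<partial>lborel)"
    proof (rule nn_integral_mono_AE)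
      have "AE s in lborel. s \<noteq> b" by (rule AE_lborel_singleton)
      with AEV show "AE s in lborel. ennreal (norm (indicator {a<..b} s *\<^sub>R K s))
          \<le> ennreal (norm h) * (indicator {0..1} s * (indicator {z \<in> U. k < W z \<and> W z < l} (x + s *\<^sub>R h)
          * ennreal (norm (G (x + s *\<^sub>R h)))))"
      proof eventually_elim
        case (elim s)
        show ?case
        proof (cases "a < s \<and> s < b")
          case True
          then have s: "0 < s" "s \<le> 1" "k < V s" "V s < l" using ab by auto
          then have "W (x + s *\<^sub>R h) = V s" using elim by simp
          moreover have "(1 - s) *\<^sub>R x + s *\<^sub>R (x + h) \<in> U"
            using \<open>convex U\<close> x s by (intro convexD) auto
          then have "x + s *\<^sub>R h \<in> U" by (simp add: algebra_simps)
          moreover have "\<bar>K s\<bar> \<le> norm h * norm (G (x + s *\<^sub>R h))"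
            unfolding K_def using Cauchy_Schwarz_ineq2[of "G (x + s *\<^sub>R h)" h] by (simp add: mult.commute)
          ultimately show ?thesis
            using s by (simp add: ennreal_mult[symmetric] ennreal_leI indicator_def)
        next
          case False
          then show ?thesis using elim by (auto simp: indicator_def)
        qed
      qed
    qed
    also have "\<dots> = ennreal (norm h) * (\<integral>\<^sup>+ s. indicator {0..1} s * (indicator {z \<in> U. k < W z \<and> W z < l} (x + s *\<^sub>R h)
        * ennreal (norm (G (x + s *\<^sub>R h)))) \<partial>lborel)"
      by (rule nn_integral_cmult) measurable
    finally show "ennreal (l - k) \<le> ennreal (norm h) * (\<integral>\<^sup>+ s. indicator {0..1} s * (indicator {z \<in> U. k < W z \<and> W z < l} (x + s *\<^sub>R h)
        * ennreal (norm (G (x + s *\<^sub>R h)))) \<partial>lborel)" .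
  qed
qed

lemma nn_integral_lborel_scale:
  fixes f :: "'a::euclidean_space \<Rightarrow> ennreal"
  assumes [measurable]: "f \<in> borel_measurable borel" and "c \<noteq> 0"
  shows "(\<integral>\<^sup>+ h. f (x + c *\<^sub>R h) \<partial>lborel) = ennreal (1 / \<bar>c\<bar> ^ DIM('a)) * (\<integral>\<^sup>+ z. f z \<partial>lborel)"
proof -
  let ?c = "\<bar>c\<bar> ^ DIM('a)"
  have c: "?c > 0" using assms by simp
  have "(\<integral>\<^sup>+ z. f z \<partial>lborel)
      = (\<integral>\<^sup>+ z. f z \<partial>density (distr lborel borel (\<lambda>h. x + c *\<^sub>R h)) (\<lambda>_. ?c))"
    using lborel_affine[OF \<open>c \<noteq> 0\<close>, of x] by simp
  also have "\<dots> = ennreal ?c * (\<integral>\<^sup>+ h. f (x + c *\<^sub>R h) \<partial>lborel)"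
    by (simp add: nn_integral_density nn_integral_distr nn_integral_cmult)
  finally have "(\<integral>\<^sup>+ z. f z \<partial>lborel) = ennreal ?c * (\<integral>\<^sup>+ h. f (x + c *\<^sub>R h) \<partial>lborel)" .
  then have "ennreal (1 / ?c) * (\<integral>\<^sup>+ z. f z \<partial>lborel)
      = ennreal (1 / ?c * ?c) * (\<integral>\<^sup>+ h. f (x + c *\<^sub>R h) \<partial>lborel)"
    using c by (subst ennreal_mult) (auto simp only: mult.assoc zero_le_divide_1_iff less_imp_le)
  then show ?thesis using c by simp
qed

text \<open>The crossing estimate is integrated over all pairs with \<open>x\<close> in
  \<open>N\<close> and \<open>x + h\<close> in \<open>X\<close>. For fixed \<open>s\<close> the
  intermediate point sweeps out space as the far end moves, with a Jacobian that is singular at s =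
  1 seen from \<open>X\<close> and at s = 0 seen from \<open>N\<close>. Hence the split at 1 -
  \<tau>; the parameter \<tau> stays free for a later balance.\<close>

lemma isoperimetric_scaling:
  fixes W :: "'a::euclidean_space \<Rightarrow> real"
  assumes WG: "has_integrable_weak_gradient (ball y r) W G" and "k < l" and \<tau>: "0 < \<tau>" "\<tau> \<le> 1 / 2"
  defines "N \<equiv> {x \<in> ball y r. W x \<le> k}" and "X \<equiv> {x \<in> ball y r. l < W x}"
    and "E \<equiv> {x \<in> ball y r. k < W x \<and> W x < l}"
  shows "ennreal (l - k) * (emeasure lborel N * emeasure lborel X)
    \<le> ennreal (2 * r) * ((ennreal (1 / \<tau> ^ DIM('a)) * emeasure lborel X
        + ennreal (\<tau> * 2 ^ DIM('a)) * emeasure lborel N)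
      * (\<integral>\<^sup>+ z. indicator E z * ennreal (norm (G z)) \<partial>lborel))"
proof -
  have [measurable]: "W \<in> borel_measurable borel" "G \<in> borel_measurable borel"
    using WG by (auto simp: has_integrable_weak_gradient_def)
  have [measurable]: "N \<in> sets borel" "X \<in> sets borel" "E \<in> sets borel"
    unfolding N_def X_def E_def by measurable
  define f where "f z = indicator E z * ennreal (norm (G z))" for z
  have [measurable]: "f \<in> borel_measurable borel" unfolding f_def by measurable
  define J where "J s = (\<integral>\<^sup>+ h. \<integral>\<^sup>+ x. f (x + s *\<^sub>R h) * (indicator N x * indicator X (x + h)) \<partial>lborel \<partial>lborel)" for s :: real
  let ?F = "\<integral>\<^sup>+ z. f z \<partial>lborel"
  let ?n = "DIM('a)"
  have fixed: "(\<integral>\<^sup>+ x. ennreal (l - k) * (indicator N x * indicator X (x + h)) \<partial>lborel)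
      \<le> (\<integral>\<^sup>+ s. ennreal (2 * r) * (indicator {0..1} s *
          (\<integral>\<^sup>+ x. f (x + s *\<^sub>R h) * (indicator N x * indicator X (x + h)) \<partial>lborel)) \<partial>lborel)" for h :: 'a
  proof -
    have "(\<integral>\<^sup>+ x. ennreal (l - k) * (indicator N x * indicator X (x + h)) \<partial>lborel)
      \<le> (\<integral>\<^sup>+ x. \<integral>\<^sup>+ s. ennreal (2 * r) * (indicator {0..1} s *
          (f (x + s *\<^sub>R h) * (indicator N x * indicator X (x + h)))) \<partial>lborel \<partial>lborel)"
    proof (rule nn_integral_mono_AE)
      show "AE x in lborel. ennreal (l - k) * (indicator N x * indicator X (x + h))
        \<le> (\<integral>\<^sup>+ s. ennreal (2 * r) * (indicator {0..1} s * (f (x + s *\<^sub>R h) * (indicator N x * indicator X (x + h)))) \<partial>lborel)"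
        using crossing_estimate[OF WG open_ball convex_ball \<open>k < l\<close>, of h]
      proof eventually_elim
        case (elim x)
        show ?case
        proof (cases "x \<in> N \<and> x + h \<in> X")
          case True
          then have "dist y x < r" "dist y (x + h) < r" by (auto simp: N_def X_def)
          then have "norm h \<le> 2 * r"
            using dist_triangle3[of x "x + h" y] by (simp add: dist_norm)
          have "ennreal (l - k) \<le> ennreal (norm h) * (\<integral>\<^sup>+ s. indicator {0..1} s * f (x + s *\<^sub>R h) \<partial>lborel)"
            using elim True unfolding f_def E_def by (auto simp: N_def X_def)
          also have "\<dots> \<le> ennreal (2 * r) * (\<integral>\<^sup>+ s. indicator {0..1} s * f (x + s *\<^sub>R h) \<partial>lborel)"
            using \<open>norm h \<le> 2 * r\<close> by (intro mult_right_mono ennreal_leI) auto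
          also have "\<dots> = (\<integral>\<^sup>+ s. ennreal (2 * r) * (indicator {0..1} s * f (x + s *\<^sub>R h)) \<partial>lborel)"
            by (rule nn_integral_cmult[symmetric]) measurable
          finally show ?thesis using True by simp
        next
          case False
          then show ?thesis by (auto simp: indicator_def)
        qed
      qed
    qed
    also have "\<dots> = (\<integral>\<^sup>+ s. \<integral>\<^sup>+ x. ennreal (2 * r) * (indicator {0..1} s *
          (f (x + s *\<^sub>R h) * (indicator N x * indicator X (x + h)))) \<partial>lborel \<partial>lborel)"
      by (rule lborel_pair.Fubini'[symmetric]) measurable
    also have "\<dots> = (\<integral>\<^sup>+ s. ennreal (2 * r) * (indicator {0..1} s *
          (\<integral>\<^sup>+ x. f (x + s *\<^sub>R h) * (indicator N x * indicator X (x + h)) \<partial>lborel)) \<partial>lborel)"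
      by (simp add: nn_integral_cmult)
    finally show ?thesis .
  qed
  have Xt: "(\<integral>\<^sup>+ h. indicator X (x + h) \<partial>lborel) = emeasure lborel X" for x
    using nn_integral_lborel_translate[of "indicator X" x] by (simp add: add.commute)
  have "ennreal (l - k) * (emeasure lborel N * emeasure lborel X)
      = (\<integral>\<^sup>+ x. ennreal (l - k) * (indicator N x * (\<integral>\<^sup>+ h. indicator X (x + h) \<partial>lborel)) \<partial>lborel)"
    unfolding Xt by (simp add: nn_integral_cmult nn_integral_multc)
  also have "\<dots> = (\<integral>\<^sup>+ x. \<integral>\<^sup>+ h. ennreal (l - k) * (indicator N x * indicator X (x + h)) \<partial>lborel \<partial>lborel)"
    by (simp add: nn_integral_cmult)
  also have "\<dots> = (\<integral>\<^sup>+ h. \<integral>\<^sup>+ x. ennreal (l - k) * (indicator N x * indicator X (x + h)) \<partial>lborel \<partial>lborel)"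
    by (rule lborel_pair.Fubini') measurable
  also have "\<dots> \<le> (\<integral>\<^sup>+ h. \<integral>\<^sup>+ s. ennreal (2 * r) * (indicator {0..1} s *
          (\<integral>\<^sup>+ x. f (x + s *\<^sub>R h) * (indicator N x * indicator X (x + h)) \<partial>lborel)) \<partial>lborel \<partial>lborel)"
    by (intro nn_integral_mono fixed)
  also have "\<dots> = (\<integral>\<^sup>+ s. \<integral>\<^sup>+ h. ennreal (2 * r) * (indicator {0..1} s *
          (\<integral>\<^sup>+ x. f (x + s *\<^sub>R h) * (indicator N x * indicator X (x + h)) \<partial>lborel)) \<partial>lborel \<partial>lborel)"
    by (rule lborel_pair.Fubini') measurable
  also have "\<dots> = (\<integral>\<^sup>+ s. ennreal (2 * r) * (indicator {0..1} s * J s) \<partial>lborel)"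
    unfolding J_def by (simp add: nn_integral_cmult)
  also have "\<dots> \<le> (\<integral>\<^sup>+ s. ennreal (2 * r) *
      (indicator {0..1 - \<tau>} s * (ennreal (1 / \<tau> ^ ?n) * emeasure lborel X * ?F)
       + indicator {1 - \<tau><..1} s * (ennreal (2 ^ ?n) * emeasure lborel N * ?F)) \<partial>lborel)"
  proof (intro nn_integral_mono mult_left_mono)
    fix s :: real
    \<comment> \<open>Away from \<open>X\<close>: the condition on \<open>N\<close> is dropped and
      the end in \<open>X\<close> becomes the base point; |s - 1| is at least \<tau>.\<close>
    have B: "J s \<le> ennreal (1 / \<tau> ^ ?n) * emeasure lborel X * ?F" if s: "0 \<le> s" "s \<le> 1 - \<tau>"
    proof -
      have "J s \<le> (\<integral>\<^sup>+ h. \<integral>\<^sup>+ x. f (x + s *\<^sub>R h) * indicator X (x + h) \<partial>lborel \<partial>lborel)"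
        unfolding J_def by (intro nn_integral_mono mult_left_mono) (auto simp: indicator_def)
      also have "\<dots> = (\<integral>\<^sup>+ h. \<integral>\<^sup>+ x. f (x + (s - 1) *\<^sub>R h) * indicator X x \<partial>lborel \<partial>lborel)"
        using nn_integral_lborel_translate[of "\<lambda>x. f (x + (s - 1) *\<^sub>R h) * indicator X x" h for h]
        by (simp add: algebra_simps)
      also have "\<dots> = (\<integral>\<^sup>+ x. \<integral>\<^sup>+ h. f (x + (s - 1) *\<^sub>R h) * indicator X x \<partial>lborel \<partial>lborel)"
        by (rule lborel_pair.Fubini') measurable
      also have "\<dots> = ennreal (1 / \<bar>s - 1\<bar> ^ ?n) * emeasure lborel X * ?F"
        using s \<tau> by (simp add: nn_integral_multc nn_integral_lborel_scale nn_integral_cmult mult.assoc mult.left_commute mult.commute)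
      also have "\<dots> \<le> ennreal (1 / \<tau> ^ ?n) * emeasure lborel X * ?F"
        using s \<tau> by (intro mult_right_mono ennreal_leI divide_left_mono power_mono mult_pos_pos zero_less_power) auto
      finally show ?thesis .
    qed
    \<comment> \<open>Near \<open>X\<close>: the condition on \<open>X\<close> is dropped and
      \<open>N\<close> is the base. The Jacobian is bounded by 2^n because s > 1/2; the smallness
      comes from the length \<tau> of this range of \<open>s\<close>.\<close>
    have A: "J s \<le> ennreal (2 ^ ?n) * emeasure lborel N * ?F" if s: "1 - \<tau> < s"
    proof -
      have "J s \<le> (\<integral>\<^sup>+ h. \<integral>\<^sup>+ x. f (x + s *\<^sub>R h) * indicator N x \<partial>lborel \<partial>lborel)"
        unfolding J_def by (intro nn_integral_mono mult_left_mono) (auto simp: indicator_def)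
      also have "\<dots> = (\<integral>\<^sup>+ x. \<integral>\<^sup>+ h. f (x + s *\<^sub>R h) * indicator N x \<partial>lborel \<partial>lborel)"
        by (rule lborel_pair.Fubini') measurable
      also have "\<dots> = ennreal (1 / \<bar>s\<bar> ^ ?n) * emeasure lborel N * ?F"
        using s \<tau> by (simp add: nn_integral_multc nn_integral_lborel_scale nn_integral_cmult mult.assoc mult.left_commute mult.commute)
      also have "\<dots> \<le> ennreal (2 ^ ?n) * emeasure lborel N * ?F"
      proof (intro mult_right_mono ennreal_leI)
        have "(1 / 2) ^ ?n \<le> \<bar>s\<bar> ^ ?n" using s \<tau> by (intro power_mono) auto
        then have "1 / \<bar>s\<bar> ^ ?n \<le> 1 / (1 / 2) ^ ?n"
          using s \<tau> by (intro divide_left_mono mult_pos_pos zero_less_power) auto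
        then show "1 / \<bar>s\<bar> ^ ?n \<le> 2 ^ ?n" by (simp add: power_divide)
      qed auto
      finally show ?thesis .
    qed
    show "indicator {0..1} s * J s \<le>
       indicator {0..1 - \<tau>} s * (ennreal (1 / \<tau> ^ ?n) * emeasure lborel X * ?F)
       + indicator {1 - \<tau><..1} s * (ennreal (2 ^ ?n) * emeasure lborel N * ?F)"
    proof (cases "0 \<le> s \<and> s \<le> 1")
      case True
      then show ?thesis
        using A B \<tau> by (cases "s \<le> 1 - \<tau>") (auto simp: indicator_def)
    qed (auto simp: indicator_def)
  qed auto
  also have "\<dots> = ennreal (2 * r) * (ennreal (1 - \<tau>) * (ennreal (1 / \<tau> ^ ?n) * emeasure lborel X * ?F)
      + ennreal \<tau> * (ennreal (2 ^ ?n) * emeasure lborel N * ?F))"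
    using \<tau> by (simp add: nn_integral_cmult nn_integral_add nn_integral_multc)
  also have "\<dots> \<le> ennreal (2 * r) * (1 * (ennreal (1 / \<tau> ^ ?n) * emeasure lborel X * ?F)
      + ennreal \<tau> * (ennreal (2 ^ ?n) * emeasure lborel N * ?F))"
    using \<tau> by (intro mult_left_mono add_right_mono mult_right_mono) auto
  also have "\<dots> = ennreal (2 * r) * ((ennreal (1 / \<tau> ^ ?n) * emeasure lborel X
        + ennreal (\<tau> * 2 ^ ?n) * emeasure lborel N) * ?F)"
    using \<tau> by (simp add: distrib_right ennreal_mult mult.assoc)
  finally show ?thesis unfolding f_def .
qed


section \<open>Borel representatives, and the isoperimetric inequality for the original
  function\<close>

lemma set_integrable_lebesgue_borel_version:
  fixes w :: "'a::euclidean_space \<Rightarrow> real"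
  assumes "set_integrable lebesgue S w"
  obtains W where "integrable lborel W" "AE x in lborel. indicator S x * w x = W x"
proof -
  have int: "integrable lebesgue (\<lambda>x. indicator S x * w x)"
    using assms by (simp add: set_integrable_def)
  then have "(\<lambda>x. indicator S x * w x) \<in> borel_measurable (completion lborel)" by auto
  then obtain W where W: "W \<in> borel_measurable lborel" "AE x in lborel. indicator S x * w x = W x"
    using completion_ex_borel_measurable_real by blast
  have "integrable lebesgue W"
    using int W(1) AE_completion[OF W(2)]
    by (subst integrable_cong_AE[where g = "\<lambda>x. indicator S x * w x"])
      (auto intro: measurable_completion elim!: eventually_mono)
  then have "integrable lborel W" using W(1) by (simp add: integrable_completion)
  then show ?thesis using that W(2) by blast
qed

text \<open>The closed ball is compact in \<Omega>, so local integrability gives integrability on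
  it, and cutting off outside it is invisible to test functions supported in the open ball.
  \<open>G\<close> is assembled from Borel versions of the coordinates of \<open>g\<close>;
  linearity of the derivative extends the weak identity from basis vectors to all
  directions.\<close>

lemma has_weak_gradient_borel_version:
  fixes w :: "'a::euclidean_space \<Rightarrow> real"
  assumes wg: "has_weak_gradient \<Omega> w g" and sub: "cball y r \<subseteq> \<Omega>"
  obtains W G where "has_integrable_weak_gradient (ball y r) W G"
    "AE x in lborel. x \<in> ball y r \<longrightarrow> w x = W x \<and> g x = G x"
proof -
  let ?S = "cball y r"
  have wint: "set_integrable lebesgue ?S w" and gint: "set_integrable lebesgue ?S g"
    using wg sub by (auto simp: has_weak_gradient_def locally_integrable_def)
  obtain W where W: "integrable lborel W" "AE x in lborel. indicator ?S x * w x = W x"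
    using set_integrable_lebesgue_borel_version[OF wint] by blast
  have "\<exists>Gi. integrable lborel Gi \<and> (AE x in lborel. indicator ?S x * (g x \<bullet> i) = Gi x)" for i
  proof -
    have "integrable lebesgue (\<lambda>x. (indicator ?S x *\<^sub>R g x) \<bullet> i)"
      using gint unfolding set_integrable_def by (rule integrable_inner_left)
    then have "set_integrable lebesgue ?S (\<lambda>x. g x \<bullet> i)"
      by (simp add: set_integrable_def)
    from set_integrable_lebesgue_borel_version[OF this] show ?thesis by blast
  qed
  then obtain Gi where Gi: "\<And>i. integrable lborel (Gi i)"
    "\<And>i. AE x in lborel. indicator ?S x * (g x \<bullet> i) = Gi i x" by metis
  define G where "G x = (\<Sum>i\<in>Basis. Gi i x *\<^sub>R i)" for x
  have Gint: "integrable lborel G"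
    unfolding G_def using Gi(1) by (intro Bochner_Integration.integrable_sum integrable_scaleR_left) auto
  have "AE x in lborel. \<forall>i\<in>Basis. indicator ?S x * (g x \<bullet> i) = Gi i x"
    using Gi(2) by (subst AE_ball_countable) (auto intro: countable_finite)
  then have G: "AE x in lborel. indicator ?S x *\<^sub>R g x = G x"
  proof eventually_elim
    case (elim x)
    have "G x = (\<Sum>i\<in>Basis. ((indicator ?S x *\<^sub>R g x) \<bullet> i) *\<^sub>R i)"
      unfolding G_def by (rule sum.cong) (use elim in auto)
    then show ?case unfolding euclidean_representation by simp
  qed
  have [measurable]: "W \<in> borel_measurable borel" "G \<in> borel_measurable borel" using W Gint by auto
  have weak: "(LINT x|lborel. W x * frechet_derivative \<phi> (at x) h) = - (LINT x|lborel. (G x \<bullet> h) * \<phi> x)"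
    if \<phi>: "test_function (ball y r) \<phi>" for \<phi> h
  proof -
    let ?D = "\<lambda>i x. frechet_derivative \<phi> (at x) i"
    have [measurable]: "?D i \<in> borel_measurable borel" for i
      using test_function_derivative_continuous[OF \<phi>] by (rule borel_measurable_continuous_onI)
    have [measurable]: "\<phi> \<in> borel_measurable borel"
      using test_function_continuous[OF \<phi>] by (rule borel_measurable_continuous_onI)
    have \<phi>': "test_function \<Omega> \<phi>"
      by (rule test_function_mono[OF \<phi>]) (use sub ball_subset_cball in blast)
    have sw: "integrable lebesgue (\<lambda>x. indicator ?S x * w x)"
      using wint by (simp add: set_integrable_def)
    have sg: "integrable lebesgue (\<lambda>x. indicator ?S x *\<^sub>R g x)"
      using gint by (simp add: set_integrable_def)
    have leb [measurable]: "?D i \<in> borel_measurable lebesgue" "\<phi> \<in> borel_measurable lebesgue"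
      "W \<in> borel_measurable lebesgue" "G \<in> borel_measurable lebesgue"
      "(\<lambda>x. indicator ?S x * w x) \<in> borel_measurable lebesgue"
      "(\<lambda>x. indicator ?S x *\<^sub>R g x) \<in> borel_measurable lebesgue" for i
      using sw sg by (auto intro: measurable_completion)
    have basis: "(LINT x|lborel. W x * ?D i x) = - (LINT x|lborel. (G x \<bullet> i) * \<phi> x)" if i: "i \<in> Basis" for i
    proof -
      have "(LINT x|lborel. W x * ?D i x) = (LINT x|lebesgue. W x * ?D i x)"
        by (rule integral_completion[symmetric]) measurable
      also have "\<dots> = (LINT x|lebesgue. (indicator ?S x * w x) * ?D i x)"
        by (rule integral_cong_AE) (use AE_completion[OF W(2)] in \<open>auto elim!: eventually_mono\<close>)
      also have "\<dots> = (LINT x:\<Omega>|lebesgue. w x * ?D i x)"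
        unfolding set_lebesgue_integral_def
        by (rule Bochner_Integration.integral_cong)
          (use sub test_function_derivative_outside[OF \<phi>] in \<open>auto simp: indicator_def subset_iff\<close>)
      also have "\<dots> = - (LINT x:\<Omega>|lebesgue. (g x \<bullet> i) * \<phi> x)"
        using wg \<phi>' i by (simp add: has_weak_gradient_def)
      also have "(LINT x:\<Omega>|lebesgue. (g x \<bullet> i) * \<phi> x) = (LINT x|lebesgue. ((indicator ?S x *\<^sub>R g x) \<bullet> i) * \<phi> x)"
        unfolding set_lebesgue_integral_def
        by (rule Bochner_Integration.integral_cong)
          (use sub test_function_eq_0[OF \<phi>] in \<open>auto simp: indicator_def subset_iff\<close>)
      also have "\<dots> = (LINT x|lebesgue. (G x \<bullet> i) * \<phi> x)"
      proof (rule integral_cong_AE)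
        show "AE x in lebesgue. ((indicator ?S x *\<^sub>R g x) \<bullet> i) * \<phi> x = (G x \<bullet> i) * \<phi> x"
          using AE_completion[OF G] by eventually_elim (simp only:)
        show "(\<lambda>x. ((indicator ?S x *\<^sub>R g x) \<bullet> i) * \<phi> x) \<in> borel_measurable lebesgue"
          by (intro borel_measurable_times borel_measurable_inner leb) auto
      qed measurable
      also have "\<dots> = (LINT x|lborel. (G x \<bullet> i) * \<phi> x)"
        by (rule integral_completion) measurable
      finally show ?thesis .
    qed
    have WD: "integrable lborel (\<lambda>x. W x * ?D i x)" for i
    proof -
      obtain C where C: "\<And>x. \<bar>?D i x\<bar> \<le> C" using test_function_derivative_bounded[OF \<phi>] by blast
      show ?thesis
      proof (rule Bochner_Integration.integrable_bound[where f = "\<lambda>x. C * W x"])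
        show "AE x in lborel. norm (W x * ?D i x) \<le> norm (C * W x)"
          using C order_trans[OF abs_ge_zero C]
          by (intro AE_I2) (simp add: abs_mult mult.commute[of C] mult_left_mono)
      qed (use W in auto)
    qed
    have G\<phi>: "integrable lborel (\<lambda>x. (G x \<bullet> i) * \<phi> x)" for i
    proof -
      obtain C where C: "\<And>x. \<bar>\<phi> x\<bar> \<le> C" using test_function_bounded[OF \<phi>] by blast
      show ?thesis
      proof (rule Bochner_Integration.integrable_bound[where f = "\<lambda>x. C * (G x \<bullet> i)"])
        show "AE x in lborel. norm ((G x \<bullet> i) * \<phi> x) \<le> norm (C * (G x \<bullet> i))"
          using C order_trans[OF abs_ge_zero C]
          by (intro AE_I2) (simp add: abs_mult mult.commute[of C] mult_left_mono)
      qed (use Gint in auto)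
    qed
    have D: "?D h x = (\<Sum>i\<in>Basis. (h \<bullet> i) * ?D i x)" for x
    proof -
      interpret linear "frechet_derivative \<phi> (at x)"
        using has_derivative_linear[OF test_function_has_derivative[OF \<phi>]] .
      have "?D h x = frechet_derivative \<phi> (at x) (\<Sum>i\<in>Basis. (h \<bullet> i) *\<^sub>R i)"
        by (simp add: euclidean_representation)
      then show ?thesis by (simp add: sum scaleR)
    qed
    have "(LINT x|lborel. W x * ?D h x) = (LINT x|lborel. (\<Sum>i\<in>Basis. (h \<bullet> i) * (W x * ?D i x)))"
      by (simp add: D sum_distrib_left mult.left_commute)
    also have "\<dots> = (\<Sum>i\<in>Basis. (h \<bullet> i) * (LINT x|lborel. W x * ?D i x))"
      using WD by simp
    also have "\<dots> = - (\<Sum>i\<in>Basis. (h \<bullet> i) * (LINT x|lborel. (G x \<bullet> i) * \<phi> x))"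
      by (simp add: basis sum_negf)
    also have "(\<Sum>i\<in>Basis. (h \<bullet> i) * (LINT x|lborel. (G x \<bullet> i) * \<phi> x))
        = (LINT x|lborel. (\<Sum>i\<in>Basis. (h \<bullet> i) * ((G x \<bullet> i) * \<phi> x)))"
      using G\<phi> by simp
    also have "\<dots> = (LINT x|lborel. (G x \<bullet> h) * \<phi> x)"
      by (simp add: euclidean_inner[of _ h] sum_distrib_right mult.assoc mult.left_commute)
    finally show ?thesis .
  qed
  have "has_integrable_weak_gradient (ball y r) W G"
    using W(1) Gint weak by (simp add: has_integrable_weak_gradient_def)
  moreover have "AE x in lborel. x \<in> ball y r \<longrightarrow> w x = W x \<and> g x = G x"
    using W(2) G by eventually_elim (auto simp: indicator_def split: if_splits)
  ultimately show ?thesis using that by blast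
qed

lemma weak_gradient_sublevel_sets:
  fixes w :: "'a::euclidean_space \<Rightarrow> real"
  assumes wg: "has_weak_gradient \<Omega> w g" and sub: "ball y r \<subseteq> \<Omega>" and S: "S \<in> sets borel"
  shows "{x \<in> ball y r. w x \<in> S} \<in> sets lebesgue"
proof -
  have "w \<in> borel_measurable (lebesgue_on \<Omega>)"
    using wg by (simp add: has_weak_gradient_def locally_integrable_def)
  then have "w \<in> borel_measurable (lebesgue_on (ball y r))"
    using sub measurable_restrict_mono by blast
  then have "w -` S \<inter> space (lebesgue_on (ball y r)) \<in> sets (lebesgue_on (ball y r))"
    using S by (rule measurable_sets)
  then have "w -` S \<inter> ball y r \<in> sets lebesgue"
    by (simp add: sets_restrict_space_iff space_restrict_space)
  moreover have "w -` S \<inter> ball y r = {x \<in> ball y r. w x \<in> S}" by auto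
  ultimately show ?thesis by simp
qed

text \<open>All sets lie in one ball, so their measures are finite and the inequality for the Borel
  versions descends from extended to real numbers.\<close>

lemma isoperimetric_linear:
  fixes w :: "'a::euclidean_space \<Rightarrow> real"
  assumes wg: "has_weak_gradient \<Omega> w g" and sub: "cball y r \<subseteq> \<Omega>" and r: "0 < r"
    and "k < l" and \<tau>: "0 < \<tau>" "\<tau> \<le> 1 / 2"
    and I: "(\<integral>\<^sup>+ x\<in>{x \<in> ball y r. k < w x \<and> w x < l}. ennreal (norm (g x)) \<partial>lebesgue) \<le> ennreal I" "0 \<le> I"
  defines "N \<equiv> measure lebesgue {x \<in> ball y r. w x \<le> k}"
    and "X \<equiv> measure lebesgue {x \<in> ball y r. l < w x}"
  shows "(l - k) * (N * X) \<le> 2 * r * ((X / \<tau> ^ DIM('a) + \<tau> * 2 ^ DIM('a) * N) * I)"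
proof -
  obtain W G where WG: "has_integrable_weak_gradient (ball y r) W G"
    and AE: "AE x in lborel. x \<in> ball y r \<longrightarrow> w x = W x \<and> g x = G x"
    using has_weak_gradient_borel_version[OF wg sub] by blast
  have [measurable]: "W \<in> borel_measurable borel" "G \<in> borel_measurable borel"
    using WG by (auto simp: has_integrable_weak_gradient_def)
  have bsub: "ball y r \<subseteq> \<Omega>" using sub ball_subset_cball by blast
  have meas: "emeasure lborel {x \<in> ball y r. W x \<in> S} = ennreal (measure lebesgue {x \<in> ball y r. w x \<in> S})"
    if S: "S \<in> sets borel" for S
  proof -
    have b: "{x \<in> ball y r. W x \<in> S} \<in> sets borel" using S by measurable
    have w: "{x \<in> ball y r. w x \<in> S} \<in> sets lebesgue"
      by (rule weak_gradient_sublevel_sets[OF wg bsub S])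
    have "emeasure lborel {x \<in> ball y r. W x \<in> S} = emeasure lebesgue {x \<in> ball y r. W x \<in> S}"
      using b by (simp add: emeasure_completion)
    also have "\<dots> = emeasure lebesgue {x \<in> ball y r. w x \<in> S}"
    proof (rule emeasure_eq_AE)
      show "AE x in lebesgue. x \<in> {x \<in> ball y r. W x \<in> S} \<longleftrightarrow> x \<in> {x \<in> ball y r. w x \<in> S}"
        using AE_completion[OF AE] by eventually_elim auto
    qed (use b w in auto)
    also have "\<dots> = ennreal (measure lebesgue {x \<in> ball y r. w x \<in> S})"
    proof (rule emeasure_eq_ennreal_measure)
      have "{x \<in> ball y r. w x \<in> S} \<in> lmeasurable"
        by (rule bounded_set_imp_lmeasurable[OF _ w]) (auto intro: bounded_subset[OF bounded_ball])
      then show "emeasure lebesgue {x \<in> ball y r. w x \<in> S} \<noteq> top"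
        using fmeasurableD2 by blast
    qed
    finally show ?thesis .
  qed
  have N: "emeasure lborel {x \<in> ball y r. W x \<le> k} = ennreal N"
    using meas[of "{..k}"] by (simp add: N_def)
  have X: "emeasure lborel {x \<in> ball y r. l < W x} = ennreal X"
    using meas[of "{l<..}"] by (simp add: X_def)
  have "(\<integral>\<^sup>+ z. indicator {x \<in> ball y r. k < W x \<and> W x < l} z * ennreal (norm (G z)) \<partial>lborel)
      = (\<integral>\<^sup>+ z. indicator {x \<in> ball y r. k < W x \<and> W x < l} z * ennreal (norm (G z)) \<partial>lebesgue)"
    by (rule nn_integral_completion[symmetric])
  also have "\<dots> = (\<integral>\<^sup>+ x\<in>{x \<in> ball y r. k < w x \<and> w x < l}. ennreal (norm (g x)) \<partial>lebesgue)"
    by (rule nn_integral_cong_AE)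
      (use AE_completion[OF AE] in \<open>auto elim!: eventually_mono simp: indicator_def\<close>)
  also note I(1)
  finally have F: "(\<integral>\<^sup>+ z. indicator {x \<in> ball y r. k < W x \<and> W x < l} z * ennreal (norm (G z)) \<partial>lborel) \<le> ennreal I" .
  have nn: "0 \<le> N" "0 \<le> X" by (simp_all add: N_def X_def)
  have "ennreal (l - k) * (ennreal N * ennreal X)
    \<le> ennreal (2 * r) * ((ennreal (1 / \<tau> ^ DIM('a)) * ennreal X + ennreal (\<tau> * 2 ^ DIM('a)) * ennreal N)
      * (\<integral>\<^sup>+ z. indicator {x \<in> ball y r. k < W x \<and> W x < l} z * ennreal (norm (G z)) \<partial>lborel))"
    using isoperimetric_scaling[OF WG \<open>k < l\<close> \<tau>] unfolding N X .
  also have "\<dots> \<le> ennreal (2 * r) * ((ennreal (1 / \<tau> ^ DIM('a)) * ennreal X + ennreal (\<tau> * 2 ^ DIM('a)) * ennreal N)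
      * ennreal I)"
    by (intro mult_left_mono F) auto
  also have "\<dots> = ennreal (2 * r * ((1 / \<tau> ^ DIM('a) * X + \<tau> * 2 ^ DIM('a) * N) * I))"
    using nn r \<tau> I(2) by (simp add: ennreal_plus[symmetric] ennreal_mult[symmetric] del: ennreal_plus)
  also have "ennreal (l - k) * (ennreal N * ennreal X) = ennreal ((l - k) * (N * X))"
    using nn \<open>k < l\<close> by (simp add: ennreal_mult)
  finally show ?thesis
    using nn r \<tau> I(2) by (subst (asm) ennreal_le_iff) auto
qed

text \<open>With z the (n+1)-st root of \<open>Y\<close> and \<tau> = z / 2, both terms of the
  linear inequality are of order z times the measure of the ball. Since the measure above
  \<open>l\<close> is z^(n+1) times that of the ball, cancelling one z leaves z^n on the left. So
  \<open>Y\<close> to the power n / (n + 1) is controlled by the gradient, and this exponent below 1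
  is what makes De Giorgi's iteration contract.\<close>

lemma isoperimetric_power:
  fixes w :: "'a::euclidean_space \<Rightarrow> real"
  assumes wg: "has_weak_gradient \<Omega> w g" and sub: "cball y r \<subseteq> \<Omega>" and r: "0 < r"
    and "k < l" and \<nu>: "0 < \<nu>"
    and I: "(\<integral>\<^sup>+ x\<in>{x \<in> ball y r. k < w x \<and> w x < l}. ennreal (norm (g x)) \<partial>lebesgue) \<le> ennreal I" "0 \<le> I"
    and N: "\<nu> * measure lebesgue (ball y r) \<le> measure lebesgue {x \<in> ball y r. w x \<le> k}"
  defines "Y \<equiv> measure lebesgue {x \<in> ball y r. l < w x} / measure lebesgue (ball y r)"
  shows "Y ^ DIM('a) * ((l - k) * \<nu>) ^ Suc DIM('a)
    \<le> (2 ^ (DIM('a) + 2) * r * I / measure lebesgue (ball y r)) ^ Suc DIM('a)"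
proof (cases "Y = 0")
  case True
  then show ?thesis
    using r I(2) by (simp add: power_0_left del: power_Suc)
next
  case False
  let ?n = "DIM('a)"
  define B where "B = measure lebesgue (ball y r)"
  define X where "X = measure lebesgue {x \<in> ball y r. l < w x}"
  define M where "M = measure lebesgue {x \<in> ball y r. w x \<le> k}"
  have B: "B > 0" unfolding B_def using r by (simp add: content_ball_pos)
  have bsub: "ball y r \<subseteq> \<Omega>" using sub ball_subset_cball by blast
  have le: "measure lebesgue {x \<in> ball y r. w x \<in> S} \<le> B" if "S \<in> sets borel" for S
    unfolding B_def
    by (rule measure_mono_fmeasurable) (use weak_gradient_sublevel_sets[OF wg bsub that] in auto)
  have XB: "X \<le> B" "M \<le> B" using le[of "{l<..}"] le[of "{..k}"] by (auto simp: X_def M_def)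
  have Y: "Y = X / B" by (simp add: Y_def X_def B_def)
  have X0: "0 \<le> X" by (simp add: X_def)
  then have Ypos: "0 < Y" "Y \<le> 1" using False B XB by (auto simp: Y divide_simps)
  define z where "z = root (Suc ?n) Y"
  have zY: "z ^ Suc ?n = Y" unfolding z_def using Ypos by (intro real_root_pow_pos2) auto
  have z: "0 < z" "z \<le> 1" unfolding z_def using Ypos by auto
  have "(l - k) * (M * X) \<le> 2 * r * ((X / (z / 2) ^ ?n + (z / 2) * 2 ^ ?n * M) * I)"
    using isoperimetric_linear[OF wg sub r \<open>k < l\<close> _ _ I, of "z / 2"] z unfolding X_def M_def by simp
  also have "X / (z / 2) ^ ?n = 2 ^ ?n * z * B"
  proof -
    have "X = z ^ Suc ?n * B" using zY Y B by simp
    then show ?thesis using z by (simp add: power_divide)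
  qed
  also have "(2 ^ ?n * z * B + (z / 2) * 2 ^ ?n * M) \<le> 2 ^ ?n * z * B + z * 2 ^ ?n * B"
    using z XB by (intro add_left_mono mult_mono) (auto simp: M_def)
  also have "(2 ^ ?n * z * B + z * 2 ^ ?n * B) = 2 ^ (?n + 1) * z * B" by simp
  finally have le1: "(l - k) * (M * X) \<le> 2 * r * (2 ^ (?n + 1) * z * B * I)"
    using r I(2) by (simp add: mult_left_mono mult_right_mono)
  have le2: "(l - k) * (\<nu> * B * X) \<le> (l - k) * (M * X)"
    using N \<open>k < l\<close> X0 by (intro mult_left_mono mult_right_mono) (auto simp: B_def M_def)
  have XzB: "X = z ^ Suc ?n * B" using zY Y B by simp
  have e1: "(l - k) * (\<nu> * B * (z ^ Suc ?n * B)) = ((l - k) * \<nu> * z ^ ?n) * (z * B * B)"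
    by (simp only: power_Suc mult_ac)
  have e2: "2 * r * (2 ^ (?n + 1) * z * B * I) = (2 ^ (?n + 2) * r * I / B) * (z * B * B)"
    using B by simp
  have "((l - k) * \<nu> * z ^ ?n) * (z * B * B) \<le> (2 ^ (?n + 2) * r * I / B) * (z * B * B)"
    using order_trans[OF le2 le1] unfolding e2 by (subst (asm) XzB) (simp only: e1)
  then have "(l - k) * \<nu> * z ^ ?n \<le> 2 ^ (?n + 2) * r * I / B"
    using z B by (simp only: mult_le_cancel_right) auto
  then have "((l - k) * \<nu> * z ^ ?n) ^ Suc ?n \<le> (2 ^ (?n + 2) * r * I / B) ^ Suc ?n"
    using \<open>k < l\<close> \<nu> z by (intro power_mono) auto
  also have "((l - k) * \<nu> * z ^ ?n) ^ Suc ?n = (z ^ Suc ?n) ^ ?n * ((l - k) * \<nu>) ^ Suc ?n"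
  proof -
    have "(z ^ ?n) ^ Suc ?n = (z ^ Suc ?n) ^ ?n"
      unfolding power_mult[symmetric] by (simp only: mult.commute)
    then show ?thesis unfolding power_mult_distrib[of "(l - k) * \<nu>"] by (simp only: mult.commute)
  qed
  finally show ?thesis unfolding zY B_def .
qed


section \<open>Gauges and the energy inequality\<close>

text \<open>The two multiplicativity assumptions make \<open>F (a * b)\<close> and
  \<open>F a * F b\<close> comparable with one constant, which is the scale invariance used
  throughout. \<open>F\<close> takes the place of A(x, .), so that the estimates no longer see the
  space variable.\<close>

locale gauge =
  fixes F :: "real \<Rightarrow> real" and M\<^sub>0 :: real
  assumes F_cont: "continuous_on {0..} F"
    and F_strict_mono: "strict_mono_on {0..} F"
    and F_0: "0 \<le> F 0"
    and M\<^sub>0: "0 < M\<^sub>0"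
    and F_submult: "\<And>a b. 0 < a \<Longrightarrow> 0 < b \<Longrightarrow> F (a * b) \<le> M\<^sub>0 * F a * F b"
    and F_supermult: "\<And>a b. 0 < a \<Longrightarrow> 0 < b \<Longrightarrow> F a * F b \<le> M\<^sub>0 * F (a * b)"
    and F_superlinear: "filterlim (\<lambda>t. F t / t) at_top at_top"
begin

lemma F_mono: "0 \<le> a \<Longrightarrow> a \<le> b \<Longrightarrow> F a \<le> F b"
  using strict_mono_onD[OF F_strict_mono, of a b] by (cases "a = b") auto

lemma F_pos: "0 < t \<Longrightarrow> 0 < F t"
  using strict_mono_onD[OF F_strict_mono, of 0 t] F_0 by auto

lemma F_nonneg: "0 \<le> t \<Longrightarrow> 0 \<le> F t"
  using F_mono[of 0 t] F_0 by auto

text \<open>If a > L s, put t = a / s. Superlinearity gives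
  \<open>M\<^sub>0 * t \<le> \<epsilon> * F t\<close>, and supermultiplicativity turns
  \<open>F t * F s\<close> into at most \<open>M\<^sub>0 * F a\<close>, so that
  \<open>M\<^sub>0\<close> cancels. The threshold is on the ratio t, hence \<open>L\<close> does not
  depend on \<open>s\<close>.\<close>

lemma quasi_Young:
  assumes "0 < \<epsilon>"
  obtains L where "0 < L" "\<And>a s. 0 \<le> a \<Longrightarrow> 0 < s \<Longrightarrow> a \<le> L * s + \<epsilon> * s * F a / F s"
proof -
  obtain T where T: "\<And>t. t \<ge> T \<Longrightarrow> M\<^sub>0 / \<epsilon> \<le> F t / t"
    using F_superlinear unfolding filterlim_at_top eventually_at_top_linorder by blast
  define L where "L = max T 1"
  have "a \<le> L * s + \<epsilon> * s * F a / F s" if a: "0 \<le> a" and s: "0 < s" for a s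
  proof (cases "a \<le> L * s")
    case True
    moreover have "0 \<le> \<epsilon> * s * F a / F s"
      using assms a s F_nonneg[of a] F_pos[of s] by simp
    ultimately show ?thesis by simp
  next
    case False
    define t where "t = a / s"
    have "L < t" using False s by (simp add: t_def pos_less_divide_eq)
    moreover have "1 \<le> L" by (simp add: L_def)
    ultimately have t: "L < t" "0 < t" "a = t * s" using s by (auto simp: t_def)
    have "M\<^sub>0 / \<epsilon> \<le> F t / t" using T[of t] t by (auto simp: L_def)
    then have "M\<^sub>0 * t \<le> \<epsilon> * F t"
      using t assms by (simp add: field_simps)
    then have "M\<^sub>0 * t * F s \<le> \<epsilon> * F t * F s"
      using F_pos[OF s] by (intro mult_right_mono) auto
    also have "\<epsilon> * F t * F s \<le> \<epsilon> * (M\<^sub>0 * F a)"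
      using F_supermult[of t s] t s assms by (simp add: mult.assoc mult_left_mono)
    finally have "M\<^sub>0 * (t * F s) \<le> M\<^sub>0 * (\<epsilon> * F a)"
      by (simp only: mult.assoc mult.left_commute[of \<epsilon>])
    then have "t * F s \<le> \<epsilon> * F a" using M\<^sub>0 by simp
    then have "t \<le> \<epsilon> * F a / F s" using F_pos[OF s] by (simp add: field_simps)
    then have "a \<le> \<epsilon> * F a / F s * s" using s t(3) by (metis less_imp_le mult_right_mono)
    also have "\<dots> = \<epsilon> * s * F a / F s" by simp
    also have "\<dots> \<le> L * s + \<epsilon> * s * F a / F s" using s by (simp add: L_def)
    finally show ?thesis .
  qed
  then show ?thesis using that[of L] by (simp add: L_def)
qed

text \<open>Submultiplicativity gives doubling. Radius gaps that halve at each step of the iteration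
  therefore cost only a geometric factor.\<close>

lemma F_power_2:
  assumes "0 < t" "1 \<le> a" "M\<^sub>0 * F 2 \<le> a"
  shows "F (2 ^ j * t) \<le> a ^ j * F t"
proof (induction j)
  case (Suc j)
  have "F (2 ^ Suc j * t) = F (2 * (2 ^ j * t))" by (simp add: mult.assoc)
  also have "\<dots> \<le> M\<^sub>0 * F 2 * F (2 ^ j * t)"
    using assms by (intro F_submult) auto
  also have "\<dots> \<le> a * (a ^ j * F t)"
    using assms Suc F_pos[of "2 ^ j * t"] F_pos[of 2] M\<^sub>0 by (intro mult_mono) auto
  finally show ?case by (simp add: mult.assoc)
qed simp

end

text \<open>The Caccioppoli inequality with \<open>A\<close> eliminated. \<open>b\<close> may be any
  essential upper bound on the ball, and on the right w - k has been estimated by b - k. The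
  gradient is a parameter because the function and its negative come with separately chosen
  gradients.\<close>

definition energy_class ::
    "'a::euclidean_space set \<Rightarrow> (real \<Rightarrow> real) \<Rightarrow> real \<Rightarrow> real \<Rightarrow> real \<Rightarrow> ('a \<Rightarrow> real) \<Rightarrow> ('a \<Rightarrow> 'a) \<Rightarrow> bool" where
  "energy_class \<Omega> F C\<^sub>1 C\<^sub>2 d w g \<longleftrightarrow> has_weak_gradient \<Omega> w g \<and>
     (\<forall>y \<rho> \<sigma> b k. 0 < \<rho> \<longrightarrow> ball y \<rho> \<subseteq> \<Omega> \<longrightarrow> 0 < \<sigma> \<longrightarrow> \<sigma> < 1 \<longrightarrow>
        (AE x in lebesgue. x \<in> ball y \<rho> \<longrightarrow> w x \<le> b) \<longrightarrow> b - d \<le> k \<longrightarrow> k < b \<longrightarrow>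
        (\<integral>\<^sup>+x\<in>superlevel w k y (\<sigma> * \<rho>). ennreal (F (norm (g x))) \<partial>lebesgue)
          \<le> ennreal (C\<^sub>1 * F ((b - k) / ((1 - \<sigma>) * \<rho>)) + C\<^sub>2) * emeasure lebesgue (superlevel w k y \<rho>))"

lemma superlevel_lmeasurable:
  assumes "has_weak_gradient \<Omega> w g" "ball y r \<subseteq> \<Omega>"
  shows "superlevel w k y r \<in> lmeasurable"
proof (rule bounded_set_imp_lmeasurable)
  show "superlevel w k y r \<in> sets lebesgue"
    using weak_gradient_sublevel_sets[OF assms, of "{k<..}"] by (simp add: superlevel_def)
  show "bounded (superlevel w k y r)"
    unfolding superlevel_def by (rule bounded_subset[OF bounded_ball[of y r]]) auto
qed

lemma (in gauge) borel_measurable_gauge_gradient: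
  fixes w :: "'a::euclidean_space \<Rightarrow> real"
  assumes wg: "has_weak_gradient \<Omega> w g" and E: "E \<in> sets lebesgue" "E \<subseteq> \<Omega>"
  shows "(\<lambda>x. F (norm (indicator E x *\<^sub>R g x))) \<in> borel_measurable lebesgue"
proof -
  have "g \<in> borel_measurable (lebesgue_on \<Omega>)"
    using wg by (simp add: has_weak_gradient_def locally_integrable_def)
  then have "g \<in> borel_measurable (lebesgue_on E)"
    using E(2) measurable_restrict_mono by blast
  then have g': "(\<lambda>x. indicator E x *\<^sub>R g x) \<in> borel_measurable lebesgue"
    using E(1) by (simp add: borel_measurable_restrict_space_iff)
  have "continuous_on UNIV (\<lambda>v::'a. F (norm v))"
    by (rule continuous_on_compose2[OF F_cont]) (auto intro!: continuous_intros)
  then have "(\<lambda>v::'a. F (norm v)) \<in> borel_measurable borel"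
    by (rule borel_measurable_continuous_onI)
  from measurable_compose[OF g' this] show ?thesis .
qed

text \<open>The quasi-Young inequality for the norm of \<open>g\<close>, integrated over
  \<open>E\<close>. The first term sees only the measure of \<open>E\<close>; the second sees the
  whole superlevel set, but with the factor \<epsilon>.\<close>

lemma (in gauge) gradient_bound:
  fixes w :: "'a::euclidean_space \<Rightarrow> real"
  assumes en: "energy_class \<Omega> F C\<^sub>1 C\<^sub>2 d w g" and C: "0 \<le> C\<^sub>1" "0 \<le> C\<^sub>2"
    and ball: "0 < \<rho>" "ball y \<rho> \<subseteq> \<Omega>" and \<sigma>: "0 < \<sigma>" "\<sigma> < 1"
    and ae: "AE x in lebesgue. x \<in> ball y \<rho> \<longrightarrow> w x \<le> b" and k: "b - d \<le> k" "k < b"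
    and E: "E \<in> sets lebesgue" "E \<subseteq> superlevel w k y (\<sigma> * \<rho>)"
    and \<epsilon>: "0 < \<epsilon>" "0 < L" and s: "0 < s"
    and young: "\<And>a. 0 \<le> a \<Longrightarrow> a \<le> L * s + \<epsilon> * s * F a / F s"
  shows "(\<integral>\<^sup>+ x\<in>E. ennreal (norm (g x)) \<partial>lebesgue)
    \<le> ennreal (L * s * measure lebesgue E + \<epsilon> * s / F s * ((C\<^sub>1 * F ((b - k) / ((1 - \<sigma>) * \<rho>)) + C\<^sub>2)
        * measure lebesgue (superlevel w k y \<rho>)))"
proof -
  have wg: "has_weak_gradient \<Omega> w g" using en by (simp add: energy_class_def)
  have "\<sigma> * \<rho> \<le> \<rho>" using \<sigma> ball by simp
  then have sb: "ball y (\<sigma> * \<rho>) \<subseteq> ball y \<rho>" by (rule subset_ball)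
  have E\<Omega>: "E \<subseteq> \<Omega>" using E(2) sb ball(2) unfolding superlevel_def by blast
  have Es: "E \<subseteq> superlevel w k y \<rho>" using E(2) sb unfolding superlevel_def by blast
  have Elm: "E \<in> lmeasurable"
    by (rule fmeasurableI2[OF superlevel_lmeasurable[OF wg ball(2)] Es E(1)])
  \<comment> \<open>\<open>g\<close> is known to be measurable only on \<Omega>; its cut-off is
    measurable on the whole space and agrees with it on \<open>E\<close>.\<close>
  define g' where "g' x = indicator E x *\<^sub>R g x" for x
  have Fg: "(\<lambda>x. F (norm (g' x))) \<in> borel_measurable lebesgue"
    unfolding g'_def by (rule borel_measurable_gauge_gradient[OF wg E(1) E\<Omega>])
  have es: "0 \<le> \<epsilon> * s / F s" using \<epsilon> s F_pos[OF s] by simp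
  have en': "(\<integral>\<^sup>+x\<in>superlevel w k y (\<sigma> * \<rho>). ennreal (F (norm (g x))) \<partial>lebesgue)
      \<le> ennreal (C\<^sub>1 * F ((b - k) / ((1 - \<sigma>) * \<rho>)) + C\<^sub>2) * emeasure lebesgue (superlevel w k y \<rho>)"
    using en ball \<sigma> ae k by (simp add: energy_class_def)
  have arg: "0 < (b - k) / ((1 - \<sigma>) * \<rho>)" using k \<sigma> ball by simp
  have Cpos: "0 \<le> C\<^sub>1 * F ((b - k) / ((1 - \<sigma>) * \<rho>)) + C\<^sub>2"
    using F_pos[OF arg] C by simp
  have "(\<integral>\<^sup>+ x\<in>E. ennreal (norm (g x)) \<partial>lebesgue)
      \<le> (\<integral>\<^sup>+ x. ennreal (L * s) * indicator E x
          + ennreal (\<epsilon> * s / F s) * (ennreal (F (norm (g' x))) * indicator E x) \<partial>lebesgue)"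
  proof (rule nn_integral_mono)
    fix x
    show "ennreal (norm (g x)) * indicator E x \<le> ennreal (L * s) * indicator E x
          + ennreal (\<epsilon> * s / F s) * (ennreal (F (norm (g' x))) * indicator E x)"
    proof (cases "x \<in> E")
      case True
      have "norm (g x) \<le> L * s + \<epsilon> * s / F s * F (norm (g x))"
        using young[of "norm (g x)"] by simp
      then have "ennreal (norm (g x)) \<le> ennreal (L * s + \<epsilon> * s / F s * F (norm (g x)))"
        by (rule ennreal_leI)
      also have "\<dots> = ennreal (L * s) + ennreal (\<epsilon> * s / F s) * ennreal (F (norm (g x)))"
        using es \<epsilon> s F_nonneg[of "norm (g x)"]
        by (subst ennreal_plus) (auto simp only: ennreal_mult norm_ge_zero mult_nonneg_nonneg less_imp_le)
      finally show ?thesis using True by (simp add: g'_def)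
    qed simp
  qed
  also have "\<dots> = ennreal (L * s) * emeasure lebesgue E
      + ennreal (\<epsilon> * s / F s) * (\<integral>\<^sup>+ x. ennreal (F (norm (g' x))) * indicator E x \<partial>lebesgue)"
    using E(1) Fg by (simp add: nn_integral_add nn_integral_cmult)
  also have "(\<integral>\<^sup>+ x. ennreal (F (norm (g' x))) * indicator E x \<partial>lebesgue)
      \<le> (\<integral>\<^sup>+x\<in>superlevel w k y (\<sigma> * \<rho>). ennreal (F (norm (g x))) \<partial>lebesgue)"
    by (rule nn_integral_mono) (use E(2) in \<open>auto simp: g'_def indicator_def\<close>)
  also note en'
  also have "emeasure lebesgue E = ennreal (measure lebesgue E)"
    using Elm by (simp add: emeasure_eq_measure2)
  also have "emeasure lebesgue (superlevel w k y \<rho>) = ennreal (measure lebesgue (superlevel w k y \<rho>))"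
    using superlevel_lmeasurable[OF wg ball(2)] by (simp add: emeasure_eq_measure2)
  finally have "(\<integral>\<^sup>+ x\<in>E. ennreal (norm (g x)) \<partial>lebesgue)
    \<le> ennreal (L * s) * ennreal (measure lebesgue E) + ennreal (\<epsilon> * s / F s) *
      (ennreal (C\<^sub>1 * F ((b - k) / ((1 - \<sigma>) * \<rho>)) + C\<^sub>2) * ennreal (measure lebesgue (superlevel w k y \<rho>)))"
    by (simp add: add_left_mono mult_left_mono)
  moreover have "ennreal l * ennreal m + ennreal e * (ennreal c * ennreal m') = ennreal (l * m + e * (c * m'))"
    if "0 \<le> l" "0 \<le> m" "0 \<le> e" "0 \<le> c" "0 \<le> m'" for l m e c m' :: real
    using that by (simp add: ennreal_mult[symmetric] ennreal_plus[symmetric] del: ennreal_plus)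
  ultimately show ?thesis
    using es \<epsilon> s Cpos by (simp only: measure_nonneg mult_nonneg_nonneg less_imp_le)
qed

text \<open>The recursion has exponent 1 + 1/n. The ratio q = 1 / B^(n+1) is chosen so that in the
  (n+1)-st power of C B^i \<theta> q^i the surplus factor q^i cancels B^(i(n+1)); the smallness
  assumption then supplies the factor q^n needed for the next index.\<close>

lemma fast_geometric_convergence:
  fixes Y :: "nat \<Rightarrow> real"
  assumes Y: "\<And>i. 0 \<le> Y i" "Y 0 \<le> \<theta>" and B: "1 \<le> B" and C: "0 < C" and \<theta>: "0 < \<theta>" and n: "0 < n"
    and step: "\<And>i. Y i \<le> \<theta> \<Longrightarrow> Y (Suc i) ^ n \<le> (C * B ^ i * Y i) ^ Suc n"
    and small: "\<theta> * C ^ Suc n \<le> (1 / B ^ Suc n) ^ n"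
  shows "Y i \<le> \<theta> * (1 / B ^ Suc n) ^ i"
proof (induction i)
  case (Suc i)
  define q where "q = 1 / B ^ Suc n"
  have q: "0 < q" "q \<le> 1" using B one_le_power[OF B, of "Suc n"] by (auto simp: q_def divide_simps)
  have Bq: "B ^ Suc n * q = 1" using B by (simp add: q_def)
  have IH: "Y i \<le> \<theta> * q ^ i" using Suc by (simp add: q_def)
  \<comment> \<open>The recursion is available only below \<theta>; the bound being proved keeps the
    sequence there.\<close>
  also have "\<theta> * q ^ i \<le> \<theta>" using q \<theta> by (simp add: power_le_one mult_left_le)
  finally have "Y (Suc i) ^ n \<le> (C * B ^ i * Y i) ^ Suc n" by (rule step)
  also have "\<dots> \<le> (C * B ^ i * (\<theta> * q ^ i)) ^ Suc n"
    using IH Y B C by (intro power_mono mult_left_mono mult_nonneg_nonneg) auto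
  also have "\<dots> = (\<theta> * C ^ Suc n) * \<theta> ^ n * ((B ^ i) ^ Suc n * q ^ i) * (q ^ i) ^ n"
    unfolding power_mult_distrib by (simp only: power_Suc mult_ac)
  also have "(B ^ i) ^ Suc n * q ^ i = (B ^ Suc n * q) ^ i"
    unfolding power_mult_distrib power_mult[symmetric] by (simp only: mult.commute)
  also have "(B ^ Suc n * q) ^ i = 1"
    unfolding Bq by simp
  also have "(\<theta> * C ^ Suc n) * \<theta> ^ n * 1 * (q ^ i) ^ n = (\<theta> * C ^ Suc n) * (\<theta> ^ n * (q ^ i) ^ n)"
    by simp
  also have "\<dots> \<le> q ^ n * (\<theta> ^ n * (q ^ i) ^ n)"
    using small q \<theta> unfolding q_def[symmetric] by (intro mult_right_mono) auto
  also have "\<dots> = (\<theta> * q ^ Suc i) ^ n"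
    by (simp add: power_mult_distrib)
  finally have "Y (Suc i) ^ n \<le> (\<theta> * q ^ Suc i) ^ n" .
  then have "Y (Suc i) \<le> \<theta> * q ^ Suc i"
    using n q \<theta> power_mono_iff[of "Y (Suc i)" "\<theta> * q ^ Suc i" n] Y by simp
  then show ?case by (simp add: q_def)
qed (use Y in simp)


section \<open>De Giorgi's lemmas\<close>

lemma content_ball_ratio:
  fixes y z :: "'a::euclidean_space"
  assumes "0 \<le> c" "0 \<le> r"
  shows "measure lebesgue (ball y (c * r)) = c ^ DIM('a) * measure lebesgue (ball z r)"
  using assms by (simp add: content_ball power_mult_distrib)

lemma measure_sublevel_superlevel:
  fixes w :: "'a::euclidean_space \<Rightarrow> real"
  assumes "has_weak_gradient \<Omega> w g" "ball y r \<subseteq> \<Omega>"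
  shows "measure lebesgue {x \<in> ball y r. w x \<le> k} = measure lebesgue (ball y r) - measure lebesgue (superlevel w k y r)"
proof -
  have "{x \<in> ball y r. w x \<le> k} = ball y r - superlevel w k y r"
    by (auto simp: superlevel_def)
  then show ?thesis
    using measurable_measure_Diff[of "ball y r" lebesgue "superlevel w k y r"]
      fmeasurableD[OF superlevel_lmeasurable[OF assms, of k]]
    by (simp add: superlevel_def subset_iff)
qed

section \<open>From a small density of a superlevel set to an upper bound on the half ball\<close>

context gauge
begin

text \<open>At the slope \<open>s = H / R\<close> everything scales out: the argument of
  \<open>F\<close> in the energy bound is at most \<open>2 ^ (i + 2) * s\<close>, doubling pulls out
  \<open>F s\<close>, and \<open>K \<le> s\<close> puts \<open>C\<^sub>2\<close> below
  \<open>F s\<close>. The isoperimetric inequality between \<open>k\<close> and \<open>l\<close>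
  then yields the next density.\<close>

lemma density_step:
  fixes w :: "'a::euclidean_space \<Rightarrow> real"
  assumes en: "energy_class \<Omega> F C\<^sub>1 C\<^sub>2 d w g" and C: "0 \<le> C\<^sub>1" "0 \<le> C\<^sub>2" "C\<^sub>2 \<le> F K" "0 \<le> K"
    and R: "0 < r" "r < R'" "R' \<le> 2 * r" "R' \<le> R" "R' - r = R / 2 ^ (i + 2)" "ball y R' \<subseteq> \<Omega>"
    and H: "0 < H" "H \<le> d" "K * R \<le> H"
    and ae: "AE x in lebesgue. x \<in> ball y R' \<longrightarrow> w x \<le> b"
    and k: "b - H \<le> k" "k < b" "l - k = H / 2 ^ (i + 2)"
    and L: "0 < L" "\<And>a s. 0 \<le> a \<Longrightarrow> 0 < s \<Longrightarrow> a \<le> L * s + 1 * s * F a / F s"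
    and a: "1 \<le> a" "M\<^sub>0 * F 2 \<le> a"
    and small: "measure lebesgue (superlevel w k y R') / measure lebesgue (ball y R') \<le> 1 / 2 ^ Suc DIM('a)"
  shows "(measure lebesgue (superlevel w l y r) / measure lebesgue (ball y r)) ^ DIM('a)
    \<le> (2 ^ (i + 3) * 2 ^ (DIM('a) + 2) * (L + C\<^sub>1 + 1) * a ^ (i + 2) * 2 ^ DIM('a)
        * (measure lebesgue (superlevel w k y R') / measure lebesgue (ball y R'))) ^ Suc DIM('a)"
proof -
  let ?n = "DIM('a)"
  define B where "B = measure lebesgue (ball y r)"
  define B' where "B' = measure lebesgue (ball y R')"
  define X where "X = measure lebesgue (superlevel w k y R')"
  define Y where "Y = measure lebesgue (superlevel w l y r) / B"
  define s where "s = H / R"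
  define I where "I = s * ((L + C\<^sub>1 + 1) * a ^ (i + 2)) * X"
  have wg: "has_weak_gradient \<Omega> w g" using en by (simp add: energy_class_def)
  have Rpos: "0 < R" "0 < R'" using R by auto
  have s: "0 < s" using H Rpos by (simp add: s_def)
  have B: "0 < B" "0 < B'" using R Rpos by (auto simp: B_def B'_def content_ball_pos)
  have X: "0 \<le> X" by (simp add: X_def)
  have sub: "cball y r \<subseteq> \<Omega>" "ball y r \<subseteq> ball y R'"
    using R by (auto simp: subset_iff)
  have BB': "B' \<le> 2 ^ ?n * B"
  proof -
    have "B' \<le> measure lebesgue (ball y (2 * r))"
      unfolding B'_def by (rule measure_mono_fmeasurable) (use R in auto)
    then show ?thesis using R content_ball_ratio[of 2 r y y] by (simp add: B_def)
  qed
  define \<sigma> where "\<sigma> = r / R'"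
  have \<sigma>: "0 < \<sigma>" "\<sigma> < 1" "\<sigma> * R' = r" using R Rpos by (auto simp: \<sigma>_def)
  have gap: "(1 - \<sigma>) * R' = R / 2 ^ (i + 2)" using \<sigma>(3) R(5) by (simp add: left_diff_distrib)
  define E where "E = {x \<in> ball y r. k < w x \<and> w x < l}"
  have E: "E \<in> sets lebesgue" "E \<subseteq> superlevel w k y (\<sigma> * R')"
    using weak_gradient_sublevel_sets[OF wg, of y r "{k<..<l}"] sub R
    by (auto simp: E_def superlevel_def \<sigma>(3))
  have EX: "measure lebesgue E \<le> X"
    unfolding X_def
  proof (rule measure_mono_fmeasurable)
    show "E \<subseteq> superlevel w k y R'" using sub(2) by (auto simp: E_def superlevel_def)
  qed (use E superlevel_lmeasurable[OF wg R(6)] in auto)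
  have arg: "(b - k) / ((1 - \<sigma>) * R') \<le> 2 ^ (i + 2) * s"
  proof -
    have "(b - k) / ((1 - \<sigma>) * R') = (b - k) * 2 ^ (i + 2) / R" by (simp add: gap)
    also have "\<dots> \<le> H * 2 ^ (i + 2) / R"
      using k Rpos by (intro divide_right_mono mult_right_mono) auto
    finally show ?thesis by (simp add: s_def mult.commute)
  qed
  have "F ((b - k) / ((1 - \<sigma>) * R')) \<le> F (2 ^ (i + 2) * s)"
    using arg k \<sigma> Rpos by (intro F_mono) auto
  also have "\<dots> \<le> a ^ (i + 2) * F s" by (rule F_power_2[OF s a])
  finally have F1: "F ((b - k) / ((1 - \<sigma>) * R')) \<le> a ^ (i + 2) * F s" .
  have "K \<le> s" using H Rpos by (simp add: s_def field_simps)
  then have "C\<^sub>2 \<le> F s" using C F_mono[of K s] by simp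
  also have "\<dots> \<le> a ^ (i + 2) * F s"
    using one_le_power[OF a(1), of "i + 2"] F_pos[OF s] by (simp add: mult_le_cancel_right1)
  finally have F2: "C\<^sub>2 \<le> a ^ (i + 2) * F s" .
  have "(\<integral>\<^sup>+ x\<in>E. ennreal (norm (g x)) \<partial>lebesgue)
    \<le> ennreal (L * s * measure lebesgue E + 1 * s / F s * ((C\<^sub>1 * F ((b - k) / ((1 - \<sigma>) * R')) + C\<^sub>2)
        * measure lebesgue (superlevel w k y R')))"
    by (rule gradient_bound[OF en C(1,2) Rpos(2) R(6) \<sigma>(1,2) ae _ k(2) E]) (use k H L s in auto)
  also have "\<dots> \<le> ennreal I"
  proof (rule ennreal_leI)
    have "L * s * measure lebesgue E \<le> L * s * (a ^ (i + 2) * X)"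
    proof (rule mult_left_mono)
      have "X \<le> a ^ (i + 2) * X"
        using one_le_power[OF a(1), of "i + 2"] X by (simp add: mult_le_cancel_right1)
      then show "measure lebesgue E \<le> a ^ (i + 2) * X" using EX by simp
    qed (use L s in auto)
    moreover have "1 * s / F s * ((C\<^sub>1 * F ((b - k) / ((1 - \<sigma>) * R')) + C\<^sub>2) * X)
        \<le> 1 * s / F s * ((C\<^sub>1 * (a ^ (i + 2) * F s) + a ^ (i + 2) * F s) * X)"
      using F1 F2 C s F_pos[OF s] X by (intro mult_left_mono mult_right_mono add_mono) auto
    moreover have "1 * s / F s * ((C\<^sub>1 * (a ^ (i + 2) * F s) + a ^ (i + 2) * F s) * X)
        = s * ((C\<^sub>1 + 1) * a ^ (i + 2)) * X"
      using F_pos[OF s] by (simp add: field_simps)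
    ultimately show "L * s * measure lebesgue E + 1 * s / F s * ((C\<^sub>1 * F ((b - k) / ((1 - \<sigma>) * R')) + C\<^sub>2)
        * measure lebesgue (superlevel w k y R')) \<le> I"
      unfolding I_def X_def[symmetric] by (simp add: algebra_simps)
  qed
  finally have I: "(\<integral>\<^sup>+ x\<in>{x \<in> ball y r. k < w x \<and> w x < l}. ennreal (norm (g x)) \<partial>lebesgue) \<le> ennreal I"
    unfolding E_def .
  have I0: "0 \<le> I" using s L C a X by (simp add: I_def)
  \<comment> \<open>Because R' is at most 2 * r, the larger ball has at most 2^n times the measure
    of the smaller one; a density of 2^-(n+1) in the former is at most one half in the
    latter.\<close>
  have half: "1 / 2 * measure lebesgue (ball y r) \<le> measure lebesgue {x \<in> ball y r. w x \<le> k}"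
  proof -
    have "measure lebesgue (superlevel w k y r) \<le> X"
      unfolding X_def by (rule measure_mono_fmeasurable)
        (use sub superlevel_lmeasurable[OF wg R(6)] superlevel_lmeasurable[OF wg, of y r] R in \<open>auto simp: superlevel_def\<close>)
    also have "X \<le> B' / 2 ^ Suc ?n"
      using small B by (simp add: X_def B'_def field_simps)
    also have "\<dots> \<le> (2 ^ ?n * B) / 2 ^ Suc ?n"
      using BB' by (intro divide_right_mono) auto
    finally have "measure lebesgue (superlevel w k y r) \<le> B / 2" by simp
    moreover have "ball y r \<subseteq> \<Omega>" using sub R by blast
    ultimately show ?thesis
      using measure_sublevel_superlevel[OF wg, of y r k] by (simp add: B_def)
  qed
  have "0 < H / 2 ^ (i + 2)" using H by simp
  then have kl: "k < l" using k by linarith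
  have "Y ^ ?n * ((l - k) * (1 / 2)) ^ Suc ?n \<le> (2 ^ (?n + 2) * r * I / B) ^ Suc ?n"
    using isoperimetric_power[OF wg sub(1) R(1) kl _ I I0 half] by (simp add: Y_def B_def superlevel_def)
  also have "(l - k) * (1 / 2) = H / 2 ^ (i + 3)" using k by (simp add: power_add)
  finally have "Y ^ ?n \<le> (2 ^ (?n + 2) * r * I / B) ^ Suc ?n / (H / 2 ^ (i + 3)) ^ Suc ?n"
    using H by (subst pos_le_divide_eq) auto
  also have "\<dots> = (2 ^ (?n + 2) * r * I / B / (H / 2 ^ (i + 3))) ^ Suc ?n"
    by (rule power_divide[symmetric])
  also have "\<dots> \<le> (2 ^ (i + 3) * 2 ^ (?n + 2) * (L + C\<^sub>1 + 1) * a ^ (i + 2) * 2 ^ ?n * (X / B')) ^ Suc ?n"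
  proof (rule power_mono)
    define D where "D = 2 ^ (i + 3) * 2 ^ (?n + 2) * (L + C\<^sub>1 + 1) * a ^ (i + 2)"
    have D: "0 \<le> D" using L C a by (simp add: D_def)
    have "2 ^ (?n + 2) * r * I / B / (H / 2 ^ (i + 3)) = D * (r / R) * (X / B)"
      using H Rpos B by (simp add: I_def s_def D_def)
    also have "\<dots> \<le> D * 1 * (2 ^ ?n * (X / B'))"
    proof (intro mult_mono mult_left_mono)
      show "r / R \<le> 1" using R Rpos by simp
      have "X / B \<le> X / (B' / 2 ^ ?n)"
        using X B BB' by (intro divide_left_mono) (auto simp: field_simps)
      then show "X / B \<le> 2 ^ ?n * (X / B')" by (simp add: mult.commute)
    qed (use D R Rpos X B in auto)
    finally show "2 ^ (?n + 2) * r * I / B / (H / 2 ^ (i + 3))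
        \<le> 2 ^ (i + 3) * 2 ^ (?n + 2) * (L + C\<^sub>1 + 1) * a ^ (i + 2) * 2 ^ ?n * (X / B')"
      by (simp add: D_def)
    show "0 \<le> 2 ^ (?n + 2) * r * I / B / (H / 2 ^ (i + 3))"
      using R I0 B H by simp
  qed
  finally show ?thesis by (simp add: Y_def B_def X_def B'_def)
qed

text \<open>Levels rise from b - H towards b - H / 2 while radii shrink from R towards R / 2, and
  the densities obey the recursion of \<open>fast_geometric_convergence\<close>, so the limit set is
  null. The threshold depends only on the gauge, \<open>C\<^sub>1\<close> and the dimension.\<close>

lemma density_lemma:
  assumes C\<^sub>1: "0 \<le> C\<^sub>1"
  obtains \<theta> where "0 < \<theta>"
    "\<And>(\<Omega>::'a::euclidean_space set) w g C\<^sub>2 d K y R b H.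
      energy_class \<Omega> F C\<^sub>1 C\<^sub>2 d w g \<Longrightarrow> 0 \<le> C\<^sub>2 \<Longrightarrow> C\<^sub>2 \<le> F K \<Longrightarrow> 0 \<le> K \<Longrightarrow>
      0 < R \<Longrightarrow> ball y R \<subseteq> \<Omega> \<Longrightarrow> 0 < H \<Longrightarrow> H \<le> d \<Longrightarrow> K * R \<le> H \<Longrightarrow>
      (AE x in lebesgue. x \<in> ball y R \<longrightarrow> w x \<le> b) \<Longrightarrow>
      measure lebesgue (superlevel w (b - H) y R) \<le> \<theta> * measure lebesgue (ball y R) \<Longrightarrow>
      (AE x in lebesgue. x \<in> ball y (R / 2) \<longrightarrow> w x \<le> b - H / 2)"
proof -
  let ?n = "DIM('a)"
  obtain L where L: "0 < L" "\<And>a s. 0 \<le> a \<Longrightarrow> 0 < s \<Longrightarrow> a \<le> L * s + 1 * s * F a / F s"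
    using quasi_Young[of 1] by auto
  define a where "a = max 1 (M\<^sub>0 * F 2)"
  have a: "1 \<le> a" "M\<^sub>0 * F 2 \<le> a" by (auto simp: a_def)
  \<comment> \<open>\<open>c * (2 * a) ^ i\<close> is the factor of \<open>density_step\<close> with
    the index separated: 2^i comes from the level gap, a^i from doubling.\<close>
  define c where "c = 2 ^ 3 * 2 ^ (?n + 2) * (L + C\<^sub>1 + 1) * a\<^sup>2 * 2 ^ ?n"
  have c: "0 < c" using L C\<^sub>1 a by (simp add: c_def)
  define q where "q = 1 / (2 * a) ^ Suc ?n"
  have q: "0 < q" "q < 1"
    using a one_less_power[of "2 * a" "Suc ?n"] by (auto simp: q_def divide_simps simp del: power_Suc)
  \<comment> \<open>The first entry is the smallness condition of \<open>density_step\<close>, the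
    second that of the fast convergence.\<close>
  define \<theta> where "\<theta> = min (1 / 2 ^ Suc ?n) (q ^ ?n / c ^ Suc ?n)"
  have \<theta>: "0 < \<theta>" using q c by (simp add: \<theta>_def)
  have "\<theta> * c ^ Suc ?n \<le> q ^ ?n / c ^ Suc ?n * c ^ Suc ?n"
    using c by (intro mult_right_mono) (auto simp: \<theta>_def)
  then have small: "\<theta> * c ^ Suc ?n \<le> q ^ ?n" using c by simp
  show ?thesis
  proof (rule that[OF \<theta>])
    fix \<Omega> :: "'a set" and w g C\<^sub>2 d K y R b H
    assume en: "energy_class \<Omega> F C\<^sub>1 C\<^sub>2 d w g" and C\<^sub>2: "0 \<le> C\<^sub>2" "C\<^sub>2 \<le> F K" "0 \<le> K"
      and R: "0 < R" "ball y R \<subseteq> \<Omega>" and H: "0 < H" "H \<le> d" "K * R \<le> H"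
      and ae: "AE x in lebesgue. x \<in> ball y R \<longrightarrow> w x \<le> b"
      and init: "measure lebesgue (superlevel w (b - H) y R) \<le> \<theta> * measure lebesgue (ball y R)"
    have wg: "has_weak_gradient \<Omega> w g" using en by (simp add: energy_class_def)
    define k where "k i = b - H / 2 - H / 2 ^ Suc i" for i :: nat
    define \<rho> where "\<rho> i = R / 2 + R / 2 ^ Suc i" for i :: nat
    define Y where "Y i = measure lebesgue (superlevel w (k i) y (\<rho> i)) / measure lebesgue (ball y (\<rho> i))" for i
    have pw: "0 < 1 / (2::real) ^ Suc i" "1 / (2::real) ^ Suc i \<le> 1 / 2" for i
      using one_le_power[of "2::real" i] by (auto simp: divide_simps)
    have Hi: "0 < H / 2 ^ Suc i" "H / 2 ^ Suc i \<le> H / 2" "0 < R / 2 ^ Suc i" "R / 2 ^ Suc i \<le> R / 2" for i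
      using mult_left_mono[OF pw(2), of H i] mult_left_mono[OF pw(2), of R i] H R by auto
    have \<rho>: "R / 2 < \<rho> i" "\<rho> i \<le> R" "\<rho> i - \<rho> (Suc i) = R / 2 ^ (i + 2)" for i
      using Hi[of i] by (auto simp: \<rho>_def field_simps)
    have k: "b - H \<le> k i" "k i < b - H / 2" "k (Suc i) - k i = H / 2 ^ (i + 2)" for i
      using Hi[of i] by (auto simp: k_def field_simps)
    have sub: "ball y (\<rho> i) \<subseteq> ball y R" for i using \<rho>[of i] by (intro subset_ball)
    have Ynn: "0 \<le> Y i" for i by (simp add: Y_def)
    have Y0: "Y 0 \<le> \<theta>"
    proof -
      have "k 0 = b - H" "\<rho> 0 = R" by (auto simp: k_def \<rho>_def)
      moreover have "0 < measure lebesgue (ball y R)" using R by (simp add: content_ball_pos)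
      ultimately show ?thesis using init by (simp add: Y_def divide_simps)
    qed
    have step: "Y (Suc i) ^ ?n \<le> (c * (2 * a) ^ i * Y i) ^ Suc ?n" if "Y i \<le> \<theta>" for i
    proof -
      have "Y (Suc i) ^ ?n \<le> (2 ^ (i + 3) * 2 ^ (?n + 2) * (L + C\<^sub>1 + 1) * a ^ (i + 2) * 2 ^ ?n * Y i) ^ Suc ?n"
        unfolding Y_def
      proof (rule density_step[OF en C\<^sub>1 C\<^sub>2 _ _ _ \<rho>(2) \<rho>(3) _ H _ k(1) _ k(3) L a])
        show "0 < \<rho> (Suc i)" using \<rho>(1)[of "Suc i"] R by simp
        have "0 < R / 2 ^ (i + 2)" using R by simp
        then show "\<rho> (Suc i) < \<rho> i" using \<rho>(3)[of i] by linarith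
        show "\<rho> i \<le> 2 * \<rho> (Suc i)" using \<rho>(2)[of i] \<rho>(1)[of "Suc i"] by simp
        show "ball y (\<rho> i) \<subseteq> \<Omega>" using sub R by blast
        show "AE x in lebesgue. x \<in> ball y (\<rho> i) \<longrightarrow> w x \<le> b"
          using ae by eventually_elim (use sub in blast)
        show "k i < b" using k(2)[of i] H by simp
        have "Y i \<le> 1 / 2 ^ Suc ?n" using that by (simp add: \<theta>_def)
        then show "measure lebesgue (superlevel w (k i) y (\<rho> i)) / measure lebesgue (ball y (\<rho> i)) \<le> 1 / 2 ^ Suc ?n"
          by (simp add: Y_def)
      qed
      also have "2 ^ (i + 3) * 2 ^ (?n + 2) * (L + C\<^sub>1 + 1) * a ^ (i + 2) * 2 ^ ?n * Y i = c * (2 * a) ^ i * Y i"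
        unfolding power_add[of _ i] power_mult_distrib c_def by (simp only: mult_ac)
      finally show ?thesis .
    qed
    have Y: "Y i \<le> \<theta> * q ^ i" for i
      unfolding q_def
      by (rule fast_geometric_convergence[OF Ynn Y0 _ c \<theta> _ step])
        (use a small in \<open>auto simp: q_def\<close>)
    define X where "X = measure lebesgue (superlevel w (b - H / 2) y (R / 2))"
    have subh: "ball y (R / 2) \<subseteq> \<Omega>" using subset_ball[of "R / 2" R y] R by auto
    have "X \<le> \<theta> * q ^ i * measure lebesgue (ball y R)" for i
    proof -
      have "X \<le> measure lebesgue (superlevel w (k i) y (\<rho> i))"
        unfolding X_def
      proof (rule measure_mono_fmeasurable)
        have "ball y (R / 2) \<subseteq> ball y (\<rho> i)" using \<rho>(1)[of i] by (intro subset_ball) simp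
        then show "superlevel w (b - H / 2) y (R / 2) \<subseteq> superlevel w (k i) y (\<rho> i)"
          using k(2)[of i] unfolding superlevel_def by (blast intro: less_trans)
        show "superlevel w (k i) y (\<rho> i) \<in> lmeasurable"
          by (rule superlevel_lmeasurable[OF wg]) (use sub R in blast)
      qed (use superlevel_lmeasurable[OF wg subh] in auto)
      also have "\<dots> = Y i * measure lebesgue (ball y (\<rho> i))"
        using \<rho>(1)[of i] R content_ball_pos[of "\<rho> i" y] by (simp add: Y_def)
      also have "\<dots> \<le> \<theta> * q ^ i * measure lebesgue (ball y R)"
        using Y[of i] Ynn[of i] by (intro mult_mono measure_mono_fmeasurable sub) auto
      finally show ?thesis .
    qed
    moreover have "(\<lambda>i. \<theta> * q ^ i * measure lebesgue (ball y R)) \<longlonglongrightarrow> \<theta> * 0 * measure lebesgue (ball y R)"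
      by (intro tendsto_intros LIMSEQ_realpow_zero) (use q in auto)
    ultimately have "X \<le> \<theta> * 0 * measure lebesgue (ball y R)"
      by (intro LIMSEQ_le_const) auto
    then have "X = 0" by (simp add: X_def antisym)
    then have "superlevel w (b - H / 2) y (R / 2) \<in> null_sets lebesgue"
      using superlevel_lmeasurable[OF wg subh, of "b - H / 2"]
      by (intro null_setsI) (auto simp: X_def emeasure_eq_measure2)
    then have "AE x in lebesgue. x \<notin> superlevel w (b - H / 2) y (R / 2)" by (rule AE_not_in)
    then show "AE x in lebesgue. x \<in> ball y (R / 2) \<longrightarrow> w x \<le> b - H / 2"
      by eventually_elim (auto simp: superlevel_def)
  qed
qed

end


section \<open>Shrinking of superlevel sets that miss half of a ball, and the one-sided
  improvement\<close>

context gauge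
begin

text \<open>The density need not be small here, so the gain in the exponent is given up. The band
  between the two levels lies in what the superlevel set loses, so the first term of
  \<open>gradient_bound\<close> becomes a difference of consecutive densities, which telescopes; the
  second is made small by the free \<epsilon>.\<close>

lemma shrinking_step:
  fixes w :: "'a::euclidean_space \<Rightarrow> real"
  assumes en: "energy_class \<Omega> F C\<^sub>1 C\<^sub>2 d w g" and C: "0 \<le> C\<^sub>1" "0 \<le> C\<^sub>2" "C\<^sub>2 \<le> F K" "0 \<le> K"
    and r: "0 < r" "ball y (2 * r) \<subseteq> \<Omega>"
    and h: "0 < h" "h \<le> d" "K * r \<le> h"
    and ae: "AE x in lebesgue. x \<in> ball y (2 * r) \<longrightarrow> w x \<le> b"
    and half: "1 / 2 * measure lebesgue (ball y r) \<le> measure lebesgue {x \<in> ball y r. w x \<le> b - h}"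
    and \<epsilon>: "0 < \<epsilon>" and L: "0 < L" "\<And>a s. 0 \<le> a \<Longrightarrow> 0 < s \<Longrightarrow> a \<le> L * s + \<epsilon> * s * F a / F s"
  defines "Y \<equiv> \<lambda>m. measure lebesgue (superlevel w m y r) / measure lebesgue (ball y r)"
  shows "Y (b - h / 2) \<le> 2 ^ (DIM('a) + 4) * (L * (Y (b - h) - Y (b - h / 2)) + \<epsilon> * (C\<^sub>1 + 1) * 2 ^ DIM('a))"
proof -
  let ?n = "DIM('a)"
  let ?k = "b - h" and ?l = "b - h / 2"
  define B where "B = measure lebesgue (ball y r)"
  define s where "s = h / r"
  define E where "E = {x \<in> ball y r. ?k < w x \<and> w x < ?l}"
  have wg: "has_weak_gradient \<Omega> w g" using en by (simp add: energy_class_def)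
  have s: "0 < s" "r * s = h" using h r by (auto simp: s_def)
  have B: "0 < B" using r by (simp add: B_def content_ball_pos)
  have sub: "cball y r \<subseteq> \<Omega>" "ball y r \<subseteq> \<Omega>" using r by (auto simp: subset_iff)
  have lm: "superlevel w m y r \<in> lmeasurable" for m by (rule superlevel_lmeasurable[OF wg sub(2)])
  have E: "E \<in> sets lebesgue" "E \<subseteq> superlevel w ?k y (1 / 2 * (2 * r))"
    using weak_gradient_sublevel_sets[OF wg sub(2), of "{?k<..<?l}"]
    by (auto simp: E_def superlevel_def)
  have YB: "measure lebesgue (superlevel w m y r) = Y m * B" for m
    using B by (simp add: Y_def B_def)
  have Y1: "0 \<le> Y m" "Y m \<le> 1" for m
  proof -
    have "measure lebesgue (superlevel w m y r) \<le> B"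
      unfolding B_def using fmeasurableD[OF lm[of m]] by (intro measure_mono_fmeasurable) (auto simp: superlevel_def)
    then show "0 \<le> Y m" "Y m \<le> 1" using B by (auto simp: Y_def B_def)
  qed
  have ED: "measure lebesgue E \<le> (Y ?k - Y ?l) * B"
  proof -
    have "E \<subseteq> superlevel w ?k y r - superlevel w ?l y r"
      by (auto simp: E_def superlevel_def)
    then have "measure lebesgue E \<le> measure lebesgue (superlevel w ?k y r - superlevel w ?l y r)"
      using lm E(1) by (intro measure_mono_fmeasurable) auto
    also have "\<dots> = measure lebesgue (superlevel w ?k y r) - measure lebesgue (superlevel w ?l y r)"
      using h by (intro measurable_measure_Diff lm fmeasurableD) (auto simp: superlevel_def)
    finally show ?thesis by (simp add: YB left_diff_distrib)
  qed
  have X2: "measure lebesgue (superlevel w ?k y (2 * r)) \<le> 2 ^ ?n * B"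
  proof -
    have "measure lebesgue (superlevel w ?k y (2 * r)) \<le> measure lebesgue (ball y (2 * r))"
      using fmeasurableD[OF superlevel_lmeasurable[OF wg r(2), of ?k]]
      by (intro measure_mono_fmeasurable) (auto simp: superlevel_def)
    then show ?thesis using content_ball_ratio[of 2 r y y] r by (simp add: B_def)
  qed
  have "K \<le> s" using h r by (simp add: s_def field_simps)
  then have F2: "C\<^sub>2 \<le> F s" using C F_mono[of K s] by simp
  define I where "I = s * (L * (Y ?k - Y ?l) + \<epsilon> * (C\<^sub>1 + 1) * 2 ^ ?n) * B"
  have mono: "Y ?l \<le> Y ?k"
    unfolding Y_def using B lm h
    by (intro divide_right_mono measure_mono_fmeasurable) (auto simp: superlevel_def B_def)
  have I0: "0 \<le> I" using s L \<epsilon> C B mono by (simp add: I_def)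
  have "(\<integral>\<^sup>+ x\<in>E. ennreal (norm (g x)) \<partial>lebesgue)
    \<le> ennreal (L * s * measure lebesgue E + \<epsilon> * s / F s * ((C\<^sub>1 * F ((b - ?k) / ((1 - 1 / 2) * (2 * r))) + C\<^sub>2)
        * measure lebesgue (superlevel w ?k y (2 * r))))"
    by (rule gradient_bound[OF en C(1,2) _ r(2) _ _ ae _ _ E \<epsilon> L(1) s(1)]) (use h r L s in auto)
  also have "\<dots> \<le> ennreal I"
  proof (rule ennreal_leI)
    have arg: "(b - ?k) / ((1 - 1 / 2) * (2 * r)) = s" by (simp add: s_def)
    have "L * s * measure lebesgue E \<le> L * s * ((Y ?k - Y ?l) * B)"
      using ED L s by (intro mult_left_mono) auto
    moreover have "\<epsilon> * s / F s * ((C\<^sub>1 * F s + C\<^sub>2) * measure lebesgue (superlevel w ?k y (2 * r)))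
        \<le> \<epsilon> * s / F s * ((C\<^sub>1 * F s + F s) * (2 ^ ?n * B))"
      using F2 X2 C \<epsilon> s F_pos[OF s(1)] B by (intro mult_left_mono mult_mono add_mono) auto
    moreover have "\<epsilon> * s / F s * ((C\<^sub>1 * F s + F s) * (2 ^ ?n * B)) = s * (\<epsilon> * (C\<^sub>1 + 1) * 2 ^ ?n) * B"
      using F_pos[OF s(1)] by (simp add: field_simps)
    ultimately show "L * s * measure lebesgue E + \<epsilon> * s / F s * ((C\<^sub>1 * F ((b - ?k) / ((1 - 1 / 2) * (2 * r))) + C\<^sub>2)
        * measure lebesgue (superlevel w ?k y (2 * r))) \<le> I"
      unfolding I_def arg by (simp add: algebra_simps)
  qed
  finally have I: "(\<integral>\<^sup>+ x\<in>{x \<in> ball y r. ?k < w x \<and> w x < ?l}. ennreal (norm (g x)) \<partial>lebesgue) \<le> ennreal I"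
    unfolding E_def .
  have kl: "?k < ?l" using h by simp
  have "Y ?l ^ ?n * ((?l - ?k) * (1 / 2)) ^ Suc ?n \<le> (2 ^ (?n + 2) * r * I / B) ^ Suc ?n"
    using isoperimetric_power[OF wg sub(1) r(1) kl _ I I0 half] by (simp add: Y_def B_def superlevel_def)
  \<comment> \<open>As \<open>Y\<close> is at most 1, one more power of it only lowers the left
    side; then both sides are (n+1)-st powers and the root can be taken.\<close>
  moreover have "Y ?l ^ Suc ?n * (h / 4) ^ Suc ?n \<le> Y ?l ^ ?n * (h / 4) ^ Suc ?n"
    using Y1[of ?l] h by (intro mult_right_mono power_decreasing) auto
  moreover have "(?l - ?k) * (1 / 2) = h / 4" by simp
  ultimately have "(Y ?l * (h / 4)) ^ Suc ?n \<le> (2 ^ (?n + 2) * r * I / B) ^ Suc ?n"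
    unfolding power_mult_distrib[of "Y ?l"] by simp
  then have "Y ?l * (h / 4) \<le> 2 ^ (?n + 2) * r * I / B"
    by (rule power_le_imp_le_base) (use r I0 B in simp)
  also have "2 ^ (?n + 2) * r * I / B = 2 ^ (?n + 2) * (r * s) * (L * (Y ?k - Y ?l) + \<epsilon> * (C\<^sub>1 + 1) * 2 ^ ?n)"
    using B by (simp add: I_def)
  also have "\<dots> = (2 ^ (?n + 4) * (L * (Y ?k - Y ?l) + \<epsilon> * (C\<^sub>1 + 1) * 2 ^ ?n)) * (h / 4)"
    unfolding s(2) by (simp add: power_add)
  finally show ?thesis using h by (simp only: mult_le_cancel_right)
qed

text \<open>If the density still exceeded \<theta> after \<open>J\<close> halvings of the distance
  to \<open>b\<close>, each halving would have cost at least \<theta> / (2 P) of density, and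
  \<open>J\<close> such losses exceed the total of 1.\<close>

lemma shrinking_lemma:
  assumes C\<^sub>1: "0 \<le> C\<^sub>1" and \<theta>: "0 < \<theta>"
  obtains J :: nat where
    "\<And>(\<Omega>::'a::euclidean_space set) w g C\<^sub>2 d K y r b H.
      energy_class \<Omega> F C\<^sub>1 C\<^sub>2 d w g \<Longrightarrow> 0 \<le> C\<^sub>2 \<Longrightarrow> C\<^sub>2 \<le> F K \<Longrightarrow> 0 \<le> K \<Longrightarrow>
      0 < r \<Longrightarrow> ball y (2 * r) \<subseteq> \<Omega> \<Longrightarrow> 0 < H \<Longrightarrow> H \<le> d \<Longrightarrow> K * r \<le> H / 2 ^ J \<Longrightarrow>
      (AE x in lebesgue. x \<in> ball y (2 * r) \<longrightarrow> w x \<le> b) \<Longrightarrow>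
      1 / 2 * measure lebesgue (ball y r) \<le> measure lebesgue {x \<in> ball y r. w x \<le> b - H} \<Longrightarrow>
      measure lebesgue (superlevel w (b - H / 2 ^ J) y r) \<le> \<theta> * measure lebesgue (ball y r)"
proof -
  let ?n = "DIM('a)"
  \<comment> \<open>Makes the contribution of the \<epsilon> term in \<open>shrinking_step\<close>
    exactly \<theta> / 2.\<close>
  define \<epsilon> where "\<epsilon> = \<theta> / (2 * (2 ^ (?n + 4) * ((C\<^sub>1 + 1) * 2 ^ ?n)))"
  have \<epsilon>: "0 < \<epsilon>" using \<theta> C\<^sub>1 by (simp add: \<epsilon>_def)
  have \<epsilon>\<theta>: "2 ^ (?n + 4) * (\<epsilon> * (C\<^sub>1 + 1) * 2 ^ ?n) = \<theta> / 2"
  proof -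
    define c where "c = 2 ^ (?n + 4) * ((C\<^sub>1 + 1) * 2 ^ ?n)"
    have "0 < c" using C\<^sub>1 by (simp add: c_def)
    have "2 ^ (?n + 4) * (\<epsilon> * (C\<^sub>1 + 1) * 2 ^ ?n) = \<epsilon> * c"
      unfolding c_def by (simp only: mult_ac)
    also have "\<dots> = \<theta> / 2"
      using \<open>0 < c\<close> unfolding \<epsilon>_def c_def[symmetric] by simp
    finally show ?thesis .
  qed
  obtain L where L: "0 < L" "\<And>a s. 0 \<le> a \<Longrightarrow> 0 < s \<Longrightarrow> a \<le> L * s + \<epsilon> * s * F a / F s"
    using quasi_Young[OF \<epsilon>] by blast
  define P where "P = 2 ^ (?n + 4) * L"
  have P: "0 < P" using L by (simp add: P_def)
  obtain J :: nat where J: "2 * P / \<theta> < real J" using reals_Archimedean2 by blast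
  show ?thesis
  proof (rule that[of J])
    fix \<Omega> :: "'a set" and w g C\<^sub>2 d K y r b H
    assume en: "energy_class \<Omega> F C\<^sub>1 C\<^sub>2 d w g" and C\<^sub>2: "0 \<le> C\<^sub>2" "C\<^sub>2 \<le> F K" "0 \<le> K"
      and r: "0 < r" "ball y (2 * r) \<subseteq> \<Omega>" and H: "0 < H" "H \<le> d" "K * r \<le> H / 2 ^ J"
      and ae: "AE x in lebesgue. x \<in> ball y (2 * r) \<longrightarrow> w x \<le> b"
      and half: "1 / 2 * measure lebesgue (ball y r) \<le> measure lebesgue {x \<in> ball y r. w x \<le> b - H}"
    have wg: "has_weak_gradient \<Omega> w g" using en by (simp add: energy_class_def)
    have sub: "ball y r \<subseteq> \<Omega>" using r by (auto simp: subset_iff)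
    have lm: "superlevel w m y r \<in> lmeasurable" for m by (rule superlevel_lmeasurable[OF wg sub])
    define B where "B = measure lebesgue (ball y r)"
    have B: "0 < B" using r by (simp add: B_def content_ball_pos)
    define Y where "Y j = measure lebesgue (superlevel w (b - H / 2 ^ j) y r) / B" for j :: nat
    have pw: "H / 2 ^ j \<le> H / 2 ^ i" if "i \<le> j" for i j :: nat
      using that H by (intro divide_left_mono power_increasing) auto
    have anti: "Y j \<le> Y i" if "i \<le> j" for i j
      unfolding Y_def using B lm fmeasurableD[OF lm] pw[OF that]
      by (intro divide_right_mono measure_mono_fmeasurable) (auto simp: superlevel_def)
    have Y0: "Y 0 \<le> 1" "0 \<le> Y j" for j
    proof -
      have "measure lebesgue (superlevel w (b - H / 2 ^ 0) y r) \<le> B"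
        unfolding B_def using fmeasurableD[OF lm]
        by (intro measure_mono_fmeasurable) (auto simp: superlevel_def)
      then show "Y 0 \<le> 1" "0 \<le> Y j" using B by (auto simp: Y_def)
    qed
    have step: "Y (Suc j) \<le> P * (Y j - Y (Suc j)) + \<theta> / 2" if "j < J" for j
    proof -
      have "Y (Suc j) \<le> 2 ^ (?n + 4) * (L * (Y j - Y (Suc j)) + \<epsilon> * (C\<^sub>1 + 1) * 2 ^ ?n)"
      proof -
        have hd: "H / 2 ^ j \<le> d" using pw[of 0 j] H by simp
        have Kr: "K * r \<le> H / 2 ^ j" using pw[of j J] H that by simp
        have hf: "1 / 2 * measure lebesgue (ball y r) \<le> measure lebesgue {x \<in> ball y r. w x \<le> b - H / 2 ^ j}"
        proof -
          have "measure lebesgue (superlevel w (b - H / 2 ^ j) y r) \<le> measure lebesgue (superlevel w (b - H) y r)"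
            using lm fmeasurableD[OF lm] pw[of 0 j]
            by (intro measure_mono_fmeasurable) (auto simp: superlevel_def)
          then show ?thesis using half measure_sublevel_superlevel[OF wg sub] by simp
        qed
        have "0 < H / 2 ^ j" using H by simp
        note st = shrinking_step[OF en C\<^sub>1 C\<^sub>2 r this hd Kr ae hf \<epsilon> L]
        have "H / 2 ^ j / 2 = H / 2 ^ Suc j" by simp
        from st[unfolded this] show ?thesis unfolding Y_def B_def .
      qed
      then show ?thesis using \<epsilon>\<theta> by (simp only: P_def distrib_left mult.assoc)
    qed
    have "Y J \<le> \<theta>"
    proof (rule ccontr)
      assume "\<not> Y J \<le> \<theta>"
      then have drop: "\<theta> / 2 \<le> P * (Y j - Y (Suc j))" if "j < J" for j
        using step[OF that] anti[of "Suc j" J] that by simp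
      have "real m * (\<theta> / 2) \<le> P * (Y 0 - Y m)" if "m \<le> J" for m
        using that
      proof (induction m)
        case (Suc m)
        then show ?case using drop[of m] by (simp add: algebra_simps add_divide_distrib)
      qed simp
      from this[of J] have "real J * (\<theta> / 2) \<le> P * (Y 0 - Y J)" by simp
      also have "\<dots> \<le> P * 1" using Y0(1) Y0(2)[of J] P by (intro mult_left_mono) auto
      finally have "real J \<le> 2 * P / \<theta>" using \<theta> by (simp add: field_simps)
      then show False using J by simp
    qed
    then show "measure lebesgue (superlevel w (b - H / 2 ^ J) y r) \<le> \<theta> * measure lebesgue (ball y r)"
      using B by (simp add: Y_def B_def[symmetric] field_simps)
  qed
qed

text \<open>On the ball of radius 2 * s, shrinking brings the density at level
  \<open>b - H / 2 ^ J\<close> below the threshold of the density lemma, which then halves both the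
  remaining gap and the radius.\<close>

lemma one_sided_improvement:
  assumes C\<^sub>1: "0 \<le> C\<^sub>1" and \<delta>: "0 < \<delta>" "\<delta> \<le> 2"
  obtains J :: nat where
    "\<And>(\<Omega>::'a::euclidean_space set) w g C\<^sub>2 M K y s b d.
      energy_class \<Omega> F C\<^sub>1 C\<^sub>2 (\<delta> * M) w g \<Longrightarrow> 0 \<le> C\<^sub>2 \<Longrightarrow> C\<^sub>2 \<le> F K \<Longrightarrow> 0 \<le> K \<Longrightarrow>
      0 < s \<Longrightarrow> ball y (4 * s) \<subseteq> \<Omega> \<Longrightarrow> 0 < d \<Longrightarrow> d \<le> 2 * M \<Longrightarrow> 2 * K * s \<le> \<delta> / 4 * d / 2 ^ J \<Longrightarrow>
      (AE x in lebesgue. x \<in> ball y (4 * s) \<longrightarrow> w x \<le> b) \<Longrightarrow>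
      1 / 2 * measure lebesgue (ball y (2 * s)) \<le> measure lebesgue {x \<in> ball y (2 * s). w x \<le> b - d / 2} \<Longrightarrow>
      (AE x in lebesgue. x \<in> ball y s \<longrightarrow> w x \<le> b - \<delta> / 4 * d / 2 ^ Suc J)"
proof -
  obtain \<theta> where \<theta>: "0 < \<theta>"
    "\<And>(\<Omega>::'a set) w g C\<^sub>2 d K y R b H.
      energy_class \<Omega> F C\<^sub>1 C\<^sub>2 d w g \<Longrightarrow> 0 \<le> C\<^sub>2 \<Longrightarrow> C\<^sub>2 \<le> F K \<Longrightarrow> 0 \<le> K \<Longrightarrow>
      0 < R \<Longrightarrow> ball y R \<subseteq> \<Omega> \<Longrightarrow> 0 < H \<Longrightarrow> H \<le> d \<Longrightarrow> K * R \<le> H \<Longrightarrow>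
      (AE x in lebesgue. x \<in> ball y R \<longrightarrow> w x \<le> b) \<Longrightarrow>
      measure lebesgue (superlevel w (b - H) y R) \<le> \<theta> * measure lebesgue (ball y R) \<Longrightarrow>
      (AE x in lebesgue. x \<in> ball y (R / 2) \<longrightarrow> w x \<le> b - H / 2)"
    by (rule density_lemma[OF C\<^sub>1]) blast
  obtain J where J:
    "\<And>(\<Omega>::'a set) w g C\<^sub>2 d K y r b H.
      energy_class \<Omega> F C\<^sub>1 C\<^sub>2 d w g \<Longrightarrow> 0 \<le> C\<^sub>2 \<Longrightarrow> C\<^sub>2 \<le> F K \<Longrightarrow> 0 \<le> K \<Longrightarrow>
      0 < r \<Longrightarrow> ball y (2 * r) \<subseteq> \<Omega> \<Longrightarrow> 0 < H \<Longrightarrow> H \<le> d \<Longrightarrow> K * r \<le> H / 2 ^ J \<Longrightarrow>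
      (AE x in lebesgue. x \<in> ball y (2 * r) \<longrightarrow> w x \<le> b) \<Longrightarrow>
      1 / 2 * measure lebesgue (ball y r) \<le> measure lebesgue {x \<in> ball y r. w x \<le> b - H} \<Longrightarrow>
      measure lebesgue (superlevel w (b - H / 2 ^ J) y r) \<le> \<theta> * measure lebesgue (ball y r)"
    by (rule shrinking_lemma[OF C\<^sub>1 \<theta>(1)]) blast
  show ?thesis
  proof (rule that[of J])
    fix \<Omega> :: "'a set" and w g C\<^sub>2 M K y s b d
    assume en: "energy_class \<Omega> F C\<^sub>1 C\<^sub>2 (\<delta> * M) w g" and C\<^sub>2: "0 \<le> C\<^sub>2" "C\<^sub>2 \<le> F K" "0 \<le> K"
      and s: "0 < s" "ball y (4 * s) \<subseteq> \<Omega>" and d: "0 < d" "d \<le> 2 * M"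
      and Ks: "2 * K * s \<le> \<delta> / 4 * d / 2 ^ J"
      and ae: "AE x in lebesgue. x \<in> ball y (4 * s) \<longrightarrow> w x \<le> b"
      and half: "1 / 2 * measure lebesgue (ball y (2 * s)) \<le> measure lebesgue {x \<in> ball y (2 * s). w x \<le> b - d / 2}"
    have wg: "has_weak_gradient \<Omega> w g" using en by (simp add: energy_class_def)
    \<comment> \<open>The factor \<delta> / 4 does two things: with d \<le> 2 * M it keeps b - H
      within the levels that the class allows, and with \<delta> \<le> 2 it keeps b - H from falling
      below the middle level b - d / 2.\<close>
    define H where "H = \<delta> / 4 * d"
    have H: "0 < H" "H \<le> \<delta> * M" "H \<le> d / 2"
    proof -
      show "0 < H" using \<delta> d by (simp add: H_def)
      have "H \<le> \<delta> / 4 * (2 * M)" unfolding H_def using \<delta> d by (intro mult_left_mono) auto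
      also have "\<dots> \<le> \<delta> * M" using \<delta> d by simp
      finally show "H \<le> \<delta> * M" .
      have "H \<le> 2 / 4 * d" unfolding H_def using \<delta> d by (intro mult_right_mono) auto
      then show "H \<le> d / 2" by simp
    qed
    have sub2: "ball y (2 * s) \<subseteq> ball y (4 * s)" using s by (intro subset_ball) auto
    then have sub: "ball y (2 * s) \<subseteq> \<Omega>" using s by blast
    have half': "1 / 2 * measure lebesgue (ball y (2 * s)) \<le> measure lebesgue {x \<in> ball y (2 * s). w x \<le> b - H}"
    proof -
      have "measure lebesgue (superlevel w (b - H) y (2 * s)) \<le> measure lebesgue (superlevel w (b - d / 2) y (2 * s))"
        using superlevel_lmeasurable[OF wg sub] fmeasurableD[OF superlevel_lmeasurable[OF wg sub]] H
        by (intro measure_mono_fmeasurable) (auto simp: superlevel_def)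
      then show ?thesis using half measure_sublevel_superlevel[OF wg sub] by simp
    qed
    have shrink: "measure lebesgue (superlevel w (b - H / 2 ^ J) y (2 * s)) \<le> \<theta> * measure lebesgue (ball y (2 * s))"
      by (rule J[OF en C\<^sub>2 _ _ H(1,2) _ _ half']) (use s ae Ks in \<open>auto simp: H_def\<close>)
    have "1 \<le> (2::real) ^ J" by simp
    then have "H / 2 ^ J \<le> H / 1" using H(1) by (intro divide_left_mono) auto
    then have HJ: "0 < H / 2 ^ J" "H / 2 ^ J \<le> \<delta> * M" using H by auto
    have "AE x in lebesgue. x \<in> ball y (2 * s) \<longrightarrow> w x \<le> b"
      using ae by eventually_elim (use sub2 in blast)
    from \<theta>(2)[OF en C\<^sub>2 _ sub HJ _ this shrink]
    have "AE x in lebesgue. x \<in> ball y (2 * s / 2) \<longrightarrow> w x \<le> b - H / 2 ^ J / 2"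
      using s Ks by (simp add: H_def)
    then show "AE x in lebesgue. x \<in> ball y s \<longrightarrow> w x \<le> b - \<delta> / 4 * d / 2 ^ Suc J"
      by (simp add: H_def)
  qed
qed

end


section \<open>Oscillation decay and Hoelder continuity\<close>

context gauge
begin

text \<open>Either \<open>u\<close> or its negative is at or below its middle level on at least half
  of the ball of radius 2 * s, so the upper or the lower bound improves. If \<open>d\<close> is too
  small for the one-sided lemma to apply, it is already at most a multiple of \<open>K * s\<close>,
  which is the second entry of the maximum.\<close>

lemma oscillation_step:
  assumes C\<^sub>1: "0 \<le> C\<^sub>1" and \<delta>: "0 < \<delta>" "\<delta> \<le> 2"
  obtains \<kappa> Q :: real where "3 / 4 \<le> \<kappa>" "\<kappa> < 1" "0 \<le> Q"
    "\<And>(\<Omega>::'a::euclidean_space set) u g g' C\<^sub>2 M K y s a d.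
      energy_class \<Omega> F C\<^sub>1 C\<^sub>2 (\<delta> * M) u g \<Longrightarrow> energy_class \<Omega> F C\<^sub>1 C\<^sub>2 (\<delta> * M) (\<lambda>x. - u x) g' \<Longrightarrow>
      0 \<le> C\<^sub>2 \<Longrightarrow> C\<^sub>2 \<le> F K \<Longrightarrow> 0 \<le> K \<Longrightarrow>
      0 < s \<Longrightarrow> ball y (4 * s) \<subseteq> \<Omega> \<Longrightarrow> 0 < d \<Longrightarrow> d \<le> 2 * M \<Longrightarrow>
      (AE x in lebesgue. x \<in> ball y (4 * s) \<longrightarrow> a \<le> u x \<and> u x \<le> a + d) \<Longrightarrow>
      \<exists>a'. AE x in lebesgue. x \<in> ball y s \<longrightarrow> a' \<le> u x \<and> u x \<le> a' + max (\<kappa> * d) (Q * K * s)"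
proof -
  obtain J :: nat where J:
    "\<And>(\<Omega>::'a set) w g C\<^sub>2 M K y s b d.
      energy_class \<Omega> F C\<^sub>1 C\<^sub>2 (\<delta> * M) w g \<Longrightarrow> 0 \<le> C\<^sub>2 \<Longrightarrow> C\<^sub>2 \<le> F K \<Longrightarrow> 0 \<le> K \<Longrightarrow>
      0 < s \<Longrightarrow> ball y (4 * s) \<subseteq> \<Omega> \<Longrightarrow> 0 < d \<Longrightarrow> d \<le> 2 * M \<Longrightarrow> 2 * K * s \<le> \<delta> / 4 * d / 2 ^ J \<Longrightarrow>
      (AE x in lebesgue. x \<in> ball y (4 * s) \<longrightarrow> w x \<le> b) \<Longrightarrow>
      1 / 2 * measure lebesgue (ball y (2 * s)) \<le> measure lebesgue {x \<in> ball y (2 * s). w x \<le> b - d / 2} \<Longrightarrow>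
      (AE x in lebesgue. x \<in> ball y s \<longrightarrow> w x \<le> b - \<delta> / 4 * d / 2 ^ Suc J)"
    by (rule one_sided_improvement[OF C\<^sub>1 \<delta>]) blast
  \<comment> \<open>With \<delta> \<le> 2 the loss is at most 1 / 4. The resulting
    \<open>3 / 4 \<le> \<kappa>\<close> later puts the exponent below 1 and lets the radii decay
    faster than the oscillation.\<close>
  define \<kappa> where "\<kappa> = 1 - \<delta> / 4 / 2 ^ Suc J"
  \<comment> \<open>The failure of the smallness condition below, solved for
    \<open>d\<close>.\<close>
  define Q where "Q = 2 * (2 ^ J * 4 / \<delta>)"
  have "(1::real) \<le> 2 ^ J" by simp
  then have "\<delta> / 4 / 2 ^ Suc J \<le> \<delta> / 4 / 2" using \<delta> by (intro divide_left_mono) auto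
  then have "\<delta> / 4 / 2 ^ Suc J \<le> 1 / 4" using \<delta> by linarith
  moreover have "0 < \<delta> / 4 / 2 ^ Suc J" using \<delta> by simp
  ultimately have \<kappa>: "3 / 4 \<le> \<kappa>" "\<kappa> < 1" unfolding \<kappa>_def by linarith+
  have Q: "0 \<le> Q" using \<delta> by (simp add: Q_def)
  show ?thesis
  proof (rule that[OF \<kappa> Q])
    fix \<Omega> :: "'a set" and u g g' C\<^sub>2 M K y s a d
    assume en: "energy_class \<Omega> F C\<^sub>1 C\<^sub>2 (\<delta> * M) u g" "energy_class \<Omega> F C\<^sub>1 C\<^sub>2 (\<delta> * M) (\<lambda>x. - u x) g'"
      and C\<^sub>2: "0 \<le> C\<^sub>2" "C\<^sub>2 \<le> F K" "0 \<le> K"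
      and s: "0 < s" "ball y (4 * s) \<subseteq> \<Omega>" and d: "0 < d" "d \<le> 2 * M"
      and ae: "AE x in lebesgue. x \<in> ball y (4 * s) \<longrightarrow> a \<le> u x \<and> u x \<le> a + d"
    have ug: "has_weak_gradient \<Omega> u g" using en by (simp add: energy_class_def)
    have sub4: "ball y s \<subseteq> ball y (4 * s)" "ball y (2 * s) \<subseteq> ball y (4 * s)"
      using s by (auto intro!: subset_ball)
    then have sub: "ball y (2 * s) \<subseteq> \<Omega>" using s by blast
    have \<kappa>d: "d - \<delta> / 4 * d / 2 ^ Suc J = \<kappa> * d" by (simp add: \<kappa>_def left_diff_distrib)
    show "\<exists>a'. AE x in lebesgue. x \<in> ball y s \<longrightarrow> a' \<le> u x \<and> u x \<le> a' + max (\<kappa> * d) (Q * K * s)"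
    proof (cases "2 * K * s \<le> \<delta> / 4 * d / 2 ^ J")
      case False
      then have "d \<le> Q * K * s" using \<delta> by (simp add: Q_def field_simps)
      have "AE x in lebesgue. x \<in> ball y s \<longrightarrow> a \<le> u x \<and> u x \<le> a + max (\<kappa> * d) (Q * K * s)"
        using ae
      proof eventually_elim
        case (elim x)
        have "a + d \<le> a + max (\<kappa> * d) (Q * K * s)" using \<open>d \<le> Q * K * s\<close> by simp
        then show ?case using elim sub4 by (meson order_trans subsetD)
      qed
      then show ?thesis by blast
    next
      case True
      define S1 where "S1 = {x \<in> ball y (2 * s). u x \<le> a + d - d / 2}"
      define S2 where "S2 = {x \<in> ball y (2 * s). - u x \<le> - a - d / 2}"
      have S: "S1 \<in> lmeasurable" "S2 \<in> lmeasurable"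
      proof -
        have m: "{x \<in> ball y (2 * s). u x \<in> T} \<in> lmeasurable" if "T \<in> sets borel" for T
          using weak_gradient_sublevel_sets[OF ug sub that]
          by (rule bounded_set_imp_lmeasurable[rotated]) (auto intro: bounded_subset[OF bounded_ball])
        have "S1 = {x \<in> ball y (2 * s). u x \<in> {..a + d - d / 2}}" "S2 = {x \<in> ball y (2 * s). u x \<in> {a + d / 2..}}"
          by (auto simp: S1_def S2_def)
        then show "S1 \<in> lmeasurable" "S2 \<in> lmeasurable"
          using m[of "{..a + d - d / 2}"] m[of "{a + d / 2..}"] by simp_all
      qed
      have "measure lebesgue (ball y (2 * s)) \<le> measure lebesgue (S1 \<union> S2)"
        using S by (intro measure_mono_fmeasurable) (auto simp: S1_def S2_def intro: fmeasurable.Un)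
      also have "\<dots> \<le> measure lebesgue S1 + measure lebesgue S2"
        using S by (intro measure_Un_le) auto
      finally consider "1 / 2 * measure lebesgue (ball y (2 * s)) \<le> measure lebesgue S1"
        | "1 / 2 * measure lebesgue (ball y (2 * s)) \<le> measure lebesgue S2" by linarith
      then show ?thesis
      proof cases
        case 1
        have "AE x in lebesgue. x \<in> ball y (4 * s) \<longrightarrow> u x \<le> a + d"
          using ae by eventually_elim auto
        from J[OF en(1) C\<^sub>2 s d True this] 1
        have "AE x in lebesgue. x \<in> ball y s \<longrightarrow> u x \<le> a + d - \<delta> / 4 * d / 2 ^ Suc J"
          unfolding S1_def by blast
        with ae have "AE x in lebesgue. x \<in> ball y s \<longrightarrow> a \<le> u x \<and> u x \<le> a + max (\<kappa> * d) (Q * K * s)"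
        proof eventually_elim
          case (elim x)
          show ?case
          proof
            assume x: "x \<in> ball y s"
            then have "a \<le> u x" "u x \<le> a + d - \<delta> / 4 * d / 2 ^ Suc J" using elim sub4 by blast+
            then show "a \<le> u x \<and> u x \<le> a + max (\<kappa> * d) (Q * K * s)" using \<kappa>d by linarith
          qed
        qed
        then show ?thesis by blast
      next
        case 2
        have "AE x in lebesgue. x \<in> ball y (4 * s) \<longrightarrow> - u x \<le> - a"
          using ae by eventually_elim auto
        from J[OF en(2) C\<^sub>2 s d True this] 2
        have "AE x in lebesgue. x \<in> ball y s \<longrightarrow> - u x \<le> - a - \<delta> / 4 * d / 2 ^ Suc J"
          unfolding S2_def by blast
        with ae have "AE x in lebesgue. x \<in> ball y s \<longrightarrow>
          a + \<delta> / 4 * d / 2 ^ Suc J \<le> u x \<and> u x \<le> a + \<delta> / 4 * d / 2 ^ Suc J + max (\<kappa> * d) (Q * K * s)"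
        proof eventually_elim
          case (elim x)
          show ?case
          proof
            assume x: "x \<in> ball y s"
            then have "u x \<le> a + d" "- u x \<le> - a - \<delta> / 4 * d / 2 ^ Suc J" using elim sub4 by blast+
            then show "a + \<delta> / 4 * d / 2 ^ Suc J \<le> u x
              \<and> u x \<le> a + \<delta> / 4 * d / 2 ^ Suc J + max (\<kappa> * d) (Q * K * s)" using \<kappa>d by linarith
          qed
        qed
        then show ?thesis by blast
      qed
    qed
  qed
qed

text \<open>\<open>D\<close> dominates both the initial oscillation and the lower-order term at the
  initial radius. That term is divided by 4 at each step, faster than multiplication by \<kappa>, so
  it never overtakes.\<close>

lemma oscillation_decay:
  assumes C\<^sub>1: "0 \<le> C\<^sub>1" and \<delta>: "0 < \<delta>" "\<delta> \<le> 2"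
  obtains \<kappa> Q :: real where "3 / 4 \<le> \<kappa>" "\<kappa> < 1" "0 \<le> Q"
    "\<And>(\<Omega>::'a::euclidean_space set) u g g' C\<^sub>2 M K y R D i.
      energy_class \<Omega> F C\<^sub>1 C\<^sub>2 (\<delta> * M) u g \<Longrightarrow> energy_class \<Omega> F C\<^sub>1 C\<^sub>2 (\<delta> * M) (\<lambda>x. - u x) g' \<Longrightarrow>
      0 \<le> C\<^sub>2 \<Longrightarrow> C\<^sub>2 \<le> F K \<Longrightarrow> 0 \<le> K \<Longrightarrow> 0 < R \<Longrightarrow> ball y R \<subseteq> \<Omega> \<Longrightarrow> 0 < M \<Longrightarrow>
      (AE x in lebesgue. x \<in> \<Omega> \<longrightarrow> \<bar>u x\<bar> \<le> M) \<Longrightarrow> 2 * M \<le> D \<Longrightarrow> Q * K * R \<le> D \<Longrightarrow>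
      \<exists>a. AE x in lebesgue. x \<in> ball y (R / 4 ^ i) \<longrightarrow> a \<le> u x \<and> u x \<le> a + D * \<kappa> ^ i"
proof -
  obtain \<kappa> Q :: real where \<kappa>: "3 / 4 \<le> \<kappa>" "\<kappa> < 1" "0 \<le> Q" and osc:
    "\<And>(\<Omega>::'a set) u g g' C\<^sub>2 M K y s a d.
      energy_class \<Omega> F C\<^sub>1 C\<^sub>2 (\<delta> * M) u g \<Longrightarrow> energy_class \<Omega> F C\<^sub>1 C\<^sub>2 (\<delta> * M) (\<lambda>x. - u x) g' \<Longrightarrow>
      0 \<le> C\<^sub>2 \<Longrightarrow> C\<^sub>2 \<le> F K \<Longrightarrow> 0 \<le> K \<Longrightarrow>
      0 < s \<Longrightarrow> ball y (4 * s) \<subseteq> \<Omega> \<Longrightarrow> 0 < d \<Longrightarrow> d \<le> 2 * M \<Longrightarrow>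
      (AE x in lebesgue. x \<in> ball y (4 * s) \<longrightarrow> a \<le> u x \<and> u x \<le> a + d) \<Longrightarrow>
      \<exists>a'. AE x in lebesgue. x \<in> ball y s \<longrightarrow> a' \<le> u x \<and> u x \<le> a' + max (\<kappa> * d) (Q * K * s)"
    by (rule oscillation_step[OF C\<^sub>1 \<delta>]) blast
  show ?thesis
  proof (rule that[OF \<kappa>])
    fix \<Omega> :: "'a set" and u g g' C\<^sub>2 M K y R D and i :: nat
    assume en: "energy_class \<Omega> F C\<^sub>1 C\<^sub>2 (\<delta> * M) u g" "energy_class \<Omega> F C\<^sub>1 C\<^sub>2 (\<delta> * M) (\<lambda>x. - u x) g'"
      and C\<^sub>2: "0 \<le> C\<^sub>2" "C\<^sub>2 \<le> F K" "0 \<le> K" and R: "0 < R" "ball y R \<subseteq> \<Omega>" and M: "0 < M"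
      and bound: "AE x in lebesgue. x \<in> \<Omega> \<longrightarrow> \<bar>u x\<bar> \<le> M" and D: "2 * M \<le> D" "Q * K * R \<le> D"
    show "\<exists>a. AE x in lebesgue. x \<in> ball y (R / 4 ^ i) \<longrightarrow> a \<le> u x \<and> u x \<le> a + D * \<kappa> ^ i"
    proof (induction i)
      case 0
      have "AE x in lebesgue. x \<in> ball y (R / 4 ^ 0) \<longrightarrow> - M \<le> u x \<and> u x \<le> - M + D * \<kappa> ^ 0"
        using bound
      proof eventually_elim
        case (elim x)
        have "x \<in> ball y (R / 4 ^ 0) \<Longrightarrow> x \<in> \<Omega>" using R by auto
        then show ?case using elim D by auto
      qed
      then show ?case by blast
    next
      case (Suc i)
      then obtain a where a: "AE x in lebesgue. x \<in> ball y (R / 4 ^ i) \<longrightarrow> a \<le> u x \<and> u x \<le> a + D * \<kappa> ^ i"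
        by blast
      \<comment> \<open>The improvement needs d \<le> 2 * M, whereas \<open>D\<close> may be larger.
        While \<open>D * \<kappa> ^ i\<close> exceeds 2 * M, the bound on |u| serves as the starting
        interval instead.\<close>
      define d where "d = min (D * \<kappa> ^ i) (2 * M)"
      have d: "0 < d" "d \<le> 2 * M" "d \<le> D * \<kappa> ^ i"
        using D M \<kappa> by (auto simp: d_def)
      have sub: "ball y (R / 4 ^ i) \<subseteq> \<Omega>"
      proof -
        have "R / 4 ^ i \<le> R / 1" using R by (intro divide_left_mono) auto
        then show ?thesis using R subset_ball[of "R / 4 ^ i" R y] by auto
      qed
      obtain a' where a': "AE x in lebesgue. x \<in> ball y (R / 4 ^ i) \<longrightarrow> a' \<le> u x \<and> u x \<le> a' + d"
      proof (cases "D * \<kappa> ^ i \<le> 2 * M")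
        case True
        then show ?thesis using a that by (simp add: d_def min_absorb1)
      next
        case False
        have "AE x in lebesgue. x \<in> ball y (R / 4 ^ i) \<longrightarrow> - M \<le> u x \<and> u x \<le> - M + d"
          using bound
        proof eventually_elim
          case (elim x)
          have "d = 2 * M" using False by (simp add: d_def)
          then show ?case using elim sub by auto
        qed
        then show ?thesis by (rule that)
      qed
      define s where "s = R / 4 ^ Suc i"
      have s: "0 < s" "4 * s = R / 4 ^ i" using R by (auto simp: s_def)
      obtain a'' where a'': "AE x in lebesgue. x \<in> ball y s \<longrightarrow> a'' \<le> u x \<and> u x \<le> a'' + max (\<kappa> * d) (Q * K * s)"
        using osc[OF en C\<^sub>2 s(1) _ d(1,2), of y a', unfolded s(2), OF sub a'] by blast
      have "max (\<kappa> * d) (Q * K * s) \<le> D * \<kappa> ^ Suc i"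
      proof (rule max.boundedI)
        have "\<kappa> * d \<le> \<kappa> * (D * \<kappa> ^ i)" using d \<kappa> by (intro mult_left_mono) auto
        then show "\<kappa> * d \<le> D * \<kappa> ^ Suc i" by (simp add: mult.left_commute)
        have "Q * K * s = (Q * K * R) * (1 / 4) ^ Suc i" by (simp add: s_def power_divide)
        also have "\<dots> \<le> D * \<kappa> ^ Suc i"
          using D M \<kappa> C\<^sub>2 by (intro mult_mono power_mono) auto
        finally show "Q * K * s \<le> D * \<kappa> ^ Suc i" .
      qed
      then have "AE x in lebesgue. x \<in> ball y s \<longrightarrow> a'' \<le> u x \<and> u x \<le> a'' + D * \<kappa> ^ Suc i"
        using a'' by (auto elim!: eventually_mono)
      then show ?case by (auto simp: s_def)
    qed
  qed
qed

end

section \<open>From decay of the oscillation to a Hoelder continuous representative\<close>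

lemma AE_lebesgue_obtain:
  fixes U :: "'a::euclidean_space set"
  assumes "AE x in lebesgue. P x" "U \<noteq> {}" "open U"
  obtains x where "x \<in> U" "P x"
proof -
  have "\<exists>x\<in>U. P x"
  proof (rule ccontr)
    assume "\<not> (\<exists>x\<in>U. P x)"
    then have "U \<subseteq> {x \<in> space lebesgue. \<not> P x}" by auto
    moreover obtain N where "{x \<in> space lebesgue. \<not> P x} \<subseteq> N" "N \<in> null_sets lebesgue"
      using assms(1) unfolding eventually_ae_filter by auto
    ultimately have "negligible U"
      using negligible_iff_null_sets negligible_subset by blast
    then show False using open_not_negligible assms by blast
  qed
  then show ?thesis using that by blast
qed

text \<open>At each centre the values of \<open>u\<close> are trapped in intervals of length D q^i.
  Any two of these meet, since the balls share a point outside the null sets, so the supremum of the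
  left end points lies in all of them. This defines \<open>v\<close> at every centre without an
  exceptional set.\<close>

lemma Hoelder_from_oscillation_decay:
  fixes u :: "'a::euclidean_space \<Rightarrow> real"
  assumes R: "0 < R" and \<alpha>: "0 < \<alpha>" and D: "0 \<le> D"
    and osc: "\<And>y i. y \<in> ball x\<^sub>0 R \<Longrightarrow>
      \<exists>a. AE x in lebesgue. x \<in> ball y (R / 4 ^ i) \<longrightarrow> a \<le> u x \<and> u x \<le> a + D * (4 powr - \<alpha>) ^ i"
  obtains v C where "AE x in lebesgue. x \<in> ball x\<^sub>0 (R / 2) \<longrightarrow> v x = u x"
    "\<And>x y. x \<in> ball x\<^sub>0 (R / 2) \<Longrightarrow> y \<in> ball x\<^sub>0 (R / 2) \<Longrightarrow> \<bar>v x - v y\<bar> \<le> C * dist x y powr \<alpha>"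
proof -
  define q where "q = (4::real) powr - \<alpha>"
  have q: "0 < q" "q < 1" using \<alpha> by (auto simp: q_def powr_less_one)
  define a where "a y i = (SOME a. AE x in lebesgue. x \<in> ball y (R / 4 ^ i) \<longrightarrow> a \<le> u x \<and> u x \<le> a + D * q ^ i)" for y i
  have a: "AE x in lebesgue. x \<in> ball y (R / 4 ^ i) \<longrightarrow> a y i \<le> u x \<and> u x \<le> a y i + D * q ^ i"
    if "y \<in> ball x\<^sub>0 R" for y i
    unfolding a_def by (rule someI_ex) (rule osc[OF that, folded q_def])
  define v where "v y = (SUP i. a y i)" for y
  have nested: "a y i \<le> a y j + D * q ^ j" if y: "y \<in> ball x\<^sub>0 R" for y i j
  proof -
    have "AE x in lebesgue. (x \<in> ball y (R / 4 ^ i) \<longrightarrow> a y i \<le> u x \<and> u x \<le> a y i + D * q ^ i)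
        \<and> (x \<in> ball y (R / 4 ^ j) \<longrightarrow> a y j \<le> u x \<and> u x \<le> a y j + D * q ^ j)"
      using a[OF y, of i] a[OF y, of j] by eventually_elim blast
    moreover have "y \<in> ball y (R / 4 ^ i) \<inter> ball y (R / 4 ^ j)" using R by simp
    then have "ball y (R / 4 ^ i) \<inter> ball y (R / 4 ^ j) \<noteq> {}" by blast
    ultimately obtain x where "x \<in> ball y (R / 4 ^ i) \<inter> ball y (R / 4 ^ j)"
      "(x \<in> ball y (R / 4 ^ i) \<longrightarrow> a y i \<le> u x \<and> u x \<le> a y i + D * q ^ i)
        \<and> (x \<in> ball y (R / 4 ^ j) \<longrightarrow> a y j \<le> u x \<and> u x \<le> a y j + D * q ^ j)"
      by (rule AE_lebesgue_obtain) auto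
    then have "a y i \<le> u x" "u x \<le> a y j + D * q ^ j" by auto
    then show ?thesis by linarith
  qed
  have v: "a y i \<le> v y" "v y \<le> a y i + D * q ^ i" if "y \<in> ball x\<^sub>0 R" for y i
  proof -
    have "bdd_above (range (a y))" using nested[OF that, of _ i] by (auto simp: bdd_above_def)
    then show "a y i \<le> v y" unfolding v_def by (rule cSUP_upper[OF UNIV_I])
    show "v y \<le> a y i + D * q ^ i" unfolding v_def using nested[OF that] by (intro cSUP_least) auto
  qed
  have close: "\<bar>v y - v z\<bar> \<le> 2 * (D * q ^ i)"
    if y: "y \<in> ball x\<^sub>0 R" and z: "z \<in> ball x\<^sub>0 R" and dist: "dist y z < R / 4 ^ i" for y z i
  proof -
    have "AE x in lebesgue. (x \<in> ball y (R / 4 ^ i) \<longrightarrow> a y i \<le> u x \<and> u x \<le> a y i + D * q ^ i)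
        \<and> (x \<in> ball z (R / 4 ^ i) \<longrightarrow> a z i \<le> u x \<and> u x \<le> a z i + D * q ^ i)"
      using a[OF y, of i] a[OF z, of i] by eventually_elim blast
    moreover have "z \<in> ball y (R / 4 ^ i) \<inter> ball z (R / 4 ^ i)" using R dist by simp
    then have "ball y (R / 4 ^ i) \<inter> ball z (R / 4 ^ i) \<noteq> {}" by blast
    ultimately obtain x where "x \<in> ball y (R / 4 ^ i) \<inter> ball z (R / 4 ^ i)"
      "(x \<in> ball y (R / 4 ^ i) \<longrightarrow> a y i \<le> u x \<and> u x \<le> a y i + D * q ^ i)
        \<and> (x \<in> ball z (R / 4 ^ i) \<longrightarrow> a z i \<le> u x \<and> u x \<le> a z i + D * q ^ i)"
      by (rule AE_lebesgue_obtain) auto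
    then have "a y i \<le> u x" "u x \<le> a y i + D * q ^ i" "a z i \<le> u x" "u x \<le> a z i + D * q ^ i" by auto
    then show ?thesis using v[OF y, of i] v[OF z, of i] by linarith
  qed
  have half: "ball x\<^sub>0 (R / 2) \<subseteq> ball x\<^sub>0 R" using R by (intro subset_ball) auto
  \<comment> \<open>There are uncountably many centres. A countable dense set of them lets one null
    set serve all, and \<open>close\<close> carries the estimate from a nearby centre to
    \<open>x\<close>.\<close>
  obtain Q :: "'a set" where Q: "countable Q" "\<And>X. open X \<Longrightarrow> X \<noteq> {} \<Longrightarrow> \<exists>z\<in>Q. z \<in> X"
    using countable_dense_exists by metis
  have "AE x in lebesgue. \<forall>z\<in>Q \<inter> ball x\<^sub>0 R. \<forall>i. x \<in> ball z (R / 4 ^ i) \<longrightarrow> a z i \<le> u x \<and> u x \<le> a z i + D * q ^ i"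
    using Q(1) a by (subst AE_ball_countable) (auto simp: AE_all_countable)
  then have "AE x in lebesgue. x \<in> ball x\<^sub>0 (R / 2) \<longrightarrow> v x = u x"
  proof eventually_elim
    case (elim x)
    show ?case
    proof
      assume "x \<in> ball x\<^sub>0 (R / 2)"
      then have x: "x \<in> ball x\<^sub>0 R" using half by blast
      have "\<bar>v x - u x\<bar> \<le> 3 * (D * q ^ i)" for i
      proof -
        have "open (ball x (R / 4 ^ i) \<inter> ball x\<^sub>0 R)" "x \<in> ball x (R / 4 ^ i) \<inter> ball x\<^sub>0 R" using x R by auto
        then obtain z where z: "z \<in> Q" "z \<in> ball x (R / 4 ^ i)" "z \<in> ball x\<^sub>0 R" using Q(2) by blast
        then have "a z i \<le> u x" "u x \<le> a z i + D * q ^ i" using elim by (auto simp: dist_commute)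
        moreover have "\<bar>v x - v z\<bar> \<le> 2 * (D * q ^ i)" by (rule close) (use x z in auto)
        ultimately show ?thesis using v[OF z(3), of i] by linarith
      qed
      then have "\<exists>N. \<forall>i\<ge>N. \<bar>v x - u x\<bar> \<le> 3 * (D * q ^ i)" by blast
      moreover have "(\<lambda>i. 3 * (D * q ^ i)) \<longlonglongrightarrow> 3 * (D * 0)"
        by (intro tendsto_intros LIMSEQ_realpow_zero) (use q in auto)
      ultimately have "\<bar>v x - u x\<bar> \<le> 3 * (D * 0)"
        by (rule LIMSEQ_le_const[rotated])
      then show "v x = u x" by simp
    qed
  qed
  moreover have "\<bar>v x - v y\<bar> \<le> 2 * D / q * (1 / R) powr \<alpha> * dist x y powr \<alpha>"
    if x: "x \<in> ball x\<^sub>0 (R / 2)" and y: "y \<in> ball x\<^sub>0 (R / 2)" for x y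
  proof (cases "x = y")
    case False
    define t where "t = dist x y"
    have t: "0 < t" using False by (simp add: t_def)
    have tR: "t < R"
      using x y dist_triangle3[of x y x\<^sub>0] unfolding t_def by simp
    have "\<exists>i. R / 4 ^ i \<le> t"
    proof -
      have "(\<lambda>i. R * (1 / 4) ^ i) \<longlonglongrightarrow> R * 0"
        by (intro tendsto_intros LIMSEQ_realpow_zero) auto
      then have "eventually (\<lambda>i. R * (1 / 4) ^ i < t) sequentially"
        using t by (intro order_tendstoD) auto
      then obtain i where "R * (1 / 4) ^ i < t" by (auto simp: eventually_sequentially)
      then show ?thesis by (intro exI[of _ i]) (simp add: power_divide)
    qed
    \<comment> \<open>The least such \<open>j\<close> brackets the distance: with i = j - 1 it lies
      between R / 4^j and R / 4^i.\<close>
    then obtain j where j: "R / 4 ^ j \<le> t" "\<And>i. i < j \<Longrightarrow> \<not> R / 4 ^ i \<le> t"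
      using exists_least_iff[of "\<lambda>i. R / 4 ^ i \<le> t"] by auto
    have "j \<noteq> 0" using j(1) tR by (cases j) auto
    then obtain i where ji: "j = Suc i" using not0_implies_Suc by blast
    have "t < R / 4 ^ i" using j(2)[of i] ji by simp
    then have "\<bar>v x - v y\<bar> \<le> 2 * (D * q ^ i)"
      using close x y half unfolding t_def by blast
    also have "q ^ i \<le> (1 / R * t) powr \<alpha> / q"
    proof -
      have "q ^ i * q = q ^ Suc i" by simp
      also have "\<dots> = (1 / 4 ^ Suc i) powr \<alpha>"
      proof -
        have "q ^ Suc i = q powr real (Suc i)"
          by (rule powr_realpow[OF q(1), symmetric])
        also have "\<dots> = 4 powr (- \<alpha> * real (Suc i))"
          unfolding q_def powr_powr ..
        also have "\<dots> = (4 powr (- real (Suc i))) powr \<alpha>"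
          unfolding powr_powr by (simp only: mult_minus_left mult_minus_right mult.commute)
        also have "4 powr (- real (Suc i)) = 1 / 4 ^ Suc i"
          unfolding powr_minus_divide by (subst powr_realpow) auto
        finally show ?thesis .
      qed
      also have "\<dots> \<le> (1 / R * t) powr \<alpha>"
        using j(1) ji R \<alpha> by (intro powr_mono2) (auto simp: field_simps)
      finally show ?thesis using q by (simp add: field_simps)
    qed
    finally have "\<bar>v x - v y\<bar> \<le> 2 * (D * ((1 / R * t) powr \<alpha> / q))"
      using D by (simp add: mult_left_mono)
    also have "(1 / R * t) powr \<alpha> = (1 / R) powr \<alpha> * t powr \<alpha>"
      by (rule powr_mult)
    finally show ?thesis by (simp add: t_def)
  qed simp
  ultimately show ?thesis by (rule that)
qed


section \<open>From the structural conditions to the energy inequality\<close>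

text \<open>The scaling inequality of \<open>cond_A1\<close> is used in three ways. Starting at
  argument 1 it bounds \<open>A\<close> below, by \<open>cond_C1\<close>. Scaling \<open>t\<close>
  back to 1 bounds \<open>A\<close> above, by the maximum of A(x, 1) on the compact closure. Scaling
  by \<open>a\<close> and back gives \<open>F a * F (1 / a) \<le> 1\<close>, which turns
  submultiplicativity into supermultiplicativity.\<close>

lemma gauge_of_conditions:
  fixes \<Omega> :: "(real^'n) set"
  assumes \<Omega>: "open \<Omega>" "\<Omega> \<noteq> {}"
    and A: "A \<in> N_class \<Omega>" "cond_A \<Omega> A" "cond_A1 \<Omega> A" "cond_C1 \<Omega> A"
  obtains F M\<^sub>0 c\<^sub>0 C\<^sub>0 where "gauge F M\<^sub>0" "0 < c\<^sub>0" "0 < C\<^sub>0"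
    "\<And>x t. x \<in> \<Omega> \<Longrightarrow> 0 \<le> t \<Longrightarrow> c\<^sub>0 * F t \<le> A x t"
    "\<And>x t. x \<in> \<Omega> \<Longrightarrow> 0 < t \<Longrightarrow> A x t \<le> C\<^sub>0 * F t"
proof -
  obtain F where F: "F \<in> {0..} \<rightarrow> {0..}" "strict_mono_on {0..} F" "F differentiable_on {0..}"
      "\<And>\<alpha> t x. 0 \<le> \<alpha> \<Longrightarrow> x \<in> \<Omega> \<Longrightarrow> F \<alpha> * A x t \<le> A x (\<alpha> * t)" "Delta_Rplus F"
    using A(3) unfolding cond_A1_def by blast
  obtain M\<^sub>0 where M\<^sub>0: "0 < M\<^sub>0" "\<And>a b. 0 < a \<Longrightarrow> 0 < b \<Longrightarrow> F (a * b) \<le> M\<^sub>0 * F a * F b"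
    using F(5) unfolding Delta_Rplus_def by blast
  have F0: "0 \<le> F 0" using F(1) by auto
  have Fpos: "0 < F t" if "0 < t" for t
    using strict_mono_onD[OF F(2), of 0 t] F0 that by auto
  have Ann: "0 \<le> A x t" if "x \<in> \<Omega>" for x t
    using A(1) that by (simp add: N_class_def)
  define c\<^sub>0 where "c\<^sub>0 = (INF x\<in>\<Omega>. A x 1)"
  have c\<^sub>0: "0 < c\<^sub>0" using A(4) by (simp add: c\<^sub>0_def cond_C1_def)
  have A1: "c\<^sub>0 \<le> A x 1" if "x \<in> \<Omega>" for x
    unfolding c\<^sub>0_def using Ann that by (intro cINF_lower) (auto simp: bdd_below_def)
  have lower: "c\<^sub>0 * F t \<le> A x t" if "x \<in> \<Omega>" "0 \<le> t" for x t
  proof -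
    have "c\<^sub>0 * F t \<le> A x 1 * F t" using A1[OF that(1)] F(1) that by (intro mult_right_mono) auto
    also have "\<dots> \<le> A x t" using F(4)[OF that(2,1), of 1] by (simp add: mult.commute)
    finally show ?thesis .
  qed
  have cont: "continuous_on (closure \<Omega> \<times> UNIV) (\<lambda>(x, t). A x t)" and bd: "bounded \<Omega>"
    using A(2) by (auto simp: cond_A_def)
  have "continuous_on (closure \<Omega>) (\<lambda>x. (\<lambda>(x, t). A x t) (x, 1))"
    by (rule continuous_on_compose2[OF cont]) (auto intro!: continuous_intros)
  then have "compact ((\<lambda>x. A x 1) ` closure \<Omega>)"
    using bd by (intro compact_continuous_image) (auto simp: compact_closure)
  then obtain S where S: "\<And>x. x \<in> closure \<Omega> \<Longrightarrow> \<bar>A x 1\<bar> \<le> S"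
    using compact_imp_bounded bounded_real by (metis (mono_tags, lifting) image_eqI)
  obtain x\<^sub>0 where x\<^sub>0: "x\<^sub>0 \<in> \<Omega>" using \<Omega> by blast
  have "0 < S" using S[of x\<^sub>0] A1[OF x\<^sub>0] c\<^sub>0 x\<^sub>0 closure_subset by fastforce
  define C\<^sub>0 where "C\<^sub>0 = M\<^sub>0 * S / F 1"
  have C\<^sub>0: "0 < C\<^sub>0" using M\<^sub>0 \<open>0 < S\<close> Fpos[of 1] by (simp add: C\<^sub>0_def)
  have upper: "A x t \<le> C\<^sub>0 * F t" if x: "x \<in> \<Omega>" and t: "0 < t" for x t
  proof -
    have "F (1 / t) * A x t \<le> A x (1 / t * t)" using F(4)[of "1 / t" x t] x t by simp
    also have "\<dots> \<le> S" using S[of x] x t closure_subset by fastforce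
    finally have 1: "F (1 / t) * A x t \<le> S" .
    have "F 1 \<le> M\<^sub>0 * F t * F (1 / t)" using M\<^sub>0(2)[of t "1 / t"] t by simp
    then have "F 1 * A x t \<le> M\<^sub>0 * F t * F (1 / t) * A x t"
      using Ann[OF x] by (intro mult_right_mono) auto
    also have "\<dots> = M\<^sub>0 * F t * (F (1 / t) * A x t)" by simp
    also have "\<dots> \<le> M\<^sub>0 * F t * S"
      using 1 M\<^sub>0 Fpos[OF t] by (intro mult_left_mono) auto
    finally show ?thesis using Fpos[of 1] by (simp add: C\<^sub>0_def field_simps)
  qed
  have inv: "F a * F (1 / a) \<le> 1" if a: "0 < a" for a
  proof -
    have "F (1 / a) * (F a * A x\<^sub>0 1) \<le> F (1 / a) * A x\<^sub>0 (a * 1)"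
      using F(4)[of a x\<^sub>0 1] x\<^sub>0 a Fpos[of "1 / a"] by (intro mult_left_mono) auto
    also have "\<dots> \<le> A x\<^sub>0 (1 / a * (a * 1))" using F(4)[of "1 / a" x\<^sub>0 "a * 1"] x\<^sub>0 a by simp
    finally have "(F a * F (1 / a)) * A x\<^sub>0 1 \<le> 1 * A x\<^sub>0 1" using a by (simp add: mult_ac)
    then show ?thesis using A1[OF x\<^sub>0] c\<^sub>0 by (simp add: mult_le_cancel_right)
  qed
  have super: "F a * F b \<le> M\<^sub>0 * F (a * b)" if a: "0 < a" and b: "0 < b" for a b
  proof -
    have "F b \<le> M\<^sub>0 * F (1 / a) * F (a * b)" using M\<^sub>0(2)[of "1 / a" "a * b"] a b by simp
    then have "F a * F b \<le> F a * (M\<^sub>0 * F (1 / a) * F (a * b))"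
      using Fpos[OF a] by (intro mult_left_mono) auto
    also have "\<dots> = (F a * F (1 / a)) * (M\<^sub>0 * F (a * b))" by simp
    also have "\<dots> \<le> 1 * (M\<^sub>0 * F (a * b))"
      using inv[OF a] M\<^sub>0 Fpos[of "a * b"] a b by (intro mult_right_mono) auto
    finally show ?thesis by simp
  qed
  \<comment> \<open>A(x, .) is an N-function for almost every x only, but one such x suffices: the
    upper bound passes its superlinear growth on to \<open>F\<close>.\<close>
  have superlin: "filterlim (\<lambda>t. F t / t) at_top at_top"
  proof -
    have "AE x in lebesgue_on \<Omega>. N_function (A x)" using A(1) by (simp add: N_class_def)
    then have "AE x in lebesgue. x \<in> \<Omega> \<longrightarrow> N_function (A x)"
      using \<Omega>(1) by (subst (asm) AE_restrict_space_iff) auto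
    then obtain x where x: "x \<in> \<Omega>" "x \<in> \<Omega> \<longrightarrow> N_function (A x)"
      using AE_lebesgue_obtain[OF _ \<Omega>(2,1)] by blast
    then have lim: "filterlim (\<lambda>t. A x t / t) at_top at_top" by (simp add: N_function_def)
    show ?thesis
      unfolding filterlim_at_top
    proof
      fix Z :: real
      have "\<forall>\<^sub>F t in at_top. C\<^sub>0 * Z \<le> A x t / t" using lim unfolding filterlim_at_top by blast
      then show "\<forall>\<^sub>F t in at_top. Z \<le> F t / t"
        using eventually_gt_at_top[of 0]
      proof eventually_elim
        case (elim t)
        have "A x t / t \<le> C\<^sub>0 * F t / t" using upper[OF x(1) elim(2)] elim by (intro divide_right_mono) auto
        then have "C\<^sub>0 * Z \<le> C\<^sub>0 * (F t / t)" using elim by simp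
        then show ?case using C\<^sub>0 by (simp only: mult_le_cancel_left_pos)
      qed
    qed
  qed
  have "continuous_on {0..} F" using F(3) by (rule differentiable_imp_continuous_on)
  then have "gauge F M\<^sub>0"
    using F(2) F0 M\<^sub>0 super superlin by unfold_locales auto
  then show ?thesis using that c\<^sub>0 C\<^sub>0 lower upper by blast
qed

section \<open>The energy inequality for members of the class\<close>

lemma has_weak_gradient_weak_gradient:
  "has_weak_gradient \<Omega> u g \<Longrightarrow> has_weak_gradient \<Omega> u (weak_gradient \<Omega> u)"
  unfolding weak_gradient_def by (rule someI[of "has_weak_gradient \<Omega> u"])

lemma has_weak_gradient_uminus:
  assumes "has_weak_gradient \<Omega> u g"
  shows "has_weak_gradient \<Omega> (\<lambda>x. - u x) (\<lambda>x. - g x)"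
  using assms unfolding has_weak_gradient_def locally_integrable_def
  by (auto simp: set_integrable_def set_lebesgue_integral_def)

text \<open>The lower bound on \<open>A\<close> is used on the left, the upper bound on the right.
  \<open>M\<close> enters only through the range of levels and \<open>\<gamma>\<^sub>1\<close> only
  through the additive constant; neither reaches the first constant, on which the rate
  depends.\<close>

lemma (in gauge) class_B_energy_class:
  fixes \<Omega> :: "'a::euclidean_space set"
  assumes c\<^sub>0: "0 < c\<^sub>0" and C\<^sub>0: "0 < C\<^sub>0"
    and lower: "\<And>x t. x \<in> \<Omega> \<Longrightarrow> 0 \<le> t \<Longrightarrow> c\<^sub>0 * F t \<le> A x t"
    and upper: "\<And>x t. x \<in> \<Omega> \<Longrightarrow> 0 < t \<Longrightarrow> A x t \<le> C\<^sub>0 * F t"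
    and u: "u \<in> class_B \<Omega> A M \<gamma> \<gamma>\<^sub>1 \<delta>" and \<gamma>: "0 < \<gamma>" "0 < \<gamma>\<^sub>1"
    and w: "w \<in> {u, \<lambda>x. - u x}"
  shows "energy_class \<Omega> F (\<gamma> * C\<^sub>0 / c\<^sub>0) (\<gamma>\<^sub>1 / c\<^sub>0) (\<delta> * M) w (weak_gradient \<Omega> w)"
proof -
  obtain g where "has_weak_gradient \<Omega> u g"
    using u by (auto simp: class_B_def W1_space_def)
  then have wg: "has_weak_gradient \<Omega> w (weak_gradient \<Omega> w)"
    using w has_weak_gradient_weak_gradient has_weak_gradient_uminus by blast
  let ?g = "weak_gradient \<Omega> w"
  have "(\<integral>\<^sup>+x\<in>superlevel w k y (\<sigma> * \<rho>). ennreal (F (norm (?g x))) \<partial>lebesgue)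
      \<le> ennreal (\<gamma> * C\<^sub>0 / c\<^sub>0 * F ((b - k) / ((1 - \<sigma>) * \<rho>)) + \<gamma>\<^sub>1 / c\<^sub>0) * emeasure lebesgue (superlevel w k y \<rho>)"
    if \<rho>: "0 < \<rho>" "ball y \<rho> \<subseteq> \<Omega>" and \<sigma>: "0 < \<sigma>" "\<sigma> < 1"
      and ae: "AE x in lebesgue. x \<in> ball y \<rho> \<longrightarrow> w x \<le> b" and k: "b - \<delta> * M \<le> k" "k < b"
    for y \<rho> \<sigma> b k
  proof -
    define \<tau> where "\<tau> = (1 - \<sigma>) * \<rho>"
    define f where "f = F ((b - k) / \<tau>)"
    define S where "S = superlevel w k y \<rho>"
    define S' where "S' = superlevel w k y (\<sigma> * \<rho>)"
    have \<tau>: "0 < \<tau>" using \<rho> \<sigma> by (simp add: \<tau>_def)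
    have f: "0 \<le> f" using F_nonneg[of "(b - k) / \<tau>"] k \<tau> by (simp add: f_def)
    have sub: "ball y (\<sigma> * \<rho>) \<subseteq> \<Omega>" using \<rho> \<sigma> subset_ball[of "\<sigma> * \<rho>" \<rho> y] by auto
    have Sm: "S \<in> sets lebesgue" "S' \<in> sets lebesgue" "S \<subseteq> \<Omega>" "S' \<subseteq> \<Omega>"
      using superlevel_lmeasurable[OF wg \<rho>(2), of k] superlevel_lmeasurable[OF wg sub, of k] \<rho>(2) sub
      by (auto simp: S_def S'_def superlevel_def)
    \<comment> \<open>An essential upper bound \<open>b\<close> is at least the essential supremum,
      so every level from b - \<delta> * M on is admissible in the class.\<close>
    have "w \<in> borel_measurable (lebesgue_on \<Omega>)"
      using wg by (simp add: has_weak_gradient_def locally_integrable_def)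
    then have "w \<in> borel_measurable (lebesgue_on (ball y \<rho>))"
      using \<rho>(2) measurable_restrict_mono by blast
    then have "(\<lambda>x. ereal (w x)) \<in> borel_measurable (lebesgue_on (ball y \<rho>))" by simp
    moreover have "AE x in lebesgue_on (ball y \<rho>). ereal (w x) \<le> ereal b"
      using ae by (subst AE_restrict_space_iff) auto
    ultimately have "esssup (lebesgue_on (ball y \<rho>)) (\<lambda>x. ereal (w x)) \<le> ereal b"
      by (rule esssup_I)
    then have "esssup (lebesgue_on (ball y \<rho>)) (\<lambda>x. ereal (w x)) - ereal (\<delta> * M) \<le> ereal b - ereal (\<delta> * M)"
      by (rule ereal_minus_mono) simp
    also have "\<dots> \<le> ereal k" using k by simp
    finally have esk: "esssup (lebesgue_on (ball y \<rho>)) (\<lambda>x. ereal (w x)) - ereal (\<delta> * M) \<le> ereal k" .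
    have "\<forall>w\<in>{u, \<lambda>x. - u x}. \<forall>y. \<forall>\<rho>>0. ball y \<rho> \<subseteq> \<Omega> \<longrightarrow>
            (\<forall>\<sigma>\<in>{0<..<1}. \<forall>k.
               ereal k \<ge> esssup (lebesgue_on (ball y \<rho>)) (\<lambda>x. ereal (w x)) - ereal (\<delta> * M) \<longrightarrow>
               (\<integral>\<^sup>+x\<in>superlevel w k y (\<sigma> * \<rho>). ennreal (A x (norm (weak_gradient \<Omega> w x))) \<partial>lebesgue)
               \<le> ennreal \<gamma> * (\<integral>\<^sup>+x\<in>superlevel w k y \<rho>. ennreal (A x ((w x - k) / ((1 - \<sigma>) * \<rho>))) \<partial>lebesgue)
                 + ennreal \<gamma>\<^sub>1 * emeasure lebesgue (superlevel w k y \<rho>))"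
      using u unfolding class_B_def mem_Collect_eq by (elim conjE)
    from this[rule_format, OF w \<rho> _ esk] \<sigma>
    have caccioppoli: "(\<integral>\<^sup>+x\<in>S'. ennreal (A x (norm (?g x))) \<partial>lebesgue)
        \<le> ennreal \<gamma> * (\<integral>\<^sup>+x\<in>S. ennreal (A x ((w x - k) / \<tau>)) \<partial>lebesgue) + ennreal \<gamma>\<^sub>1 * emeasure lebesgue S"
      by (simp add: S_def S'_def \<tau>_def)
    have "(\<integral>\<^sup>+x\<in>S. ennreal (A x ((w x - k) / \<tau>)) \<partial>lebesgue) \<le> (\<integral>\<^sup>+x. ennreal (C\<^sub>0 * f) * indicator S x \<partial>lebesgue)"
    proof (rule nn_integral_mono_AE)
      show "AE x in lebesgue. ennreal (A x ((w x - k) / \<tau>)) * indicator S x \<le> ennreal (C\<^sub>0 * f) * indicator S x"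
        using ae
      proof eventually_elim
        case (elim x)
        show ?case
        proof (cases "x \<in> S")
          case True
          then have x: "x \<in> \<Omega>" "k < w x" "w x \<le> b" using elim Sm by (auto simp: S_def superlevel_def)
          have "A x ((w x - k) / \<tau>) \<le> C\<^sub>0 * F ((w x - k) / \<tau>)"
            using x \<tau> by (intro upper) auto
          also have "\<dots> \<le> C\<^sub>0 * f"
            unfolding f_def using x \<tau> C\<^sub>0 by (intro mult_left_mono F_mono divide_right_mono) auto
          finally show ?thesis using True by (simp add: ennreal_leI)
        qed simp
      qed
    qed
    also have "\<dots> = ennreal (C\<^sub>0 * f) * emeasure lebesgue S"
      using Sm by (simp add: nn_integral_cmult_indicator)
    finally have "ennreal \<gamma> * (\<integral>\<^sup>+x\<in>S. ennreal (A x ((w x - k) / \<tau>)) \<partial>lebesgue) + ennreal \<gamma>\<^sub>1 * emeasure lebesgue S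
        \<le> ennreal \<gamma> * (ennreal (C\<^sub>0 * f) * emeasure lebesgue S) + ennreal \<gamma>\<^sub>1 * emeasure lebesgue S"
      by (intro add_right_mono mult_left_mono) auto
    also have "\<dots> = ennreal (\<gamma> * (C\<^sub>0 * f) + \<gamma>\<^sub>1) * emeasure lebesgue S"
      using \<gamma> C\<^sub>0 f by (simp add: ennreal_mult ennreal_plus distrib_right mult.assoc)
    finally have rhs: "(\<integral>\<^sup>+x\<in>S'. ennreal (A x (norm (?g x))) \<partial>lebesgue)
        \<le> ennreal (\<gamma> * (C\<^sub>0 * f) + \<gamma>\<^sub>1) * emeasure lebesgue S"
      using caccioppoli by (rule order_trans[rotated])
    have Fg: "(\<lambda>x. F (norm (indicator S' x *\<^sub>R ?g x))) \<in> borel_measurable lebesgue"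
      by (rule borel_measurable_gauge_gradient[OF wg Sm(2,4)])
    have "ennreal c\<^sub>0 * (\<integral>\<^sup>+x\<in>S'. ennreal (F (norm (?g x))) \<partial>lebesgue)
        = ennreal c\<^sub>0 * (\<integral>\<^sup>+x. ennreal (F (norm (indicator S' x *\<^sub>R ?g x))) * indicator S' x \<partial>lebesgue)"
      by (rule arg_cong[where f = "\<lambda>z. ennreal c\<^sub>0 * z"], rule nn_integral_cong) (auto simp: indicator_def)
    also have "\<dots> = (\<integral>\<^sup>+x. ennreal c\<^sub>0 * (ennreal (F (norm (indicator S' x *\<^sub>R ?g x))) * indicator S' x) \<partial>lebesgue)"
      using Fg Sm by (intro nn_integral_cmult[symmetric]) auto
    also have "\<dots> \<le> (\<integral>\<^sup>+x\<in>S'. ennreal (A x (norm (?g x))) \<partial>lebesgue)"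
    proof (rule nn_integral_mono)
      fix x
      show "ennreal c\<^sub>0 * (ennreal (F (norm (indicator S' x *\<^sub>R ?g x))) * indicator S' x)
          \<le> ennreal (A x (norm (?g x))) * indicator S' x"
        using lower[of x "norm (?g x)"] Sm(4) c\<^sub>0 F_nonneg[of "norm (?g x)"]
        by (cases "x \<in> S'") (auto simp: ennreal_mult[symmetric] intro!: ennreal_leI)
    qed
    also note rhs
    finally have "ennreal (1 / c\<^sub>0) * (ennreal c\<^sub>0 * (\<integral>\<^sup>+x\<in>S'. ennreal (F (norm (?g x))) \<partial>lebesgue))
        \<le> ennreal (1 / c\<^sub>0) * (ennreal (\<gamma> * (C\<^sub>0 * f) + \<gamma>\<^sub>1) * emeasure lebesgue S)"
      by (intro mult_left_mono) auto
    then have "ennreal (1 / c\<^sub>0 * c\<^sub>0) * (\<integral>\<^sup>+x\<in>S'. ennreal (F (norm (?g x))) \<partial>lebesgue)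
        \<le> ennreal (1 / c\<^sub>0 * (\<gamma> * (C\<^sub>0 * f) + \<gamma>\<^sub>1)) * emeasure lebesgue S"
      using c\<^sub>0 \<gamma> C\<^sub>0 f by (subst (1 2) ennreal_mult) (auto simp only: mult.assoc zero_le_divide_1_iff less_imp_le
          add_nonneg_nonneg mult_nonneg_nonneg)
    moreover have "1 / c\<^sub>0 * (\<gamma> * (C\<^sub>0 * f) + \<gamma>\<^sub>1) = \<gamma> * C\<^sub>0 / c\<^sub>0 * f + \<gamma>\<^sub>1 / c\<^sub>0"
      using c\<^sub>0 by (simp add: field_simps)
    ultimately show ?thesis
      using c\<^sub>0 by (simp add: S_def S'_def f_def \<tau>_def)
  qed
  then show ?thesis
    using wg unfolding energy_class_def by blast
qed

text \<open>The gauge and its constants come from \<open>A\<close> on \<Omega>; \<gamma> enters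
  through \<open>C\<^sub>1\<close> and \<delta> through \<kappa>. All of this is fixed before
  \<open>M\<close> and \<open>\<gamma>\<^sub>1\<close> appear, which affect only \<open>K\<close>
  and \<open>D\<close>.\<close>

theorem theorem3p1:
  fixes \<Omega> :: "(real^'n) set"
    and A :: "real^'n \<Rightarrow> real \<Rightarrow> real"
    and \<gamma> \<delta> :: real
  assumes "CARD('n) \<ge> 2"
    and "bounded \<Omega>" and "smooth_domain \<Omega>"
    and "A \<in> N_class \<Omega>"
    and "cond_A \<Omega> A" and "cond_A1 \<Omega> A" and "cond_C1 \<Omega> A"
    and "\<gamma> > 0" and "\<delta> > 0" and "\<delta> \<le> 2"
  shows "\<exists>\<alpha>. 0 < \<alpha> \<and> \<alpha> < 1 \<and>
           (\<forall>M \<gamma>\<^sub>1. M > 0 \<longrightarrow> \<gamma>\<^sub>1 > 0 \<longrightarrow> class_B \<Omega> A M \<gamma> \<gamma>\<^sub>1 \<delta> \<subseteq> C_Hoelder \<Omega> \<alpha>)"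
proof -
  have \<Omega>: "open \<Omega>" "\<Omega> \<noteq> {}"
    using assms(3) by (auto simp: smooth_domain_def)
  obtain F M\<^sub>0 c\<^sub>0 C\<^sub>0 where gauge: "gauge F M\<^sub>0" and c\<^sub>0: "0 < c\<^sub>0" and C\<^sub>0: "0 < C\<^sub>0"
    and bounds: "\<And>x t. x \<in> \<Omega> \<Longrightarrow> 0 \<le> t \<Longrightarrow> c\<^sub>0 * F t \<le> A x t"
      "\<And>x t. x \<in> \<Omega> \<Longrightarrow> 0 < t \<Longrightarrow> A x t \<le> C\<^sub>0 * F t"
    by (rule gauge_of_conditions[OF \<Omega> assms(4-7)]) blast
  interpret gauge F M\<^sub>0 by (rule gauge)
  define C\<^sub>1 where "C\<^sub>1 = \<gamma> * C\<^sub>0 / c\<^sub>0"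
  have C\<^sub>1: "0 \<le> C\<^sub>1" using assms(8) C\<^sub>0 c\<^sub>0 by (simp add: C\<^sub>1_def)
  obtain \<kappa> Q :: real where \<kappa>: "3 / 4 \<le> \<kappa>" "\<kappa> < 1" "0 \<le> Q" and decay:
    "\<And>(\<Omega>::(real^'n) set) u g g' C\<^sub>2 M K y R D i.
      energy_class \<Omega> F C\<^sub>1 C\<^sub>2 (\<delta> * M) u g \<Longrightarrow> energy_class \<Omega> F C\<^sub>1 C\<^sub>2 (\<delta> * M) (\<lambda>x. - u x) g' \<Longrightarrow>
      0 \<le> C\<^sub>2 \<Longrightarrow> C\<^sub>2 \<le> F K \<Longrightarrow> 0 \<le> K \<Longrightarrow> 0 < R \<Longrightarrow> ball y R \<subseteq> \<Omega> \<Longrightarrow> 0 < M \<Longrightarrow>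
      (AE x in lebesgue. x \<in> \<Omega> \<longrightarrow> \<bar>u x\<bar> \<le> M) \<Longrightarrow> 2 * M \<le> D \<Longrightarrow> Q * K * R \<le> D \<Longrightarrow>
      \<exists>a. AE x in lebesgue. x \<in> ball y (R / 4 ^ i) \<longrightarrow> a \<le> u x \<and> u x \<le> a + D * \<kappa> ^ i"
    by (rule oscillation_decay[OF C\<^sub>1 assms(9,10)]) blast
  \<comment> \<open>One step divides the radius by 4 and multiplies the oscillation by \<kappa>, so
    the exponent solves \<open>\<kappa> = 4 powr - \<alpha>\<close>. It is below 1 because \<kappa>
    exceeds 1 / 4.\<close>
  define \<alpha> where "\<alpha> = - ln \<kappa> / ln 4"
  have \<alpha>: "0 < \<alpha>" "\<alpha> < 1"
  proof -
    show "0 < \<alpha>" using \<kappa> by (simp add: \<alpha>_def divide_neg_pos)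
    have "ln (1 / 4) < ln \<kappa>" using \<kappa> by (subst ln_less_cancel_iff) auto
    then have "- 1 * ln 4 < ln \<kappa>" by (simp add: ln_div)
    then have "- 1 < ln \<kappa> / ln 4" by (subst pos_less_divide_eq) auto
    then show "\<alpha> < 1" by (simp add: \<alpha>_def)
  qed
  have \<kappa>\<alpha>: "\<kappa> = 4 powr - \<alpha>" using \<kappa> by (simp add: \<alpha>_def powr_def)
  have "class_B \<Omega> A M \<gamma> \<gamma>\<^sub>1 \<delta> \<subseteq> C_Hoelder \<Omega> \<alpha>" if M: "0 < M" and \<gamma>\<^sub>1: "0 < \<gamma>\<^sub>1" for M \<gamma>\<^sub>1
  proof
    fix u assume u: "u \<in> class_B \<Omega> A M \<gamma> \<gamma>\<^sub>1 \<delta>"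
    define C\<^sub>2 where "C\<^sub>2 = \<gamma>\<^sub>1 / c\<^sub>0"
    have C\<^sub>2: "0 \<le> C\<^sub>2" using \<gamma>\<^sub>1 c\<^sub>0 by (simp add: C\<^sub>2_def)
    have en: "energy_class \<Omega> F C\<^sub>1 C\<^sub>2 (\<delta> * M) w (weak_gradient \<Omega> w)" if "w \<in> {u, \<lambda>x. - u x}" for w
      unfolding C\<^sub>1_def C\<^sub>2_def
      by (rule class_B_energy_class[OF c\<^sub>0 C\<^sub>0 bounds u assms(8) \<gamma>\<^sub>1 that])
    \<comment> \<open>Superlinearity makes \<open>F\<close> unbounded: for large t at least 1,
      \<open>C\<^sub>2 \<le> C\<^sub>2 * t \<le> F t\<close>.\<close>
    obtain K where K: "0 \<le> K" "C\<^sub>2 \<le> F K"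
    proof -
      have "\<forall>\<^sub>F t in at_top. C\<^sub>2 \<le> F t / t" using F_superlinear unfolding filterlim_at_top by blast
      then obtain T where T: "\<And>t. T \<le> t \<Longrightarrow> C\<^sub>2 \<le> F t / t" unfolding eventually_at_top_linorder by blast
      define t where "t = max T 1"
      have t: "1 \<le> t" "C\<^sub>2 \<le> F t / t" using T[of t] by (auto simp: t_def)
      have "C\<^sub>2 * 1 \<le> C\<^sub>2 * t" using t C\<^sub>2 by (intro mult_left_mono) auto
      also have "\<dots> \<le> F t" using t by (simp add: field_simps)
      finally show ?thesis using that[of t] t by simp
    qed
    have "AE x in lebesgue_on \<Omega>. ereal \<bar>u x\<bar> \<le> esssup (lebesgue_on \<Omega>) (\<lambda>x. ereal \<bar>u x\<bar>)"
      by (rule esssup_AE)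
    moreover have "esssup (lebesgue_on \<Omega>) (\<lambda>x. ereal \<bar>u x\<bar>) \<le> ereal M"
      using u by (simp add: class_B_def)
    ultimately have "AE x in lebesgue_on \<Omega>. \<bar>u x\<bar> \<le> M"
      by (elim eventually_mono) (metis ereal_less_eq(3) order_trans)
    then have bound: "AE x in lebesgue. x \<in> \<Omega> \<longrightarrow> \<bar>u x\<bar> \<le> M"
      using \<Omega>(1) by (subst (asm) AE_restrict_space_iff) auto
    show "u \<in> C_Hoelder \<Omega> \<alpha>"
      unfolding C_Hoelder_def mem_Collect_eq
    proof
      fix x\<^sub>0 assume "x\<^sub>0 \<in> \<Omega>"
      then obtain r where r: "0 < r" "ball x\<^sub>0 r \<subseteq> \<Omega>" using \<Omega>(1) open_contains_ball by blast
      \<comment> \<open>Half of the radius, so that balls of radius \<open>R\<close> about all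
        centres in \<open>ball x\<^sub>0 R\<close> stay in \<Omega>.\<close>
      define R where "R = r / 2"
      have R: "0 < R" using r by (simp add: R_def)
      define D where "D = max (2 * M) (Q * K * R)"
      have D: "0 \<le> D" "2 * M \<le> D" "Q * K * R \<le> D" using M by (auto simp: D_def)
      have osc: "\<exists>a. AE x in lebesgue. x \<in> ball y (R / 4 ^ i) \<longrightarrow> a \<le> u x \<and> u x \<le> a + D * (4 powr - \<alpha>) ^ i"
        if y: "y \<in> ball x\<^sub>0 R" for y i
      proof -
        have "ball y R \<subseteq> ball x\<^sub>0 r"
        proof
          fix z assume "z \<in> ball y R"
          then show "z \<in> ball x\<^sub>0 r"
            using y dist_triangle[of x\<^sub>0 z y] by (simp add: R_def)
        qed
        then have "ball y R \<subseteq> \<Omega>" using r by blast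
        then show ?thesis
          unfolding \<kappa>\<alpha>[symmetric]
          by (intro decay[OF en en C\<^sub>2 K(2,1) R _ M bound D(2,3)]) auto
      qed
      obtain v C where v: "AE x in lebesgue. x \<in> ball x\<^sub>0 (R / 2) \<longrightarrow> v x = u x"
        "\<And>x y. x \<in> ball x\<^sub>0 (R / 2) \<Longrightarrow> y \<in> ball x\<^sub>0 (R / 2) \<Longrightarrow> \<bar>v x - v y\<bar> \<le> C * dist x y powr \<alpha>"
        by (rule Hoelder_from_oscillation_decay[OF R \<alpha>(1) D(1) osc]) blast+
      \<comment> \<open>\<open>v\<close> agrees with \<open>u\<close> only near
        \<open>x\<^sub>0\<close>, whereas \<open>C_Hoelder\<close> asks for a representative on all
        of \<Omega>; outside the small ball \<open>u\<close> itself is kept.\<close>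
      define v' where "v' x = (if x \<in> ball x\<^sub>0 (R / 2) then v x else u x)" for x
      have "AE x in lebesgue_on \<Omega>. v' x = u x"
        using v(1) \<Omega>(1) by (subst AE_restrict_space_iff) (auto simp: v'_def elim!: eventually_mono)
      moreover have "\<forall>x\<in>ball x\<^sub>0 (R / 2). \<forall>y\<in>ball x\<^sub>0 (R / 2). \<bar>v' x - v' y\<bar> \<le> C * dist x y powr \<alpha>"
        using v(2) by (simp add: v'_def)
      moreover have "ball x\<^sub>0 (R / 2) \<subseteq> \<Omega>"
        using r subset_ball[of "R / 2" r x\<^sub>0] by (auto simp: R_def)
      ultimately show "\<exists>R\<^sub>0>0. ball x\<^sub>0 R\<^sub>0 \<subseteq> \<Omega> \<and> (\<exists>v C. (AE x in lebesgue_on \<Omega>. v x = u x) \<and>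
          (\<forall>x\<in>ball x\<^sub>0 R\<^sub>0. \<forall>y\<in>ball x\<^sub>0 R\<^sub>0. \<bar>v x - v y\<bar> \<le> C * dist x y powr \<alpha>))"
        using R by (intro exI[of _ "R / 2"]) auto
    qed
  qed
  then show ?thesis using \<alpha> by blast
qed


end
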